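(* Let $S$ be a polyradial operator on $L^2(\mathbb{R}^d)$ and let $F$ be a polyradial mask (a polyradial tempered distribution on $\mathbb{R}^{2d}$) such that the mixed-state localization operator $F\star S$ is compact. Then the eigenfunctions of $F\star S$ are the product Hermite functions $\{\phi_n\}_{n\in\mathbb{N}_0^d}$, and the $n$-th eigenvalue is $$\lambda_n=\int_{\mathbb{R}^{2d}}(F*a_S)(z)\,W(\phi_n)(z)\,dz=(-1)^{|n|}\int_{V^d}(F*a_S)\Bigl(\sqrt{\tfrac{u}{2\pi}}\Bigr)\Bigl(\prod_{j=1}^dL_{n_j}^0(2u_j)\Bigr)e^{-(u_1+\dots+u_d)}\,du .$$
   Context: Identify $\mathbb{R}^{2d}$ with $\mathbb{C}^d$ via $(x,\omega)\mapsto z=(x_1+i\omega_1,\dots,x_d+i\omega_d)$. For $z=(x,\omega)$, $\pi(z)g(t)=e^{2\pi i\langle t,\omega\rangle}g(t-x)$ and $\alpha_z(S)=\pi(z)S\pi(z)^*$. The mixed-state localization operator is the function-operator convolution $F\star S=\int_{\mathbb{R}^{2d}}F(z)\alpha_z(S)\,dz$, interpreted weakly (as a duality pairing if $F$ is a distribution). Wigner distribution: $W(f,g)(x,\omega)=\int_{\mathbb{R}^d}f(x+\tfrac t2)\overline{g(x-\tfrac t2)}e^{-2\pi i\langle\omega,t\rangle}\,dt$, $W(f)=W(f,f)$. The Weyl symbol $a_S$ of $S$ is the tempered distribution with $\langle Sf,g\rangle=\langle a_S,W(g,f)\rangle$ for Schwartz $f,g$. The Fourier–Wigner transform is $\mathcal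 F_W(S)(z)=e^{-\pi i\langle x,\omega\rangle}\mathrm{tr}(\pi(-z)S)$ for trace class $S$, extended to operators with kernel in $\mathscr{S}'(\mathbb{R}^{2d})$; it satisfies $a_S=\mathcal F_\sigma\mathcal F_W(S)$, where $\mathcal F_\sigma f(z)=\int f(z')e^{-2\pi i\langle Jz,z'\rangle}dz'$ and $J=\begin{pmatrix}0&\mathrm{Id}_d\\-\mathrm{Id}_d&0\end{pmatrix}$. A tempered distribution on $\mathbb{R}^{2d}\cong\mathbb{C}^d$ is polyradial if it is invariant under all maps $(z_1,\dots,z_d)\mapsto(e^{i\theta_1}z_1,\dots,e^{i\theta_d}z_d)$. An operator $S$ on $L^2(\mathbb{R}^d)$ with kernel in $\mathscr{S}'(\mathbb{R}^{2d})$ is a polyradial operator if $\mathcal F_W(S)$ is polyradial (equivalently, $a_S$ is polyradial). The polyradial object $F*a_S$ is regarded, in the last integral, as a function of $(|z_1|,\dots,|z_d|)\in V^d=[0,\infty)^d$; integrals involving distributions are interpreted as pairings. Hermite functions: $\phi_n(t)=\frac{2^{1/4}}{\sqrt{n!}}\bigl(\frac{-1}{2\sqrt{\pi}}\bigr)^ne^{\pi t^2}\frac{d^n}{dt^n}(e^{-2\pi t^2})$ for $n\in\mathbb{N}_0$, and $\phi_n(t)=\prod_j\phi_{n_j}(t_j)$ for $n\in\mathbb{N}_0^d$; they form an orthonormal basis of $L^2(\mathbb{R}^d)$, and the claim is that $(F\star S)\phi_n=\lambda_n\phi_n$ for all $n$. $|n|=\sum_jn_j$, $\sqrt{u/2\pi}$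 is componentwise, $L_n^0(t)=\sum_{j=0}^n(-1)^j\binom{n}{n-j}\frac{t^j}{j!}$. *)

theory Defs
  imports "HOL-Analysis.Analysis"
begin

section \<open>Schwartz functions and tempered distributions\<close>

text \<open>\<open>pderivs [b\<^sub>1, \<dots>, b\<^sub>k] f\<close> is the iterated directional derivative of \<open>f\<close> along
  \<open>b\<^sub>k, \<dots>, b\<^sub>1\<close>; along basis vectors these are the partial derivatives of order \<open>k\<close>.\<close>

fun pderivs :: "'a::euclidean_space list \<Rightarrow> ('a \<Rightarrow> complex) \<Rightarrow> ('a \<Rightarrow> complex)" where
  "pderivs [] f = f"
| "pderivs (b # bs) f = (\<lambda>x. frechet_derivative (pderivs bs f) (at x) b)"

definition smooth_fun :: "('a::euclidean_space \<Rightarrow> complex) \<Rightarrow> bool" where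
  "smooth_fun f \<longleftrightarrow> (\<forall>bs. set bs \<subseteq> Basis \<longrightarrow> (\<forall>x. pderivs bs f differentiable (at x)))"

definition schwartz :: "('a::euclidean_space \<Rightarrow> complex) set" where
  "schwartz = {f. smooth_fun f \<and>
     (\<forall>bs N. set bs \<subseteq> Basis \<longrightarrow> (\<exists>C. \<forall>x. (1 + norm x) ^ N * norm (pderivs bs f x) \<le> C))}"

definition schwartz_norm :: "nat \<Rightarrow> ('a::euclidean_space \<Rightarrow> complex) \<Rightarrow> real" where
  "schwartz_norm N f =
     (SUP (bs, x) \<in> {bs. set bs \<subseteq> Basis \<and> length bs \<le> N} \<times> UNIV.
        (1 + norm x) ^ N * norm (pderivs bs f x))"

text \<open>A distribution acts bilinearly on test functions; its values outside \<^const>\<open>schwartz\<close>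
  are irrelevant.\<close>

type_synonym 'a distr = "('a \<Rightarrow> complex) \<Rightarrow> complex"

definition tempered_distribution :: "'a::euclidean_space distr \<Rightarrow> bool" where
  "tempered_distribution u \<longleftrightarrow>
     (\<forall>f\<in>schwartz. \<forall>g\<in>schwartz. \<forall>c. u (\<lambda>x. c * f x + g x) = c * u f + u g) \<and>
     (\<exists>C N. \<forall>f\<in>schwartz. norm (u f) \<le> C * schwartz_norm N f)"

text \<open>The bracket \<open>\<langle>u, g\<rangle>\<close>, conjugate linear in \<open>g\<close>.\<close>

definition distr_inner :: "'a distr \<Rightarrow> ('a \<Rightarrow> complex) \<Rightarrow> complex" where
  "distr_inner u g = u (\<lambda>x. cnj (g x))"

definition represented_by :: "'a::euclidean_space distr \<Rightarrow> ('a \<Rightarrow> complex) \<Rightarrow> bool" where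
  "represented_by u f \<longleftrightarrow>
     (\<forall>\<phi>\<in>schwartz. integrable lborel (\<lambda>x. f x * \<phi> x) \<and> u \<phi> = (LINT x|lborel. f x * \<phi> x))"

text \<open>The pairing \<open>\<langle>F, h\<rangle> = \<integral> F(z) h(z) dz\<close> of a tempered distribution with a smooth function
  that need not be a test function. It has the value \<open>c\<close> if cutting \<open>h\<close> off by
  \<open>\<eta>(\<epsilon> z)\<close>, with \<open>\<eta>\<close> a test function satisfying \<open>\<eta>(0) = 1\<close>, and letting \<open>\<epsilon>\<close> tend to 0 always
  gives \<open>c\<close>. The value is \<open>F h\<close> if \<open>h\<close> is a test function, and the Lebesgue integral if \<open>F\<close> is a
  function and \<open>F h\<close> is integrable. The first conjunct says that \<open>h\<close> is a multiplier of
  Schwartz space; it holds automatically for the functions to which the pairing is applied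
  below.\<close>

definition has_pairing ::
  "'a::euclidean_space distr \<Rightarrow> ('a \<Rightarrow> complex) \<Rightarrow> complex \<Rightarrow> bool" where
  "has_pairing F h c \<longleftrightarrow>
     (\<forall>\<eta>\<in>schwartz. (\<lambda>z. \<eta> z * h z) \<in> schwartz) \<and>
     (\<forall>\<eta>\<in>schwartz. \<eta> 0 = 1 \<longrightarrow>
        ((\<lambda>\<epsilon>. F (\<lambda>z. \<eta> (\<epsilon> *\<^sub>R z) * h z)) \<longlongrightarrow> c) (at_right (0::real)))"

text \<open>\<open>G = F * a\<close>, that is \<open>\<integral> G(w) \<Phi>(w) dw = \<integral> F(z) (\<integral> a(w - z) \<Phi>(w) dw) dz\<close>.\<close>

definition is_convolution ::
  "'a::euclidean_space distr \<Rightarrow> 'a distr \<Rightarrow> 'a distr \<Rightarrow> bool" where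
  "is_convolution F a G \<longleftrightarrow> tempered_distribution G \<and>
     (\<forall>\<Phi>\<in>schwartz. has_pairing F (\<lambda>z. a (\<lambda>w. \<Phi> (w + z))) (G \<Phi>))"


section \<open>Operators on square integrable functions\<close>

definition square_int :: "('a::euclidean_space \<Rightarrow> complex) set" where
  "square_int = {f \<in> borel_measurable lborel. integrable lborel (\<lambda>x. (norm (f x))\<^sup>2)}"

definition norm_2 :: "('a::euclidean_space \<Rightarrow> complex) \<Rightarrow> real" where
  "norm_2 f = sqrt (LINT x|lborel. (norm (f x))\<^sup>2)"

definition inner_2 :: "('a::euclidean_space \<Rightarrow> complex) \<Rightarrow> ('a \<Rightarrow> complex) \<Rightarrow> complex" where
  "inner_2 f g = (LINT x|lborel. f x * cnj (g x))"

abbreviation ae_eq :: "('a::euclidean_space \<Rightarrow> complex) \<Rightarrow> ('a \<Rightarrow> complex) \<Rightarrow> bool" where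
  "ae_eq f g \<equiv> AE x in lborel. f x = g x"

text \<open>An operator on \<open>L\<^sup>2\<close> acts on functions and respects almost everywhere equality.\<close>

definition L2_operator ::
  "(('a::euclidean_space \<Rightarrow> complex) \<Rightarrow> ('a \<Rightarrow> complex)) \<Rightarrow> bool" where
  "L2_operator T \<longleftrightarrow>
     (\<forall>f\<in>square_int. T f \<in> square_int) \<and>
     (\<forall>f\<in>square_int. \<forall>g\<in>square_int. ae_eq f g \<longrightarrow> ae_eq (T f) (T g)) \<and>
     (\<forall>f\<in>square_int. \<forall>g\<in>square_int. \<forall>c.
        ae_eq (T (\<lambda>x. c * f x + g x)) (\<lambda>x. c * T f x + T g x))"

definition compact_L2_operator ::
  "(('a::euclidean_space \<Rightarrow> complex) \<Rightarrow> ('a \<Rightarrow> complex)) \<Rightarrow> bool" where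
  "compact_L2_operator T \<longleftrightarrow> L2_operator T \<and>
     (\<forall>f :: nat \<Rightarrow> 'a \<Rightarrow> complex. (\<forall>k. f k \<in> square_int \<and> norm_2 (f k) \<le> 1) \<longrightarrow>
        (\<exists>r g. strict_mono (r :: nat \<Rightarrow> nat) \<and> g \<in> square_int \<and>
           (\<lambda>k. norm_2 (\<lambda>x. T (f (r k)) x - g x)) \<longlonglongrightarrow> 0))"

definition L2_eigenpair ::
  "(('a::euclidean_space \<Rightarrow> complex) \<Rightarrow> ('a \<Rightarrow> complex)) \<Rightarrow> ('a \<Rightarrow> complex) \<Rightarrow> complex \<Rightarrow> bool"
  where
  "L2_eigenpair T f c \<longleftrightarrow>
     f \<in> square_int \<and> \<not> ae_eq f (\<lambda>x. 0) \<and> ae_eq (T f) (\<lambda>x. c * f x)"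

definition L2_orthonormal_basis :: "('i \<Rightarrow> 'a::euclidean_space \<Rightarrow> complex) \<Rightarrow> bool" where
  "L2_orthonormal_basis e \<longleftrightarrow>
     (\<forall>i. e i \<in> square_int) \<and>
     (\<forall>i j. inner_2 (e i) (e j) = (if i = j then 1 else 0)) \<and>
     (\<forall>f\<in>square_int. (\<forall>i. inner_2 f (e i) = 0) \<longrightarrow> ae_eq f (\<lambda>x. 0))"


section \<open>Phase space\<close>

text \<open>Phase space \<open>\<real>\<^sup>2\<^sup>d\<close> consists of pairs \<open>(x, \<omega>)\<close>.\<close>

type_synonym 'd phase = "(real ^ 'd) \<times> (real ^ 'd)"

definition to_C :: "'d::finite phase \<Rightarrow> complex ^ 'd" where
  "to_C z = (\<chi> j. Complex (fst z $ j) (snd z $ j))"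

definition of_C :: "complex ^ 'd::finite \<Rightarrow> 'd phase" where
  "of_C w = (\<chi> j. Re (w $ j), \<chi> j. Im (w $ j))"

definition poly_rotation :: "real ^ 'd::finite \<Rightarrow> 'd phase \<Rightarrow> 'd phase" where
  "poly_rotation \<theta> z = of_C (\<chi> j. cis (\<theta> $ j) * to_C z $ j)"

definition poly_abs :: "'d::finite phase \<Rightarrow> real ^ 'd" where
  "poly_abs z = (\<chi> j. norm (to_C z $ j))"

definition polyradial :: "'d::finite phase distr \<Rightarrow> bool" where
  "polyradial u \<longleftrightarrow> (\<forall>\<theta>. \<forall>\<Phi>\<in>schwartz. u (\<lambda>z. \<Phi> (poly_rotation \<theta> z)) = u \<Phi>)"

definition tf_shift ::
  "'d::finite phase \<Rightarrow> (real ^ 'd \<Rightarrow> complex) \<Rightarrow> (real ^ 'd \<Rightarrow> complex)" where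
  "tf_shift z g = (\<lambda>t. cis (2 * pi * (t \<bullet> snd z)) * g (t - fst z))"

definition tf_shift_adj ::
  "'d::finite phase \<Rightarrow> (real ^ 'd \<Rightarrow> complex) \<Rightarrow> (real ^ 'd \<Rightarrow> complex)" where
  "tf_shift_adj z g = (\<lambda>t. cis (- 2 * pi * ((t + fst z) \<bullet> snd z)) * g (t + fst z))"

text \<open>Time-frequency shifts are unitary, so the adjoint is the inverse.\<close>

lemma tf_shift_adj_tf_shift: "tf_shift_adj z (tf_shift z g) = g"
  by (simp add: tf_shift_def tf_shift_adj_def mult.assoc[symmetric] cis_mult)

lemma tf_shift_tf_shift_adj: "tf_shift z (tf_shift_adj z g) = g"
  by (simp add: tf_shift_def tf_shift_adj_def mult.assoc[symmetric] cis_mult)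

definition wigner ::
  "(real ^ 'd::finite \<Rightarrow> complex) \<Rightarrow> (real ^ 'd \<Rightarrow> complex) \<Rightarrow> 'd phase \<Rightarrow> complex" where
  "wigner f g = (\<lambda>(x, \<omega>). LINT t|lborel.
     f (x + (1/2) *\<^sub>R t) * cnj (g (x - (1/2) *\<^sub>R t)) * cis (- 2 * pi * (\<omega> \<bullet> t)))"


section \<open>Operators with tempered kernels\<close>

text \<open>An operator \<open>S\<close> with kernel in \<open>\<S>'(\<real>\<^sup>2\<^sup>d)\<close> maps Schwartz functions to tempered
  distributions. An operator \<open>A\<close> whose values are functions is the instance
  \<open>S f g = \<integral> (A f)(t) g(t) dt\<close>, so that always \<open>\<langle>S f, g\<rangle> = distr_inner (S f) g\<close>.\<close>

type_synonym 'd tempered_op = "(real ^ 'd \<Rightarrow> complex) \<Rightarrow> (real ^ 'd) distr"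

definition has_tempered_kernel :: "'d::finite tempered_op \<Rightarrow> bool" where
  "has_tempered_kernel S \<longleftrightarrow> (\<exists>k :: 'd phase distr. tempered_distribution k \<and>
     (\<forall>f\<in>schwartz. \<forall>g\<in>schwartz. S f g = k (\<lambda>(x, y). g x * f y)))"

definition is_weyl_symbol :: "'d::finite tempered_op \<Rightarrow> 'd phase distr \<Rightarrow> bool" where
  "is_weyl_symbol S a \<longleftrightarrow> tempered_distribution a \<and>
     (\<forall>f\<in>schwartz. \<forall>g\<in>schwartz. distr_inner (S f) g = distr_inner a (wigner g f))"

text \<open>The Fourier-Wigner transform \<open>z \<mapsto> e\<^sup>-\<^sup>\<pi>\<^sup>i\<^sup>x\<^sup>\<omega> tr(\<pi>(-z) A)\<close> of the rank one operator
  \<open>A h = \<langle>h, f\<rangle> g\<close>, for which \<open>tr(\<pi>(-z) A) = \<langle>\<pi>(-z) g, f\<rangle>\<close>.\<close>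

definition fourier_wigner_rank1 ::
  "(real ^ 'd::finite \<Rightarrow> complex) \<Rightarrow> (real ^ 'd \<Rightarrow> complex) \<Rightarrow> 'd phase \<Rightarrow> complex" where
  "fourier_wigner_rank1 g f z = cis (- pi * (fst z \<bullet> snd z)) * inner_2 (tf_shift (- z) g) f"

text \<open>The transform is unitary from Hilbert-Schmidt operators onto \<open>L\<^sup>2(\<real>\<^sup>2\<^sup>d)\<close> and maps
  operators with Schwartz kernels onto Schwartz functions; it extends to operators with tempered
  kernels by duality, \<open>\<langle>\<F>\<^sub>W S, \<F>\<^sub>W A\<rangle> = \<langle>S, A\<rangle>\<close>. Rank one operators \<open>A h = \<langle>h, f\<rangle> g\<close> suffice
  as test operators, and for these \<open>\<langle>S, A\<rangle> = tr(S A\<^sup>*) = \<langle>S f, g\<rangle>\<close>.\<close>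

definition is_fourier_wigner :: "'d::finite tempered_op \<Rightarrow> 'd phase distr \<Rightarrow> bool" where
  "is_fourier_wigner S b \<longleftrightarrow> tempered_distribution b \<and>
     (\<forall>f\<in>schwartz. \<forall>g\<in>schwartz.
        distr_inner (S f) g = distr_inner b (fourier_wigner_rank1 g f))"

definition polyradial_operator :: "'d::finite tempered_op \<Rightarrow> bool" where
  "polyradial_operator S \<longleftrightarrow>
     has_tempered_kernel S \<and> (\<exists>b. is_fourier_wigner S b \<and> polyradial b)"

text \<open>\<open>\<pi>(z) u\<close> for a distribution \<open>u\<close>: \<open>\<langle>\<pi>(z) u, g\<rangle> = \<langle>u, \<pi>(z)\<^sup>* g\<rangle>\<close>.\<close>

definition tf_shift_distr :: "'d::finite phase \<Rightarrow> (real ^ 'd) distr \<Rightarrow> (real ^ 'd) distr" where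
  "tf_shift_distr z u = (\<lambda>\<phi>. distr_inner u (tf_shift_adj z (\<lambda>t. cnj (\<phi> t))))"

definition op_shift :: "'d::finite phase \<Rightarrow> 'd tempered_op \<Rightarrow> 'd tempered_op" where
  "op_shift z S = (\<lambda>f. tf_shift_distr z (S (tf_shift_adj z f)))"

text \<open>The operator \<open>T\<close> on \<open>L\<^sup>2\<close> is \<open>F \<star> S = \<integral> F(z) \<alpha>\<^sub>z(S) dz\<close> in the weak sense.\<close>

definition is_mixed_state_op ::
  "'d::finite phase distr \<Rightarrow> 'd tempered_op \<Rightarrow>
     ((real ^ 'd \<Rightarrow> complex) \<Rightarrow> (real ^ 'd \<Rightarrow> complex)) \<Rightarrow> bool" where
  "is_mixed_state_op F S T \<longleftrightarrow>
     (\<forall>f\<in>schwartz. \<forall>g\<in>schwartz.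
        has_pairing F (\<lambda>z. distr_inner (op_shift z S f) g) (inner_2 (T f) g))"


section \<open>Hermite functions, Laguerre polynomials, integration over \<open>[0,\<infinity>)\<^sup>d\<close>\<close>

definition hermite1 :: "nat \<Rightarrow> real \<Rightarrow> real" where
  "hermite1 n t = 2 powr (1/4) / sqrt (fact n) * (- 1 / (2 * sqrt pi)) ^ n * exp (pi * t\<^sup>2) *
     (deriv ^^ n) (\<lambda>s. exp (- 2 * pi * s\<^sup>2)) t"

definition hermite :: "nat ^ 'd::finite \<Rightarrow> real ^ 'd \<Rightarrow> complex" where
  "hermite n t = of_real (\<Prod>j\<in>UNIV. hermite1 (n $ j) (t $ j))"

definition laguerre :: "nat \<Rightarrow> real \<Rightarrow> real" where
  "laguerre n t = (\<Sum>j=0..n. (- 1) ^ j * real (n choose (n - j)) * t ^ j / fact j)"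

definition Vd :: "(real ^ 'd::finite) set" where
  "Vd = {u. \<forall>j. 0 \<le> u $ j}"

text \<open>For polyradial \<open>G\<close>, regarded as depending on \<open>(|z\<^sub>1|, \<dots>, |z\<^sub>d|)\<close>, the pairing
  \<open>\<integral>\<^bsub>V\<^sup>d\<^esub> G(sqrt (u / 2\<pi>)) \<psi>(u) du\<close>. Polar coordinates with \<open>u\<^sub>j = 2\<pi>|z\<^sub>j|\<^sup>2\<close>, hence
  \<open>du\<^sub>j = 4\<pi>|z\<^sub>j| d|z\<^sub>j|\<close>, turn it into \<open>2\<^sup>d \<integral> G(z) \<psi>(2\<pi>|z\<^sub>1|\<^sup>2, \<dots>, 2\<pi>|z\<^sub>d|\<^sup>2) dz\<close>.\<close>

definition Vd_pairing :: "'d::finite phase distr \<Rightarrow> (real ^ 'd \<Rightarrow> real) \<Rightarrow> complex" where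
  "Vd_pairing G \<psi> =
     2 ^ CARD('d) * G (\<lambda>z. of_real (\<psi> (\<chi> j. 2 * pi * (poly_abs z $ j)\<^sup>2)))"

definition laguerre_weight :: "nat ^ 'd::finite \<Rightarrow> real ^ 'd \<Rightarrow> real" where
  "laguerre_weight n u = (\<Prod>j\<in>UNIV. laguerre (n $ j) (2 * u $ j)) * exp (- (\<Sum>j\<in>UNIV. u $ j))"

end

theory Submission
  imports Defs "HOL-Probability.Characteristic_Functions" "HOL-Real_Asymp.Real_Asymp"
begin

text \<open>Only Hermite functions are used as test functions. With \<open>H(z) = \<langle>\<alpha>\<^sub>z(S) \<phi>\<^sub>n, \<phi>\<^sub>m\<rangle>\<close>, the matrix
  coefficient \<open>\<langle>T \<phi>\<^sub>n, \<phi>\<^sub>m\<rangle>\<close> is the pairing of \<open>F\<close> with \<open>H\<close>. The Fourier-Wigner transform of the rank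
  one operator given by the shifted Hermite functions is that of \<open>\<phi>\<^sub>m\<close> and \<open>\<phi>\<^sub>n\<close> times a symplectic
  character; poly-rotations preserve the symplectic form and multiply the transform of \<open>\<phi>\<^sub>m\<close> and
  \<open>\<phi>\<^sub>n\<close> by a character \<open>\<kappa>\<close>, nontrivial if \<open>n \<noteq> m\<close>. As \<open>S\<close> is polyradial, \<open>H\<close> composed with a
  poly-rotation is \<open>\<kappa> H\<close>, and as \<open>F\<close> is polyradial, its pairing with \<open>H\<close> vanishes for \<open>n \<noteq> m\<close>. For
  \<open>n = m\<close>, covariance of the Wigner distribution gives \<open>H(z) = a(W(\<phi>\<^sub>n)(\<cdot> + z))\<close>, so that the
  coefficient is \<open>(F * a)(W(\<phi>\<^sub>n))\<close>.

  Creation and annihilation operators give a three term recursion for the Wigner distributions of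
  Hermite functions, without differentiating under the integral; its solution is explicit and on the
  diagonal a Laguerre function of \<open>|z|\<^sup>2\<close>.

  For completeness, let \<open>f\<close> be orthogonal to all \<open>\<phi>\<^sub>n\<close>, hence to all polynomials times
  \<open>exp (-\<pi> |x|\<^sup>2)\<close>. Expanding exponentials of quadratic polynomials in power series, dominated by
  a slightly wider Gaussian, yields first orthogonality to polynomials times narrower and narrower
  Gaussians, and then to their translates, which form an approximate identity.\<close>

section \<open>Polynomials times Gaussians\<close>

text \<open>Every test function in the pairings is a polynomial times one Gaussian. This class is
  visibly stable under products, derivatives, affine substitutions and modulations, so membership in
  Schwartz space never rests on general mapping properties of Wigner or Fourier-Wigner transforms.
  The operator \<open>S\<close> enters through two distributions that are never compared: its
  Fourier-Wigner transform carries the symmetry and gives the vanishing off the diagonal, its Weyl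
  symbol gives the values on the diagonal. As \<open>F\<close> is only a distribution, its pairing
  with \<open>H\<close> is a limit over cutoffs; the symmetry argument needs a cutoff that is itself
  rotation invariant, and a Gaussian is one. In the completeness proof the exponential series is
  bounded through absolute values, blind to the sign of its argument. This limits how much narrower
  a Gaussian can become in a single expansion, hence the repeated narrowing before any
  translation.\<close>

inductive_set poly_fun :: "('a::euclidean_space \<Rightarrow> complex) set" where
  const: "(\<lambda>x. c) \<in> poly_fun"
| inner: "(\<lambda>x. of_real (x \<bullet> v)) \<in> poly_fun"
| add: "p \<in> poly_fun \<Longrightarrow> q \<in> poly_fun \<Longrightarrow> (\<lambda>x. p x + q x) \<in> poly_fun"
| mult: "p \<in> poly_fun \<Longrightarrow> q \<in> poly_fun \<Longrightarrow> (\<lambda>x. p x * q x) \<in> poly_fun"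

lemma poly_fun_power: "p \<in> poly_fun \<Longrightarrow> (\<lambda>x. p x ^ k) \<in> poly_fun"
  by (induction k) (auto intro: poly_fun.intros)

lemma poly_fun_sum:
  "(\<And>i. i \<in> I \<Longrightarrow> p i \<in> poly_fun) \<Longrightarrow> (\<lambda>x. \<Sum>i\<in>I. p i x) \<in> poly_fun"
  by (induction I rule: infinite_finite_induct) (auto intro: poly_fun.intros)

lemma poly_fun_prod:
  "(\<And>i. i \<in> I \<Longrightarrow> p i \<in> poly_fun) \<Longrightarrow> (\<lambda>x. \<Prod>i\<in>I. p i x) \<in> poly_fun"
  by (induction I rule: infinite_finite_induct) (auto intro: poly_fun.intros)

lemma poly_fun_inner_self: "(\<lambda>x. of_real (x \<bullet> x)) \<in> poly_fun"
proof -
  have "(\<lambda>x. \<Sum>b\<in>Basis. of_real (x \<bullet> b) * of_real (x \<bullet> b)) \<in> poly_fun"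
    by (intro poly_fun_sum poly_fun.intros)
  then show ?thesis
    by (simp add: euclidean_inner[of x x for x])
qed

lemma poly_fun_cnj: "p \<in> poly_fun \<Longrightarrow> (\<lambda>x. cnj (p x)) \<in> poly_fun"
  by (induction rule: poly_fun.induct) (auto intro: poly_fun.intros)

lemma poly_fun_affine: "p \<in> poly_fun \<Longrightarrow> (\<lambda>x. p (a + s *\<^sub>R x)) \<in> poly_fun"
proof (induction rule: poly_fun.induct)
  case (inner v)
  have "(\<lambda>x. of_real (a \<bullet> v) + of_real (x \<bullet> (s *\<^sub>R v))) \<in> poly_fun"
    by (intro poly_fun.intros)
  then show ?case by (simp add: inner_add_left)
qed (auto intro: poly_fun.intros)

lemma poly_fun_bound:
  "p \<in> poly_fun \<Longrightarrow> \<exists>C k. C \<ge> 0 \<and> (\<forall>x. norm (p x) \<le> C * (1 + norm x) ^ k)"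
proof (induction rule: poly_fun.induct)
  case (const c)
  show ?case by (intro exI[of _ "norm c"] exI[of _ 0]) auto
next
  case (inner v)
  have "norm (complex_of_real (x \<bullet> v)) \<le> norm v * (1 + norm x) ^ 1" for x
    using Cauchy_Schwarz_ineq2[of x v] by (simp add: algebra_simps) (smt (verit) norm_ge_zero)
  then show ?case by (intro exI[of _ "norm v"] exI[of _ 1]) auto
next
  case (add p q)
  then obtain C k D l where C: "C \<ge> 0" "\<And>x. norm (p x) \<le> C * (1 + norm x) ^ k"
    and D: "D \<ge> 0" "\<And>x. norm (q x) \<le> D * (1 + norm x) ^ l" by blast
  have "norm (p x + q x) \<le> (C + D) * (1 + norm x) ^ (k + l)" for x
  proof -
    have "norm (p x + q x) \<le> C * (1 + norm x) ^ k + D * (1 + norm x) ^ l"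
      by (meson C D add_mono norm_triangle_ineq order_trans)
    also have "\<dots> \<le> C * (1 + norm x) ^ (k + l) + D * (1 + norm x) ^ (k + l)"
      using C D by (intro add_mono mult_left_mono power_increasing) auto
    finally show ?thesis by (simp add: algebra_simps)
  qed
  then show ?case using C D by (intro exI[of _ "C + D"] exI[of _ "k + l"]) auto
next
  case (mult p q)
  then obtain C k D l where C: "C \<ge> 0" "\<And>x. norm (p x) \<le> C * (1 + norm x) ^ k"
    and D: "D \<ge> 0" "\<And>x. norm (q x) \<le> D * (1 + norm x) ^ l" by blast
  have "norm (p x * q x) \<le> (C * D) * (1 + norm x) ^ (k + l)" for x
  proof -
    have "norm (p x * q x) \<le> (C * (1 + norm x) ^ k) * (D * (1 + norm x) ^ l)"
      unfolding norm_mult using C D by (intro mult_mono) auto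
    then show ?thesis by (simp add: algebra_simps power_add)
  qed
  then show ?case using C D by (intro exI[of _ "C * D"] exI[of _ "k + l"]) auto
qed

lemma poly_fun_has_derivative:
  "p \<in> poly_fun \<Longrightarrow>
    \<exists>D. (\<forall>x. (p has_derivative D x) (at x)) \<and> (\<forall>v. (\<lambda>x. D x v) \<in> poly_fun)"
proof (induction rule: poly_fun.induct)
  case (const c)
  show ?case by (intro exI[of _ "\<lambda>x v. 0"]) (auto intro: poly_fun.intros)
next
  case (inner v)
  show ?case
    by (intro exI[of _ "\<lambda>x w. of_real (w \<bullet> v)"])
      (auto intro!: poly_fun.intros derivative_eq_intros)
next
  case (add p q)
  then obtain D E where D: "\<And>x. (p has_derivative D x) (at x)" "\<And>v. (\<lambda>x. D x v) \<in> poly_fun"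
    and E: "\<And>x. (q has_derivative E x) (at x)" "\<And>v. (\<lambda>x. E x v) \<in> poly_fun" by metis
  show ?case
    by (intro exI[of _ "\<lambda>x v. D x v + E x v"])
      (auto intro!: poly_fun.intros derivative_eq_intros D E)
next
  case (mult p q)
  then obtain D E where D: "\<And>x. (p has_derivative D x) (at x)" "\<And>v. (\<lambda>x. D x v) \<in> poly_fun"
    and E: "\<And>x. (q has_derivative E x) (at x)" "\<And>v. (\<lambda>x. E x v) \<in> poly_fun" by metis
  show ?case
    by (intro exI[of _ "\<lambda>x v. p x * E x v + D x v * q x"])
      (auto intro!: poly_fun.intros derivative_eq_intros D E mult(1,2))
qed

lemma poly_fun_continuous: "p \<in> poly_fun \<Longrightarrow> continuous_on A p"
  by (induction rule: poly_fun.induct) (auto intro!: continuous_intros)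

text \<open>The linear terms are there for closure: translating a Gaussian produces the real one,
  modulating it the imaginary one.\<close>

definition gaussian_exp :: "real \<Rightarrow> 'a::euclidean_space \<Rightarrow> 'a \<Rightarrow> 'a \<Rightarrow> complex" where
  "gaussian_exp c u v x = exp (of_real (x \<bullet> u - c * (x \<bullet> x)) + \<i> * of_real (x \<bullet> v))"

text \<open>With a single exponential this is not a vector space; sums occur only with a common
  exponential and are collected in the polynomial.\<close>

definition poly_gauss :: "('a::euclidean_space \<Rightarrow> complex) set" where
  "poly_gauss = {\<lambda>x. p x * gaussian_exp c u v x | p c u v. p \<in> poly_fun \<and> c > 0}"

lemma poly_gaussI:
  "p \<in> poly_fun \<Longrightarrow> c > 0 \<Longrightarrow> (\<And>x. f x = p x * gaussian_exp c u v x) \<Longrightarrow> f \<in> poly_gauss"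
  unfolding poly_gauss_def by blast

lemma poly_gaussE:
  assumes "f \<in> poly_gauss"
  obtains p c u v where "p \<in> poly_fun" "c > 0" "f = (\<lambda>x. p x * gaussian_exp c u v x)"
  using assms unfolding poly_gauss_def by blast

lemma poly_gauss_exp: "c > 0 \<Longrightarrow> (\<lambda>x. exp (- of_real (c * (x \<bullet> x)))) \<in> poly_gauss"
  by (rule poly_gaussI[of "\<lambda>_. 1" c _ 0 0]) (auto intro: poly_fun.intros simp: gaussian_exp_def)

lemma poly_gauss_poly_mult:
  assumes "p \<in> poly_fun" "f \<in> poly_gauss" shows "(\<lambda>x. p x * f x) \<in> poly_gauss"
proof -
  obtain q c u v where q: "q \<in> poly_fun" "c > 0" "f = (\<lambda>x. q x * gaussian_exp c u v x)"
    using assms(2) by (rule poly_gaussE)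
  then show ?thesis
    by (intro poly_gaussI[OF poly_fun.mult[OF assms(1) q(1)] q(2)]) (auto simp: mult.assoc)
qed

lemma poly_gauss_cmult: "f \<in> poly_gauss \<Longrightarrow> (\<lambda>x. c * f x) \<in> poly_gauss"
  by (rule poly_gauss_poly_mult) (rule poly_fun.const)

lemma gaussian_exp_mult:
  "gaussian_exp c u v x * gaussian_exp c' u' v' x = gaussian_exp (c + c') (u + u') (v + v') x"
  by (simp add: gaussian_exp_def mult_exp_exp[symmetric] inner_add_right algebra_simps exp_add[symmetric])

lemma poly_gauss_mult:
  assumes "f \<in> poly_gauss" "g \<in> poly_gauss" shows "(\<lambda>x. f x * g x) \<in> poly_gauss"
proof -
  obtain p c u v where p: "p \<in> poly_fun" "c > 0" "f = (\<lambda>x. p x * gaussian_exp c u v x)"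
    using assms(1) by (rule poly_gaussE)
  obtain q c' u' v' where q: "q \<in> poly_fun" "c' > 0" "g = (\<lambda>x. q x * gaussian_exp c' u' v' x)"
    using assms(2) by (rule poly_gaussE)
  have "f x * g x = (p x * q x) * gaussian_exp (c + c') (u + u') (v + v') x" for x
    unfolding gaussian_exp_mult[symmetric] p q by simp
  then show ?thesis
    using p q by (intro poly_gaussI[of "\<lambda>x. p x * q x" "c + c'"]) (auto intro: poly_fun.intros)
qed

lemma poly_gauss_cnj:
  assumes "f \<in> poly_gauss" shows "(\<lambda>x. cnj (f x)) \<in> poly_gauss"
proof -
  obtain p c u v where p: "p \<in> poly_fun" "c > 0" "f = (\<lambda>x. p x * gaussian_exp c u v x)"
    using assms by (rule poly_gaussE)
  then have "cnj (f x) = cnj (p x) * gaussian_exp c u (- v) x" for x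
    by (simp add: gaussian_exp_def exp_cnj)
  then show ?thesis
    using p by (intro poly_gaussI[of "\<lambda>x. cnj (p x)" c]) (auto intro: poly_fun_cnj)
qed

lemma poly_gauss_affine:
  assumes "f \<in> poly_gauss" "s \<noteq> 0" shows "(\<lambda>x. f (a + s *\<^sub>R x)) \<in> poly_gauss"
proof -
  obtain p c u v where p: "p \<in> poly_fun" "c > 0" "f = (\<lambda>x. p x * gaussian_exp c u v x)"
    using assms(1) by (rule poly_gaussE)
  \<comment> \<open>When the square is expanded, the cross term joins the real linear part and the
    terms without \<open>x\<close> form the value at \<open>a\<close>.\<close>
  have "gaussian_exp c u v (a + s *\<^sub>R x) =
      gaussian_exp c u v a * gaussian_exp (c * s\<^sup>2) (s *\<^sub>R u - (2 * c * s) *\<^sub>R a) (s *\<^sub>R v) x" for x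
    unfolding gaussian_exp_def exp_add[symmetric]
    by (rule arg_cong[where f = exp])
      (simp add: inner_simps algebra_simps power2_eq_square inner_commute)
  then have "f (a + s *\<^sub>R x) = (p (a + s *\<^sub>R x) * gaussian_exp c u v a) *
      gaussian_exp (c * s\<^sup>2) (s *\<^sub>R u - (2 * c * s) *\<^sub>R a) (s *\<^sub>R v) x" for x
    by (simp add: p)
  then show ?thesis
    using p assms(2)
    by (intro poly_gaussI[of "\<lambda>x. p (a + s *\<^sub>R x) * gaussian_exp c u v a" "c * s\<^sup>2"])
      (auto intro: poly_fun.intros poly_fun_affine)
qed

lemma poly_gauss_cis:
  assumes "f \<in> poly_gauss" shows "(\<lambda>x. cis (r + x \<bullet> w) * f x) \<in> poly_gauss"
proof -
  obtain p c u v where p: "p \<in> poly_fun" "c > 0" "f = (\<lambda>x. p x * gaussian_exp c u v x)"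
    using assms by (rule poly_gaussE)
  have "cis (r + x \<bullet> w) * f x = (cis r * p x) * gaussian_exp c u (v + w) x" for x
    by (simp add: p gaussian_exp_def cis_conv_exp exp_add inner_add_right distrib_left)
  then show ?thesis
    using p by (intro poly_gaussI[of "\<lambda>x. cis r * p x" c]) (auto intro: poly_fun.intros)
qed

lemma gaussian_exp_has_derivative:
  "(gaussian_exp c u v has_derivative
     (\<lambda>h. gaussian_exp c u v x * (of_real (h \<bullet> u - 2 * c * (x \<bullet> h)) + \<i> * of_real (h \<bullet> v)))) (at x)"
proof -
  let ?L = "\<lambda>h. complex_of_real (h \<bullet> u - 2 * c * (x \<bullet> h)) + \<i> * of_real (h \<bullet> v)"
  have "((\<lambda>x. complex_of_real (x \<bullet> u - c * (x \<bullet> x)) + \<i> * of_real (x \<bullet> v)) has_derivative ?L) (at x)"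
    by (auto intro!: derivative_eq_intros simp: algebra_simps inner_commute)
  from has_derivative_compose[OF this has_field_derivative_imp_has_derivative[OF DERIV_exp]]
  show ?thesis
    unfolding gaussian_exp_def[abs_def] .
qed

text \<open>Differentiation leaves the exponential unchanged and only brings down a polynomial of
  degree one, so the class absorbs iterated partial derivatives.\<close>

lemma poly_gauss_has_derivative:
  assumes "f \<in> poly_gauss"
  shows "\<exists>D. (\<forall>x. (f has_derivative D x) (at x)) \<and> (\<forall>v. (\<lambda>x. D x v) \<in> poly_gauss)"
proof -
  obtain p c u v where p: "p \<in> poly_fun" "c > 0" "f = (\<lambda>x. p x * gaussian_exp c u v x)"
    using assms by (rule poly_gaussE)
  obtain E where E: "\<And>x. (p has_derivative E x) (at x)" "\<And>v. (\<lambda>x. E x v) \<in> poly_fun"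
    using poly_fun_has_derivative[OF p(1)] by metis
  define g where "g x h = E x h +
      p x * (of_real (h \<bullet> u - 2 * c * (x \<bullet> h)) + \<i> * of_real (h \<bullet> v))" for x h
  have "(f has_derivative (\<lambda>h. g x h * gaussian_exp c u v x)) (at x)" for x
    unfolding p(3)
    by (rule derivative_eq_intros E gaussian_exp_has_derivative refl)+
      (simp add: g_def algebra_simps)
  moreover have "(\<lambda>x. g x h * gaussian_exp c u v x) \<in> poly_gauss" for h
  proof (rule poly_gaussI[OF _ p(2) refl])
    have "(\<lambda>x. E x h + p x * ((of_real (h \<bullet> u) + of_real (- 2 * c) * of_real (x \<bullet> h))
        + \<i> * of_real (h \<bullet> v))) \<in> poly_fun"
      by (intro poly_fun.intros p E)
    then show "(\<lambda>x. g x h) \<in> poly_fun" by (simp add: g_def[abs_def])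
  qed
  ultimately show ?thesis by (intro exI[of _ "\<lambda>x h. g x h * gaussian_exp c u v x"]) blast
qed

lemma poly_gauss_frechet_derivative:
  assumes "f \<in> poly_gauss" shows "(\<lambda>x. frechet_derivative f (at x) b) \<in> poly_gauss"
proof -
  obtain D where D: "\<And>x. (f has_derivative D x) (at x)" "\<And>v. (\<lambda>x. D x v) \<in> poly_gauss"
    using poly_gauss_has_derivative[OF assms] by metis
  have "frechet_derivative f (at x) = D x" for x
    using frechet_derivative_at[OF D(1)] by simp
  then show ?thesis using D(2) by simp
qed

lemma poly_gauss_pderivs: "f \<in> poly_gauss \<Longrightarrow> pderivs bs f \<in> poly_gauss"
  by (induction bs) (auto intro: poly_gauss_frechet_derivative)

lemma poly_gauss_differentiable: "f \<in> poly_gauss \<Longrightarrow> f differentiable (at x)"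
  using poly_gauss_has_derivative unfolding differentiable_def by blast

lemma poly_gauss_continuous: "f \<in> poly_gauss \<Longrightarrow> continuous_on A f"
  by (meson continuous_at_imp_continuous_on differentiable_imp_continuous_within
      poly_gauss_differentiable)

lemma poly_gauss_measurable: "f \<in> poly_gauss \<Longrightarrow> f \<in> borel_measurable borel"
  by (intro borel_measurable_continuous_onI poly_gauss_continuous)

text \<open>Half of the quadratic exponent is spent on absorbing the polynomial and the linear
  exponent; the other half remains as decay.\<close>

lemma poly_gauss_decay:
  assumes "f \<in> poly_gauss"
  shows "\<exists>C k. 0 < k \<and> 0 \<le> C \<and> (\<forall>x. norm (f x) \<le> C * exp (- (k * (x \<bullet> x))))"
proof -
  obtain p c u v where p: "p \<in> poly_fun" "c > 0" "f = (\<lambda>x. p x * gaussian_exp c u v x)"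
    using assms by (rule poly_gaussE)
  obtain C k where C: "C \<ge> 0" "\<And>x. norm (p x) \<le> C * (1 + norm x) ^ k"
    using poly_fun_bound[OF p(1)] by blast
  \<comment> \<open>With \<open>r = norm x\<close>, two bounds are combined:
    \<open>(1 + r) ^ k \<le> fact k * exp (1 + r)\<close>, from one term of the exponential series,
    and a completed square that bounds \<open>r * (1 + norm u)\<close> by
    \<open>c / 2 * r\<^sup>2\<close> plus a constant.\<close>
  define K where "K = C * (fact k * exp (1 + (1 + norm u)\<^sup>2 / (2 * c)))"
  have "norm (f x) \<le> K * exp (- ((c / 2) * (x \<bullet> x)))" for x
  proof -
    define r where "r = norm x"
    have "(1 + r) ^ k \<le> fact k * exp (1 + r)"
    proof -
      have "(1 + r) ^ k / fact k \<le> (\<Sum>i<Suc k. (1 + r) ^ i / fact i)"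
        by (rule member_le_sum) (auto simp: r_def)
      also have "\<dots> \<le> exp (1 + r)"
        unfolding exp_def using summable_exp_generic[of "1 + r"]
        by (intro order_trans[OF _ sum_le_suminf[of _ "{..<Suc k}"]]) (auto simp: r_def scaleR_conv_of_real field_simps)
      finally show ?thesis by (simp add: field_simps)
    qed
    moreover have "x \<bullet> u \<le> r * norm u"
      unfolding r_def by (rule norm_cauchy_schwarz)
    moreover have "r * (1 + norm u) \<le> (1 + norm u)\<^sup>2 / (2 * c) + c / 2 * r\<^sup>2"
    proof -
      have "0 \<le> (1 + norm u - c * r)\<^sup>2" by simp
      then have "2 * c * (r * (1 + norm u)) \<le> (1 + norm u)\<^sup>2 + c\<^sup>2 * r\<^sup>2"
        by (simp add: power2_eq_square algebra_simps)
      then show ?thesis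
        using p(2) by (simp add: field_simps power2_eq_square)
    qed
    ultimately have "(1 + r) ^ k * exp (x \<bullet> u - c * r\<^sup>2) \<le>
        (fact k * exp (1 + r)) * exp (r * norm u - c * r\<^sup>2)"
      by (intro mult_mono) (auto simp: r_def)
    also have "\<dots> = fact k * exp (1 + r * (1 + norm u) - c * r\<^sup>2)"
      by (simp add: mult_exp_exp algebra_simps)
    also have "\<dots> \<le> fact k * exp (1 + (1 + norm u)\<^sup>2 / (2 * c) + - (c / 2 * r\<^sup>2))"
      using \<open>r * (1 + norm u) \<le> _\<close> by (intro mult_left_mono) auto
    finally have *: "(1 + r) ^ k * exp (x \<bullet> u - c * r\<^sup>2) \<le>
        fact k * exp (1 + (1 + norm u)\<^sup>2 / (2 * c)) * exp (- (c / 2 * r\<^sup>2))"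
      by (simp add: mult_exp_exp mult.assoc)
    have "norm (f x) \<le> (C * (1 + r) ^ k) * exp (x \<bullet> u - c * r\<^sup>2)"
      unfolding p(3) norm_mult gaussian_exp_def r_def
      by (intro mult_mono C) (auto simp: norm_exp_eq_Re C power2_norm_eq_inner)
    also have "\<dots> \<le> C * (fact k * exp (1 + (1 + norm u)\<^sup>2 / (2 * c)) * exp (- (c / 2 * r\<^sup>2)))"
      unfolding mult.assoc[of C] by (intro mult_left_mono C) (use * in \<open>simp add: mult.assoc\<close>)
    finally show ?thesis
      by (simp add: K_def r_def power2_norm_eq_inner mult.assoc)
  qed
  then show ?thesis
    using p(2) C(1) by (intro exI[of _ K] exI[of _ "c / 2"]) (auto simp: K_def)
qed

lemma poly_gauss_bounded: "f \<in> poly_gauss \<Longrightarrow> \<exists>C. \<forall>x. norm (f x) \<le> C"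
proof -
  assume "f \<in> poly_gauss"
  then obtain C k where C: "0 < k" "0 \<le> C" "\<And>x. norm (f x) \<le> C * exp (- (k * (x \<bullet> x)))"
    using poly_gauss_decay by blast
  have "norm (f x) \<le> C" for x
    using C(1,2) by (intro order_trans[OF C(3)] mult_left_le) auto
  then show ?thesis by blast
qed

text \<open>Derivatives and polynomial multiples stay in the class, so boundedness of its members
  yields every seminorm. As \<open>1 + norm x\<close> is not a polynomial, it is replaced by the
  larger \<open>2 + x \<bullet> x\<close>.\<close>

lemma poly_gauss_schwartz: "poly_gauss \<subseteq> schwartz"
proof
  fix f :: "'a \<Rightarrow> complex" assume f: "f \<in> poly_gauss"
  show "f \<in> schwartz"
    unfolding schwartz_def smooth_fun_def
  proof (intro CollectI conjI allI impI)
    fix bs :: "'a list" and x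
    show "pderivs bs f differentiable (at x)"
      by (intro poly_gauss_differentiable poly_gauss_pderivs f)
  next
    fix bs :: "'a list" and N
    define g where "g = pderivs bs f"
    have g: "g \<in> poly_gauss" unfolding g_def by (intro poly_gauss_pderivs f)
    have q: "(\<lambda>x::'a. (2 + of_real (x \<bullet> x)) ^ N) \<in> poly_fun"
      by (intro poly_fun_power poly_fun.add poly_fun.const poly_fun_inner_self)
    obtain C where C: "\<And>x. norm ((2 + of_real (x \<bullet> x)) ^ N * g x) \<le> C"
      using poly_gauss_bounded[OF poly_gauss_poly_mult[OF q g]] by blast
    have "(1 + norm x) ^ N * norm (g x) \<le> C" for x
    proof -
      have "0 \<le> (norm x - 1/2)\<^sup>2" by simp
      then have "1 + norm x \<le> 2 + x \<bullet> x"
        by (simp add: power2_norm_eq_inner[symmetric] power2_eq_square algebra_simps)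
      then have "(1 + norm x) ^ N * norm (g x) \<le> (2 + x \<bullet> x) ^ N * norm (g x)"
        by (intro mult_right_mono power_mono) auto
      also have "\<dots> = norm ((2 + of_real (x \<bullet> x)) ^ N * g x)"
      proof -
        have "norm (2 + complex_of_real (x \<bullet> x)) = 2 + x \<bullet> x"
          by (metis abs_of_nonneg add_nonneg_nonneg inner_ge_zero norm_of_real of_real_add of_real_numeral zero_le_numeral)
        then show ?thesis by (simp add: norm_mult norm_power)
      qed
      finally show ?thesis using C[of x] by linarith
    qed
    then show "\<exists>C. \<forall>x. (1 + norm x) ^ N * norm (pderivs bs f x) \<le> C"
      unfolding g_def by blast
  qed
qed

section \<open>Gaussian integrals and integrability\<close>

lemma integrable_gauss_real:
  assumes "0 < (k::real)" shows "integrable lborel (\<lambda>x. exp (- (k * x\<^sup>2)))"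
proof -
  \<comment> \<open>The standard deviation for which \<open>1 / (2 * s\<^sup>2) = k\<close>.\<close>
  define s where "s = sqrt (1 / (2 * k))"
  have "normal_density 0 s x = exp (- (k * x\<^sup>2)) / sqrt (2 * pi * s\<^sup>2)" for x
    using assms by (simp add: normal_density_def s_def field_simps)
  then have "exp (- (k * x\<^sup>2)) = sqrt (2 * pi * s\<^sup>2) * normal_density 0 s x" for x
    using assms by (simp add: s_def)
  moreover have "s > 0" using assms by (simp add: s_def)
  ultimately show ?thesis by simp
qed

lemma integrable_gauss:
  assumes "0 < k" shows "integrable lborel (\<lambda>x::'a::euclidean_space. exp (- (k * (x \<bullet> x))))"
proof (rule integrableI_nonneg)
  have "exp (- (k * (x \<bullet> x))) = (\<Prod>b\<in>Basis. exp (- (k * (x \<bullet> b)\<^sup>2)))" for x :: 'a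
    by (simp add: exp_sum[symmetric] sum_negf sum_distrib_left[symmetric]
        euclidean_inner[of x x] power2_eq_square)
  then have "(\<integral>\<^sup>+x. ennreal (exp (- (k * (x \<bullet> x)))) \<partial>(lborel :: 'a measure)) =
     (\<integral>\<^sup>+x. (\<Prod>b\<in>Basis. ennreal (exp (- (k * (x \<bullet> b)\<^sup>2)))) \<partial>(lborel :: 'a measure))"
    by (simp add: prod_ennreal)
  also have "\<dots> = (\<Prod>b\<in>(Basis::'a set). \<integral>\<^sup>+x. ennreal (exp (- (k * x\<^sup>2))) \<partial>lborel)"
    by (subst nn_integral_lborel_prod) auto
  also have "\<dots> < \<infinity>"
    using integrable_gauss_real[OF assms]
    by (auto simp: real_integrable_def less_top power_less_top_ennreal)
  finally show "(\<integral>\<^sup>+x. ennreal (exp (- (k * (x \<bullet> x)))) \<partial>(lborel :: 'a measure)) < \<infinity>" .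
qed auto

lemma poly_gauss_integrable:
  assumes "f \<in> poly_gauss" shows "integrable lborel f"
proof -
  obtain C k where C: "0 < k" "0 \<le> C" "\<And>x. norm (f x) \<le> C * exp (- (k * (x \<bullet> x)))"
    using poly_gauss_decay[OF assms] by blast
  show ?thesis
    by (rule Bochner_Integration.integrable_bound[of _ "\<lambda>x. C * exp (- (k * (x \<bullet> x)))"])
      (use C in \<open>auto intro!: integrable_mult_right integrable_gauss poly_gauss_measurable assms
        simp: abs_mult\<close>)
qed

lemma poly_gauss_square_int: assumes "f \<in> poly_gauss" shows "f \<in> square_int"
proof -
  have "integrable lborel (\<lambda>x. Re (f x * cnj (f x)))"
    by (intro integrable_Re poly_gauss_integrable poly_gauss_mult poly_gauss_cnj assms)
  then show ?thesis
    using poly_gauss_measurable[OF assms]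
    by (simp add: square_int_def complex_norm_square[symmetric] cmod_power2 power2_eq_square)
qed

section \<open>Integration in coordinates\<close>

lemma prod_Basis_vec: "(\<Prod>b\<in>(Basis :: (real ^ 'd::finite) set). f b) = (\<Prod>j\<in>UNIV. f (axis j 1))"
proof -
  have *: "(Basis :: (real ^ 'd) set) = (\<lambda>j. axis j 1) ` UNIV"
    by (auto simp: Basis_vec_def)
  show ?thesis
    unfolding * by (subst prod.reindex) (auto simp: inj_on_def axis_eq_axis)
qed

lemma measurable_vec_lambda:
  assumes "\<And>j. (\<lambda>x. f x j) \<in> borel_measurable M"
  shows "(\<lambda>x. (\<chi> j. f x j) :: real ^ 'd::finite) \<in> borel_measurable M"
  by (subst borel_measurable_euclidean_space) (use assms in \<open>auto simp: Basis_vec_def inner_axis\<close>)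

lemma borel_measurable_vec_nth [measurable]:
  "(\<lambda>x :: real ^ 'd::finite. x $ j) \<in> borel_measurable borel"
  by (intro borel_measurable_continuous_onI continuous_intros)

lemma nn_integral_lborel_vec_prod:
  fixes f :: "'d::finite \<Rightarrow> real \<Rightarrow> ennreal"
  assumes [measurable]: "\<And>j. f j \<in> borel_measurable borel"
  shows "(\<integral>\<^sup>+x. (\<Prod>j\<in>UNIV. f j (x $ j)) \<partial>lborel) = (\<Prod>j\<in>UNIV. \<integral>\<^sup>+x. f j x \<partial>lborel)"
proof -
  define g where "g b = f (THE j. b = axis j 1)" for b :: "real ^ 'd"
  have g: "g (axis j 1) = f j" for j
    unfolding g_def by (simp add: axis_eq_axis)
  have "(\<integral>\<^sup>+x. (\<Prod>b\<in>Basis. g b (x \<bullet> b)) \<partial>lborel) = (\<Prod>b\<in>Basis. \<integral>\<^sup>+x. g b x \<partial>lborel)"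
    by (rule nn_integral_lborel_prod) (auto simp: g_def)
  then show ?thesis by (simp add: prod_Basis_vec g inner_axis)
qed

lemma measurable_vec_lambda_PiM [measurable]:
  "vec_lambda \<in> borel_measurable (Pi\<^sub>M UNIV (\<lambda>_::'d::finite. lborel :: real measure))"
proof -
  have "(\<lambda>f. f j) \<in> borel_measurable (Pi\<^sub>M UNIV (\<lambda>_::'d. lborel :: real measure))" for j
    by measurable
  then show ?thesis
    using measurable_vec_lambda[of "\<lambda>f j. f j" "Pi\<^sub>M UNIV (\<lambda>_::'d. lborel :: real measure)"]
    by blast
qed

text \<open>Fubini for complex products of functions of one coordinate each is a statement about
  product measures; this identification carries it over to \<open>real ^ 'd\<close>.\<close>

lemma lborel_vec_eq:
  "(lborel :: (real ^ 'd::finite) measure) =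
     distr (Pi\<^sub>M UNIV (\<lambda>_. lborel)) borel vec_lambda"
proof (rule lborel_eqI)
  interpret product_sigma_finite "\<lambda>_::'d. lborel :: real measure" ..
  fix l u :: "real ^ 'd"
  assume le: "\<And>b. b \<in> Basis \<Longrightarrow> l \<bullet> b \<le> u \<bullet> b"
  have le': "l $ j \<le> u $ j" for j
    using le[of "axis j 1"] by (simp add: inner_axis axis_in_Basis_iff)
  have "vec_lambda -` box l u \<inter> space (Pi\<^sub>M UNIV (\<lambda>_. lborel)) =
      Pi\<^sub>E UNIV (\<lambda>j. {l $ j <..< u $ j})"
    by (auto simp: space_PiM mem_box_cart PiE_iff)
  then show "emeasure (distr (Pi\<^sub>M UNIV (\<lambda>_. lborel)) borel vec_lambda) (box l u) =
      ennreal (\<Prod>b\<in>Basis. (u - l) \<bullet> b)"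
    by (simp add: emeasure_distr emeasure_PiM prod_Basis_vec le' inner_axis prod_ennreal)
qed simp

lemma integral_vec_prod:
  fixes f :: "'d::finite \<Rightarrow> real \<Rightarrow> complex"
  assumes f: "\<And>j. integrable lborel (f j)"
  shows "(LINT x|lborel. (\<Prod>j\<in>UNIV. f j (x $ j))) = (\<Prod>j\<in>UNIV. (LINT x|lborel. f j x))"
proof -
  interpret product_sigma_finite "\<lambda>_::'d. lborel :: real measure" ..
  have [measurable]: "f j \<in> borel_measurable borel" for j
    using f[of j] by (simp add: borel_measurable_integrable)
  have m2: "(\<lambda>x. \<Prod>j\<in>UNIV. f j (x $ j)) \<in> borel_measurable borel"
    by measurable
  show "(LINT x|lborel. (\<Prod>j\<in>UNIV. f j (x $ j))) = (\<Prod>j\<in>UNIV. (LINT x|lborel. f j x))"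
    by (subst lborel_vec_eq, subst integral_distr[OF measurable_vec_lambda_PiM m2])
      (use f in \<open>auto intro: product_integral_prod\<close>)
qed

lemma integral_affine:
  fixes f :: "'a::euclidean_space \<Rightarrow> complex"
  assumes c: "c \<noteq> 0" and f [measurable]: "f \<in> borel_measurable borel"
  shows "(LINT x|lborel. f x) = \<bar>c\<bar> ^ DIM('a) *\<^sub>R (LINT x|lborel. f (t + c *\<^sub>R x))"
proof -
  have m [measurable]: "(\<lambda>x::'a. t + c *\<^sub>R x) \<in> borel_measurable borel" by simp
  have eq: "(lborel :: 'a measure) =
      density (distr lborel borel (\<lambda>x. t + c *\<^sub>R x)) (\<lambda>_. ennreal (\<bar>c\<bar> ^ DIM('a)))"
    using lborel_affine[OF c, of t] by (simp add: ennreal_power)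
  have "(LINT x|lborel. f x) = (LINT x|density (distr lborel borel (\<lambda>x. t + c *\<^sub>R x))
      (\<lambda>_. ennreal (\<bar>c\<bar> ^ DIM('a))). f x)"
    by (subst eq) simp
  also have "\<dots> = \<bar>c\<bar> ^ DIM('a) *\<^sub>R (LINT x|lborel. f (t + c *\<^sub>R x))"
    by (simp add: integral_density integral_distr)
  finally show "(LINT x|lborel. f x) = \<bar>c\<bar> ^ DIM('a) *\<^sub>R (LINT x|lborel. f (t + c *\<^sub>R x))" .
qed

section \<open>Integration by parts and the Fourier transform of a Gaussian\<close>

lemma poly_gauss_tendsto_0:
  assumes "(f :: real \<Rightarrow> complex) \<in> poly_gauss"
  shows "(f \<longlongrightarrow> 0) at_top" "(f \<longlongrightarrow> 0) at_bot"
proof -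
  obtain C k where C: "0 < k" "0 \<le> C" "\<And>x. norm (f x) \<le> C * exp (- (k * (x * x)))"
    using poly_gauss_decay[OF assms] by auto
  have 1: "((\<lambda>x::real. C * exp (- (k * (x * x)))) \<longlongrightarrow> 0) at_top"
    using C(1) by real_asymp
  have 2: "((\<lambda>x::real. C * exp (- (k * (x * x)))) \<longlongrightarrow> 0) at_bot"
    using C(1) by real_asymp
  show "(f \<longlongrightarrow> 0) at_top"
    by (rule Lim_null_comparison[OF _ 1]) (use C in auto)
  show "(f \<longlongrightarrow> 0) at_bot"
    by (rule Lim_null_comparison[OF _ 2]) (use C in auto)
qed

lemma poly_gauss_vector_derivative:
  assumes f: "f \<in> poly_gauss" and d: "\<And>x. (f has_vector_derivative f' x) (at x)"
  shows "f' \<in> poly_gauss"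
proof -
  obtain D where D: "\<And>x. (f has_derivative D x) (at x)" "\<And>v. (\<lambda>x. D x v) \<in> poly_gauss"
    using poly_gauss_has_derivative[OF f] by metis
  have "D x = (\<lambda>h. h *\<^sub>R f' x)" for x
    using has_derivative_unique[OF D(1) d[unfolded has_vector_derivative_def]] .
  then have "D x 1 = f' x" for x by simp
  then show ?thesis using D(2)[of 1] by simp
qed

text \<open>Gaussian decay removes the boundary values. This is the only integration by parts in
  use: orthonormality and the recursions for Wigner distributions both come from integrating a
  derivative to 0.\<close>

lemma integral_poly_gauss_deriv:
  fixes f f' :: "real \<Rightarrow> complex"
  assumes f: "f \<in> poly_gauss" and d: "\<And>x. (f has_vector_derivative f' x) (at x)"
  shows "(LINT x|lborel. f' x) = 0"
proof -
  have f': "f' \<in> poly_gauss"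
    using f d by (rule poly_gauss_vector_derivative)
  have "(LBINT x=-\<infinity>..\<infinity>. f' x) = 0 - 0"
  proof (rule interval_integral_FTC_integrable[where F = f])
    show "set_integrable lborel (einterval (-\<infinity>) \<infinity>) f'"
      using poly_gauss_integrable[OF f'] by (simp add: set_integrable_def)
    show "isCont f' x" for x
      using poly_gauss_continuous[OF f', of UNIV] by (simp add: continuous_on_eq_continuous_at)
    show "((f \<circ> real_of_ereal) \<longlongrightarrow> 0) (at_right (-\<infinity>))"
      using poly_gauss_tendsto_0(2)[OF f] by (simp add: ereal_tendsto_simps)
    show "((f \<circ> real_of_ereal) \<longlongrightarrow> 0) (at_left \<infinity>)"
      using poly_gauss_tendsto_0(1)[OF f] by (simp add: ereal_tendsto_simps)
  qed (use d in auto)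
  then show ?thesis
    by (simp add: interval_lebesgue_integral_def set_lebesgue_integral_def)
qed

text \<open>This is the characteristic function of the standard normal distribution at
  \<open>- (w * (2 * sqrt pi))\<close>, after the substitution
  \<open>x = sqrt pi * t\<close>.\<close>

lemma integral_gauss_char:
  "(LINT t|lborel. of_real (exp (- (pi * t\<^sup>2 / 2))) * cis (- 2 * pi * (w * t))) =
     of_real (sqrt 2 * exp (- 2 * pi * w\<^sup>2))"
proof -
  define s where "s = 1 / sqrt pi"
  have s: "s > 0" by (simp add: s_def)
  have "complex_of_real (exp (- (w * (2 * sqrt pi))\<^sup>2 / 2)) = char std_normal_distribution (- (w * (2 * sqrt pi)))"
    by (simp add: char_std_normal_distribution)
  also have "\<dots> = (LINT x|lborel. std_normal_density x *\<^sub>R cis (- (w * (2 * sqrt pi)) * x))"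
    unfolding char_def by (subst integral_density) (auto simp: cis_conv_exp)
  also have "\<dots> = sqrt pi *\<^sub>R (LINT t|lborel. std_normal_density (0 + sqrt pi * t) *\<^sub>R cis (- (w * (2 * sqrt pi)) * (0 + sqrt pi * t)))"
    by (subst lborel_integral_real_affine[of "sqrt pi" _ 0]) auto
  also have "(\<lambda>t. std_normal_density (0 + sqrt pi * t) *\<^sub>R cis (- (w * (2 * sqrt pi)) * (0 + sqrt pi * t))) =
     (\<lambda>t. (1 / (sqrt 2 * sqrt pi)) *\<^sub>R (of_real (exp (- (pi * t\<^sup>2 / 2))) * cis (- 2 * pi * (w * t))))"
  proof
    fix t
    have "- (w * (2 * sqrt pi)) * (0 + sqrt pi * t) = - 2 * pi * (w * t)"
    proof -
      have "- (w * (2 * sqrt pi)) * (0 + sqrt pi * t) = - 2 * (sqrt pi * sqrt pi) * (w * t)"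
        by (simp only: ac_simps add_0_left mult_minus_left mult_minus_right)
      then show ?thesis by (simp only: real_sqrt_mult_self) simp
    qed
    then show "std_normal_density (0 + sqrt pi * t) *\<^sub>R cis (- (w * (2 * sqrt pi)) * (0 + sqrt pi * t)) =
       (1 / (sqrt 2 * sqrt pi)) *\<^sub>R (of_real (exp (- (pi * t\<^sup>2 / 2))) * cis (- 2 * pi * (w * t)))"
      by (simp only:) (simp add: std_normal_density_def power_mult_distrib real_sqrt_mult scaleR_conv_of_real)
  qed
  also have "sqrt pi *\<^sub>R (LINT t|lborel. (1 / (sqrt 2 * sqrt pi)) *\<^sub>R (of_real (exp (- (pi * t\<^sup>2 / 2))) * cis (- 2 * pi * (w * t))))
     = (1 / sqrt 2) *\<^sub>R (LINT t|lborel. of_real (exp (- (pi * t\<^sup>2 / 2))) * cis (- 2 * pi * (w * t)))"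
    by (simp del: scaleR_conv_of_real)
  finally have "(LINT t|lborel. of_real (exp (- (pi * t\<^sup>2 / 2))) * cis (- 2 * pi * (w * t))) =
      sqrt 2 *\<^sub>R complex_of_real (exp (- (w * (2 * sqrt pi))\<^sup>2 / 2))"
    by simp
  then show ?thesis
    by (simp add: power_mult_distrib scaleR_conv_of_real algebra_simps)
qed

section \<open>Action coordinates and the measure they induce on \<open>Vd\<close>\<close>

lemma emeasure_disc_sublevel:
  "emeasure lborel {z :: real \<times> real. 2 * pi * ((fst z)\<^sup>2 + (snd z)\<^sup>2) \<le> a} = ennreal (a / 2)"
proof (cases "a \<ge> 0")
  case True
  define r where "r = sqrt (a / (2 * pi))"
  have "{z :: real \<times> real. 2 * pi * ((fst z)\<^sup>2 + (snd z)\<^sup>2) \<le> a} = cball 0 r"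
  proof -
    have "2 * pi * ((fst z)\<^sup>2 + (snd z)\<^sup>2) \<le> a \<longleftrightarrow> norm z \<le> r" for z :: "real \<times> real"
    proof -
      have "norm z \<le> r \<longleftrightarrow> (fst z)\<^sup>2 + (snd z)\<^sup>2 \<le> a / (2 * pi)"
        by (simp add: r_def norm_prod_def)
      then show ?thesis by (simp add: field_simps)
    qed
    then show ?thesis by (simp add: set_eq_iff dist_norm norm_minus_commute)
  qed
  moreover have "emeasure lborel (cball (0 :: real \<times> real) r) = ennreal (pi * r\<^sup>2)"
    using emeasure_cball[of r "0 :: real \<times> real"] True
    by (simp add: r_def unit_ball_vol_2)
  ultimately show ?thesis using True by (simp add: r_def)
next
  case False
  have "{z :: real \<times> real. 2 * pi * ((fst z)\<^sup>2 + (snd z)\<^sup>2) \<le> a} = {}"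
    using False by (auto simp: not_le intro: less_le_trans)
  then show ?thesis using False by (simp add: ennreal_neg)
qed

text \<open>Up to a constant the moment map of the poly-rotations: polyradial functions on phase
  space are the functions of \<open>phase_action\<close>.\<close>

definition phase_action :: "'d::finite phase \<Rightarrow> real ^ 'd" where
  "phase_action z = (\<chi> j. 2 * pi * ((fst z $ j)\<^sup>2 + (snd z $ j)\<^sup>2))"

lemma measurable_phase_action [measurable]: "phase_action \<in> borel_measurable borel"
  unfolding phase_action_def[abs_def]
  by (intro measurable_vec_lambda borel_measurable_continuous_onI continuous_intros)

lemma closed_Vd: "closed (Vd :: (real ^ 'd::finite) set)"
proof -
  have "Vd = (\<Inter>j. {u :: real ^ 'd. 0 \<le> u $ j})" by (auto simp: Vd_def)
  moreover have "closed (\<Inter>j. {u :: real ^ 'd. 0 \<le> u $ j})"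
    by (intro closed_INT ballI closed_Collect_le continuous_intros)
  ultimately show ?thesis by simp
qed

text \<open>Polar coordinates without a Jacobian: the two measures are compared on the orthants
  \<open>{..a}\<close>, where both are products over \<open>j\<close> of \<open>a $ j / 2\<close>,
  the area of a disc of squared radius \<open>a $ j / (2 * pi)\<close>. If some \<open>a $ j\<close>
  is negative, both are 0, in agreement with the truncation by \<open>ennreal\<close>.\<close>

lemma distr_phase_action:
  "distr lborel borel (phase_action :: 'd::finite phase \<Rightarrow> _) =
     density lborel (\<lambda>u. ennreal ((1/2) ^ CARD('d)) * indicator Vd u)" (is "?P = ?Q")
proof (rule measure_eqI_generator_eq)
  let ?E = "range (\<lambda>a. {..a :: real ^ 'd})"
  let ?A = "\<lambda>n::nat. {..(\<chi> j. real n) :: real ^ 'd}"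
  have [measurable]: "Vd \<in> sets (borel :: (real ^ 'd) measure)"
    using closed_Vd by (rule borel_closed)
  have P: "emeasure ?P {..a} = (\<Prod>j\<in>UNIV. ennreal (a $ j / 2))" for a
  proof -
    define k where "k j x y = (indicator {z :: real \<times> real. 2 * pi * ((fst z)\<^sup>2 + (snd z)\<^sup>2) \<le> a $ j} (x, y) :: ennreal)"
      for j x y
    have [measurable]: "{z :: real \<times> real. 2 * pi * ((fst z)\<^sup>2 + (snd z)\<^sup>2) \<le> b} \<in> sets borel" for b
      by (intro borel_closed closed_Collect_le continuous_intros)
    have [measurable]: "(\<lambda>z. k j (fst z) (snd z)) \<in> borel_measurable borel" for j
      unfolding k_def by simp
    have k1 [measurable]: "(\<lambda>y. k j x y) \<in> borel_measurable borel" for j x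
    proof -
      have "(\<lambda>y. (x, y)) \<in> measurable borel borel"
        by (intro borel_measurable_continuous_onI continuous_intros)
      then show ?thesis unfolding k_def by measurable
    qed
    have k2 [measurable]: "(\<lambda>x. \<integral>\<^sup>+y. k j x y \<partial>lborel) \<in> borel_measurable borel" for j
    proof -
      have "(\<lambda>(x, y). k j x y) \<in> borel_measurable (borel \<Otimes>\<^sub>M lborel)"
        unfolding borel_prod[symmetric] using \<open>(\<lambda>z. k j (fst z) (snd z)) \<in> borel_measurable borel\<close>
        by (simp add: case_prod_unfold borel_prod[symmetric] cong: measurable_cong_sets)
      from sigma_finite_measure.borel_measurable_nn_integral[OF lborel.sigma_finite_measure_axioms this]
      show ?thesis .
    qed
    have "emeasure ?P {..a} = emeasure lborel (phase_action -` {..a})"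
      by (simp add: emeasure_distr)
    also have "\<dots> = (\<integral>\<^sup>+z. indicator (phase_action -` {..a}) z \<partial>lborel)"
      using measurable_sets_borel[OF measurable_phase_action, of "{..a}"] by simp
    also have "\<dots> = (\<integral>\<^sup>+z. (\<Prod>j\<in>UNIV. k j (fst z $ j) (snd z $ j)) \<partial>(lborel \<Otimes>\<^sub>M lborel))"
      unfolding lborel_prod
    proof (rule nn_integral_cong)
      fix z :: "'d phase"
      show "indicator (phase_action -` {..a}) z = (\<Prod>j\<in>UNIV. k j (fst z $ j) (snd z $ j))"
      proof (cases "phase_action z \<le> a")
        case True
        then show ?thesis
          by (simp add: k_def phase_action_def less_eq_vec_def)
      next
        case False
        then obtain j where j: "\<not> 2 * pi * ((fst z $ j)\<^sup>2 + (snd z $ j)\<^sup>2) \<le> a $ j"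
          by (auto simp: phase_action_def less_eq_vec_def)
        then have "k j (fst z $ j) (snd z $ j) = 0" by (simp add: k_def)
        then have "(\<Prod>j\<in>UNIV. k j (fst z $ j) (snd z $ j)) = 0"
          by (meson UNIV_I finite prod_zero)
        with False show ?thesis by simp
      qed
    qed
    \<comment> \<open>Each disc couples one position with one frequency coordinate, but phase space
      lists all positions before all frequencies. Fubini separates the two blocks, each block
      integral factors over \<open>j\<close>, and Fubini in the plane reassembles the discs.\<close>
    also have "\<dots> = (\<integral>\<^sup>+x. \<integral>\<^sup>+y. (\<Prod>j\<in>UNIV. k j (x $ j) (y $ j)) \<partial>lborel \<partial>lborel)"
    proof (subst lborel.nn_integral_fst[symmetric])
      have "(\<lambda>z. k j (fst z $ j) (snd z $ j)) \<in> borel_measurable (borel :: 'd phase measure)" for j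
      proof -
        have "(\<lambda>z :: 'd phase. (fst z $ j, snd z $ j)) \<in> measurable borel borel"
          by (intro borel_measurable_continuous_onI continuous_intros)
        then show ?thesis unfolding k_def by measurable
      qed
      then show "(\<lambda>z. \<Prod>j\<in>UNIV. k j (fst z $ j) (snd z $ j)) \<in>
          borel_measurable ((lborel :: (real ^ 'd) measure) \<Otimes>\<^sub>M lborel)"
        unfolding lborel_prod by simp
    qed auto
    also have "\<dots> = (\<integral>\<^sup>+x. (\<Prod>j\<in>UNIV. (\<integral>\<^sup>+y. k j (x $ j) y \<partial>lborel)) \<partial>lborel)"
      by (intro nn_integral_cong nn_integral_lborel_vec_prod k1)
    also have "\<dots> = (\<Prod>j\<in>UNIV. \<integral>\<^sup>+x. \<integral>\<^sup>+y. k j x y \<partial>lborel \<partial>lborel)"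
      by (intro nn_integral_lborel_vec_prod k2)
    also have "\<dots> = (\<Prod>j\<in>UNIV. ennreal (a $ j / 2))"
    proof (rule prod.cong[OF refl])
      fix j
      have "(\<integral>\<^sup>+x. \<integral>\<^sup>+y. k j x y \<partial>lborel \<partial>lborel) = (\<integral>\<^sup>+z. k j (fst z) (snd z) \<partial>(lborel \<Otimes>\<^sub>M lborel))"
        by (subst lborel.nn_integral_fst[symmetric]) (auto simp: lborel_prod)
      also have "\<dots> = emeasure lborel {z :: real \<times> real. 2 * pi * ((fst z)\<^sup>2 + (snd z)\<^sup>2) \<le> a $ j}"
        unfolding lborel_prod k_def by simp
      finally show "(\<integral>\<^sup>+x. \<integral>\<^sup>+y. k j x y \<partial>lborel \<partial>lborel) = ennreal (a $ j / 2)"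
        by (simp add: emeasure_disc_sublevel)
    qed
    finally show ?thesis .
  qed
  have Q: "emeasure ?Q {..a} = (\<Prod>j\<in>UNIV. ennreal (a $ j / 2))" for a
  proof -
    have "emeasure ?Q {..a} = (\<integral>\<^sup>+u. ennreal ((1/2) ^ CARD('d)) * (\<Prod>j\<in>UNIV. indicator {0..a $ j} (u $ j)) \<partial>lborel)"
    proof (subst emeasure_density, simp, simp, rule nn_integral_cong)
      fix u :: "real ^ 'd"
      show "ennreal ((1/2) ^ CARD('d)) * indicator Vd u * indicator {..a} u =
         ennreal ((1/2) ^ CARD('d)) * (\<Prod>j\<in>UNIV. indicator {0..a $ j} (u $ j))"
      proof (cases "u \<in> Vd \<and> u \<le> a")
        case True
        then show ?thesis by (simp add: Vd_def less_eq_vec_def)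
      next
        case False
        then obtain j where j: "\<not> (0 \<le> u $ j \<and> u $ j \<le> a $ j)"
          by (auto simp: Vd_def less_eq_vec_def)
        then have "(\<Prod>j\<in>UNIV. indicator {0..a $ j} (u $ j) :: ennreal) = 0"
          by (intro prod_zero bexI[of _ j]) auto
        with False show ?thesis by (auto simp: indicator_def)
      qed
    qed
    also have "\<dots> = ennreal ((1/2) ^ CARD('d)) * (\<Prod>j\<in>UNIV. ennreal (a $ j))"
    proof -
      have "emeasure lborel {0..x} = ennreal x" for x :: real
        by (cases "x \<ge> 0") (auto simp: ennreal_neg)
      then show ?thesis
        by (subst nn_integral_cmult)
          (simp_all add: nn_integral_lborel_vec_prod[of "\<lambda>j. indicator {0..a $ j}"])
    qed
    also have "\<dots> = (\<Prod>j\<in>UNIV. ennreal (1/2) * ennreal (a $ j))"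
      by (subst prod.distrib, subst prod_constant, subst ennreal_power) simp_all
    also have "\<dots> = (\<Prod>j\<in>UNIV. ennreal (a $ j / 2))"
      by (intro prod.cong refl, subst ennreal_mult'[symmetric]) simp_all
    finally show ?thesis .
  qed
  show "Int_stable ?E"
  proof -
    have "{..a} \<inter> {..b} = {..(\<chi> j. min (a $ j) (b $ j))}" for a b :: "real ^ 'd"
      by (auto simp: less_eq_vec_def)
    then show ?thesis by (auto simp: Int_stable_def)
  qed
  show "emeasure ?P X = emeasure ?Q X" if "X \<in> ?E" for X
    using that P Q by auto
  show "sets ?P = sigma_sets UNIV ?E" "sets ?Q = sigma_sets UNIV ?E"
    by (auto simp: borel_eq_atMost)
  show "(\<Union>n. ?A n) = UNIV"
  proof -
    have "\<exists>n::nat. \<forall>j. u $ j \<le> real n" for u :: "real ^ 'd"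
    proof -
      obtain n :: nat where "norm u \<le> real n" using real_arch_simple by blast
      then show ?thesis
        by (meson abs_le_D1 component_le_norm_cart order_trans)
    qed
    then show ?thesis by (auto simp: less_eq_vec_def)
  qed
  show "emeasure ?P (?A n) \<noteq> \<infinity>" for n
    unfolding P by (simp add: ennreal_power)
qed auto

lemma
  fixes k :: "real ^ 'd::finite \<Rightarrow> complex"
  assumes [measurable]: "k \<in> borel_measurable borel"
    and int: "integrable lborel (\<lambda>z :: 'd phase. k (phase_action z))"
  shows set_integrable_phase_action: "set_integrable lborel Vd k"
    and integral_phase_action:
      "(LINT z|lborel. k (phase_action z)) = (1/2) ^ CARD('d) *\<^sub>R (LINT u:Vd|lborel. k u)"
proof -
  have [measurable]: "Vd \<in> sets (borel :: (real ^ 'd) measure)"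
    using closed_Vd by (rule borel_closed)
  have eq: "distr lborel borel (phase_action :: 'd phase \<Rightarrow> _) =
      density lborel (\<lambda>u. ennreal ((1/2) ^ CARD('d) * indicator Vd u))"
    unfolding distr_phase_action
    by (intro arg_cong[where f = "density lborel"] ext) (auto simp: indicator_def)
  have "integrable (distr lborel borel (phase_action :: 'd phase \<Rightarrow> _)) k"
    using int by (subst integrable_distr_eq) auto
  then have "integrable lborel (\<lambda>u. (1/2) ^ CARD('d) *\<^sub>R (indicator Vd u *\<^sub>R k u))"
    unfolding eq by (subst (asm) integrable_density) auto
  from integrable_scaleR_right[OF this, of "2 ^ CARD('d)"] show "set_integrable lborel Vd k"
    by (simp add: set_integrable_def power_mult_distrib[symmetric] mult.assoc[symmetric])
  have "(LINT z|lborel. k (phase_action z)) = (LINT u|distr lborel borel (phase_action :: 'd phase \<Rightarrow> _). k u)"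
    by (subst integral_distr) auto
  also have "\<dots> = (LINT u|lborel. (1/2) ^ CARD('d) *\<^sub>R (indicator Vd u *\<^sub>R k u))"
    unfolding eq by (subst integral_density) auto
  finally show "(LINT z|lborel. k (phase_action z)) = (1/2) ^ CARD('d) *\<^sub>R (LINT u:Vd|lborel. k u)"
    unfolding set_lebesgue_integral_def by (subst (asm) integral_scaleR_right)
qed

section \<open>Hermite functions in one variable\<close>

text \<open>The polynomial factors of the derivatives of \<open>exp (- 2 * pi * t\<^sup>2)\<close>.
  At \<open>n = 0\<close> the truncated index \<open>n - 1\<close> is harmless because its
  coefficient \<open>real n\<close> vanishes; the later ladder relations use the same
  convention.\<close>

fun hermite_poly :: "nat \<Rightarrow> real \<Rightarrow> real" where
  "hermite_poly 0 t = 1"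
| "hermite_poly (Suc n) t = - (4 * pi * t) * hermite_poly n t - 4 * pi * real n * hermite_poly (n - 1) t"

text \<open>Differentiating the recursion yields the polynomials of index \<open>m\<close>,
  \<open>m - 1\<close> and \<open>m - 2\<close>; the recursion itself merges the last two into a
  further multiple of the first.\<close>

lemma hermite_poly_deriv:
  "(hermite_poly n has_real_derivative - (4 * pi * real n * hermite_poly (n - 1) t)) (at t)"
proof (induction n arbitrary: t rule: less_induct)
  case (less n)
  show ?case
  proof (cases n)
    case 0
    then show ?thesis by (simp add: hermite_poly.simps(1)[abs_def])
  next
    case (Suc m)
    have 1: "(hermite_poly m has_real_derivative - (4 * pi * real m * hermite_poly (m - 1) t)) (at t)"
      using less.IH[of m t] Suc by simp
    have 2: "((\<lambda>t. 4 * pi * real m * hermite_poly (m - 1) t) has_real_derivative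
        4 * pi * real m * - (4 * pi * real (m - 1) * hermite_poly (m - 1 - 1) t)) (at t)"
      by (intro DERIV_cmult less.IH) (use Suc in auto)
    have "((\<lambda>t. - (4 * pi * t) * hermite_poly m t - 4 * pi * real m * hermite_poly (m - 1) t)
        has_real_derivative - (4 * pi) * hermite_poly m t
          + - (4 * pi * t) * - (4 * pi * real m * hermite_poly (m - 1) t)
          - 4 * pi * real m * - (4 * pi * real (m - 1) * hermite_poly (m - 1 - 1) t)) (at t)"
      by (rule derivative_eq_intros 1 2 refl)+ simp
    also have "- (4 * pi) * hermite_poly m t
          + - (4 * pi * t) * - (4 * pi * real m * hermite_poly (m - 1) t)
          - 4 * pi * real m * - (4 * pi * real (m - 1) * hermite_poly (m - 1 - 1) t)
        = - (4 * pi * real (Suc m) * hermite_poly m t)"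
    proof (cases m)
      case (Suc l)
      then show ?thesis by (simp add: algebra_simps)
    qed simp
    finally show ?thesis
      by (simp add: Suc hermite_poly.simps(2)[abs_def])
  qed
qed

lemma deriv_iter_gauss:
  "(deriv ^^ n) (\<lambda>s. exp (- 2 * pi * s\<^sup>2)) = (\<lambda>t. hermite_poly n t * exp (- 2 * pi * t\<^sup>2))"
proof (induction n)
  case (Suc n)
  have "deriv (\<lambda>t. hermite_poly n t * exp (- 2 * pi * t\<^sup>2)) t =
      hermite_poly (Suc n) t * exp (- 2 * pi * t\<^sup>2)" for t
    by (rule DERIV_imp_deriv) (auto intro!: derivative_eq_intros hermite_poly_deriv simp: algebra_simps)
  then show ?case unfolding funpow.simps comp_def Suc by (rule ext)
qed simp

lemma hermite1_eq:
  "hermite1 n t = 2 powr (1/4) / sqrt (fact n) * (- 1 / (2 * sqrt pi)) ^ n * hermite_poly n t * exp (- pi * t\<^sup>2)"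
proof -
  have "exp (pi * t\<^sup>2) * exp (- 2 * pi * t\<^sup>2) = exp (- pi * t\<^sup>2)"
    by (simp add: mult_exp_exp)
  then show ?thesis
    unfolding hermite1_def deriv_iter_gauss by (simp add: algebra_simps)
qed

lemma hermite1_0: "hermite1 0 t = 2 powr (1/4) * exp (- pi * t\<^sup>2)"
  by (simp add: hermite1_eq)

text \<open>For normalized Hermite functions, multiplication by \<open>2 * sqrt pi * t\<close> is
  the sum of the creation and the annihilation operator.\<close>

lemma hermite1_Suc:
  "sqrt (real (Suc n)) * hermite1 (Suc n) t =
     2 * sqrt pi * t * hermite1 n t - sqrt (real n) * hermite1 (n - 1) t"
proof -
  \<comment> \<open>The part of the normalization that is raised to the power \<open>n\<close>. The
    identity \<open>4 * pi * a * a = 1\<close> balances the terms of the recursion and leaves only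
    square roots of the indices.\<close>
  define a where "a = - 1 / (2 * sqrt pi)"
  have a: "4 * pi * a = - 2 * sqrt pi"
    using real_sqrt_mult_self[of pi] by (simp add: a_def field_simps)
  have a2: "4 * pi * a * a = 1"
    using real_sqrt_mult_self[of pi] by (simp add: a_def field_simps)
  define K where "K = 2 powr (1/4) * exp (- pi * t\<^sup>2)"
  have h: "hermite1 n t = K / sqrt (fact n) * a ^ n * hermite_poly n t" for n
    by (simp add: hermite1_eq K_def a_def)
  have s: "sqrt (real (Suc n)) * (K / sqrt (fact (Suc n))) = K / sqrt (fact n)" for n
    by (simp add: real_sqrt_mult)
  have "sqrt (real (Suc n)) * hermite1 (Suc n) t =
      K / sqrt (fact n) * a ^ Suc n * hermite_poly (Suc n) t"
    unfolding h mult.assoc[symmetric] s ..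
  also have "\<dots> = K / sqrt (fact n) * a ^ n * (- (4 * pi * a) * t) * hermite_poly n t
      - K / sqrt (fact n) * a ^ n * (4 * pi * a) * real n * hermite_poly (n - 1) t"
    by (simp add: algebra_simps)
  also have "K / sqrt (fact n) * a ^ n * (- (4 * pi * a) * t) * hermite_poly n t = 2 * sqrt pi * t * hermite1 n t"
    unfolding a h by simp
  also have "K / sqrt (fact n) * a ^ n * (4 * pi * a) * real n * hermite_poly (n - 1) t =
      sqrt (real n) * hermite1 (n - 1) t"
  proof (cases n)
    case (Suc m)
    have "K / sqrt (fact n) * a ^ n * (4 * pi * a) * real n * hermite_poly (n - 1) t =
        (4 * pi * a * a) * (real n * (K / sqrt (fact n)) * a ^ m * hermite_poly m t)"
      by (simp add: Suc)
    also have "real n * (K / sqrt (fact n)) = sqrt (real n) * (sqrt (real n) * (K / sqrt (fact n)))"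
      by simp
    also have "sqrt (real n) * (K / sqrt (fact n)) = K / sqrt (fact m)"
      unfolding Suc s ..
    finally show ?thesis
      by (simp add: a2 h Suc)
  qed simp
  finally show ?thesis .
qed

lemma hermite1_deriv:
  "(hermite1 n has_real_derivative
     2 * sqrt pi * sqrt (real n) * hermite1 (n - 1) t - 2 * pi * t * hermite1 n t) (at t)"
proof -
  define a where "a = - 1 / (2 * sqrt pi)"
  have a: "4 * pi * a = - 2 * sqrt pi"
    using real_sqrt_mult_self[of pi] by (simp add: a_def field_simps)
  define K where "K n = 2 powr (1/4) / sqrt (fact n) * a ^ n" for n
  have h: "hermite1 n t = K n * hermite_poly n t * exp (- pi * t\<^sup>2)" for n t
    by (simp add: hermite1_eq K_def a_def)
  then have h': "hermite1 n = (\<lambda>t. K n * hermite_poly n t * exp (- pi * t\<^sup>2))" for n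
    by blast
  have K: "K n * (4 * pi * real n) = - (2 * sqrt pi * sqrt (real n) * K (n - 1))"
  proof (cases n)
    case (Suc m)
    have "K n * (4 * pi * real n) = 2 powr (1/4) * (4 * pi * a) * a ^ m * (real n / sqrt (fact n))"
      by (simp add: K_def Suc)
    also have "real n / sqrt (fact n) = real n / sqrt (real n) / sqrt (fact m)"
      unfolding Suc fact_Suc of_nat_mult real_sqrt_mult divide_divide_eq_left ..
    also have "\<dots> = sqrt (real n) / sqrt (fact m)"
      using real_div_sqrt[of "real n"] by simp
    finally show ?thesis by (simp add: a K_def Suc)
  qed simp
  have "((\<lambda>t. K n * hermite_poly n t * exp (- pi * t\<^sup>2)) has_real_derivative
      - (K n * (4 * pi * real n)) * hermite_poly (n - 1) t * exp (- pi * t\<^sup>2)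
      - 2 * pi * t * (K n * hermite_poly n t * exp (- pi * t\<^sup>2))) (at t)"
    by (auto intro!: derivative_eq_intros hermite_poly_deriv simp: algebra_simps)
  then show ?thesis
    unfolding K by (simp add: h' mult.assoc)
qed

lemma hermite1_minus: "hermite1 n (- t) = (- 1) ^ n * hermite1 n t"
proof (induction n rule: less_induct)
  case (less n)
  show ?case
  proof (cases n)
    case 0
    then show ?thesis by (simp add: hermite1_0)
  next
    case (Suc m)
    have 1: "hermite1 m (- t) = (- 1) ^ m * hermite1 m t"
      using less Suc by simp
    have 2: "sqrt (real m) * hermite1 (m - 1) (- t) = - ((- 1) ^ m * (sqrt (real m) * hermite1 (m - 1) t))"
      using less[of "m - 1"] Suc by (cases m) auto
    have "sqrt (real (Suc m)) * hermite1 (Suc m) (- t) =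
        sqrt (real (Suc m)) * ((- 1) ^ Suc m * hermite1 (Suc m) t)"
      unfolding mult.left_commute[of "sqrt (real (Suc m))" "(-1) ^ Suc m"] hermite1_Suc 1 2
      by (simp add: algebra_simps)
    moreover have "sqrt (real (Suc m)) \<noteq> 0" by simp
    ultimately show ?thesis unfolding Suc by (rule mult_left_cancel[THEN iffD1, rotated])
  qed
qed

abbreviation hermite1c :: "nat \<Rightarrow> real \<Rightarrow> complex" where
  "hermite1c n t \<equiv> of_real (hermite1 n t)"

lemma hermite1c_poly:
  "\<exists>p\<in>poly_fun. \<forall>t. hermite1c n t = p t * exp (- of_real (pi * t\<^sup>2))"
proof (induction n rule: less_induct)
  case (less n)
  show ?case
  proof (cases n)
    case 0
    then show ?thesis
      by (intro bexI[of _ "\<lambda>_. of_real (2 powr (1/4))"])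
        (auto simp: hermite1_0 exp_of_real[symmetric] intro: poly_fun.const)
  next
    case (Suc m)
    obtain p q where p: "p \<in> poly_fun" "\<And>t. hermite1c m t = p t * exp (- of_real (pi * t\<^sup>2))"
      and q: "q \<in> poly_fun" "\<And>t. hermite1c (m - 1) t = q t * exp (- of_real (pi * t\<^sup>2))"
      using less[of m] less[of "m - 1"] Suc by (metis lessI less_imp_diff_less)
    define \<alpha> where "\<alpha> = 2 * sqrt pi / sqrt (real (Suc m))"
    define \<beta> where "\<beta> = - sqrt (real m) / sqrt (real (Suc m))"
    define r where "r t = of_real \<alpha> * of_real (t \<bullet> 1) * p t + of_real \<beta> * q t" for t
    have "r \<in> poly_fun"
      unfolding r_def by (intro poly_fun.intros p q)
    moreover have "hermite1c n t = r t * exp (- of_real (pi * t\<^sup>2))" for t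
    proof -
      have "hermite1 (Suc m) t = \<alpha> * t * hermite1 m t + \<beta> * hermite1 (m - 1) t"
        using hermite1_Suc[of m t] by (simp add: \<alpha>_def \<beta>_def field_simps del: of_nat_Suc)
      then have "hermite1c n t = of_real \<alpha> * of_real t * hermite1c m t + of_real \<beta> * hermite1c (m - 1) t"
        unfolding Suc by (simp only: of_real_mult of_real_add)
      then show ?thesis
        unfolding p q r_def by (simp add: distrib_right mult.assoc)
    qed
    ultimately show ?thesis by blast
  qed
qed

lemma hermite1c_poly_gauss: "hermite1c n \<in> poly_gauss"
proof -
  obtain p where p: "p \<in> poly_fun" "\<And>t. hermite1c n t = p t * exp (- of_real (pi * t\<^sup>2))"
    using hermite1c_poly by blast
  show ?thesis
    by (rule poly_gaussI[OF p(1), of pi _ 0 0]) (auto simp: p(2) gaussian_exp_def power2_eq_square)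
qed

lemma hermite1c_deriv:
  "(hermite1c n has_vector_derivative
     (2 * sqrt pi * sqrt (real n) * hermite1 (n - 1) t - 2 * pi * t * hermite1 n t)) (at t)"
  by (intro has_vector_derivative_of_real hermite1_deriv)

text \<open>Trades the lowering form of the derivative for the raising form. In a product of two
  Hermite functions, using a different form for each factor makes the terms containing the
  integration variable cancel.\<close>

lemma hermite1_deriv':
  "2 * sqrt pi * sqrt (real n) * hermite1 (n - 1) t - 2 * pi * t * hermite1 n t =
   2 * pi * t * hermite1 n t - 2 * sqrt pi * sqrt (real (Suc n)) * hermite1 (Suc n) t"
proof -
  have "2 * sqrt pi * (sqrt (real (Suc n)) * hermite1 (Suc n) t) =
      2 * sqrt pi * (2 * sqrt pi * t * hermite1 n t - sqrt (real n) * hermite1 (n - 1) t)"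
    unfolding hermite1_Suc ..
  also have "\<dots> = 4 * (sqrt pi * sqrt pi) * t * hermite1 n t - 2 * sqrt pi * sqrt (real n) * hermite1 (n - 1) t"
    by (simp only: algebra_simps)
  finally show ?thesis by simp
qed

lemmas hermite1_deriv_up = hermite1_deriv[unfolded hermite1_deriv']

text \<open>The integral of the derivative of \<open>hermite1c n t * hermite1c m t\<close> is 0;
  this is a ladder relation lowering both indices at once, so that everything reduces to an index
  0.\<close>

lemma hermite1_orthonormal:
  "(LINT t|lborel. hermite1c n t * hermite1c m t) = (if n = m then 1 else 0)"
proof -
  define I where "I n m = (LINT t|lborel. hermite1c n t * hermite1c m t)" for n m
  have int: "integrable lborel (\<lambda>t. hermite1c n t * hermite1c m t)" for n m
    by (intro poly_gauss_integrable poly_gauss_mult hermite1c_poly_gauss)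
  have rec: "sqrt (real (Suc n)) * I (Suc n) m = sqrt (real m) * I n (m - 1)" for n m
  proof -
    let ?c1 = "complex_of_real (- 2 * sqrt pi * sqrt (real (Suc n)))"
    let ?c2 = "complex_of_real (2 * sqrt pi * sqrt (real m))"
    let ?f' = "\<lambda>t. ?c1 * (hermite1c (Suc n) t * hermite1c m t) + ?c2 * (hermite1c n t * hermite1c (m - 1) t)"
    have d: "((\<lambda>t. hermite1c n t * hermite1c m t) has_vector_derivative ?f' t) (at t)" for t
    proof -
      have "((\<lambda>t. hermite1c n t * hermite1c m t) has_vector_derivative
          (hermite1c n t * (2 * sqrt pi * sqrt (real m) * hermite1 (m - 1) t - 2 * pi * t * hermite1 m t)
          + (2 * pi * t * hermite1 n t - 2 * sqrt pi * sqrt (real (Suc n)) * hermite1 (Suc n) t) * hermite1c m t)) (at t)"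
        using has_vector_derivative_mult[OF hermite1c_deriv[of n t] hermite1c_deriv[of m t]]
        unfolding hermite1_deriv'[of n] .
      then show ?thesis by (simp add: algebra_simps)
    qed
    have 0: "(LINT t|lborel. ?f' t) = ?c1 * I (Suc n) m + ?c2 * I n (m - 1)"
      unfolding I_def by (subst Bochner_Integration.integral_add) (use int in auto)
    have "?c1 * I (Suc n) m + ?c2 * I n (m - 1) = 0"
      using integral_poly_gauss_deriv[OF poly_gauss_mult[OF hermite1c_poly_gauss hermite1c_poly_gauss] d] 0
      by simp
    then have "complex_of_real (2 * sqrt pi) * (sqrt (real (Suc n)) * I (Suc n) m) =
        complex_of_real (2 * sqrt pi) * (sqrt (real m) * I n (m - 1))"
      by (simp add: algebra_simps add_eq_0_iff2 del: of_nat_Suc)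
    then show ?thesis by simp
  qed
  have I00: "I 0 0 = 1"
  proof -
    have "I 0 0 = complex_of_real (LINT t|lborel. hermite1 0 t * hermite1 0 t)"
      unfolding I_def of_real_mult[symmetric] by (rule integral_complex_of_real)
    \<comment> \<open>The squared ground state is the centred normal density of variance
      \<open>1 / (4 * pi)\<close>.\<close>
    also have "(\<lambda>t. hermite1 0 t * hermite1 0 t) = normal_density 0 (1 / (2 * sqrt pi))"
    proof
      fix t
      have "hermite1 0 t * hermite1 0 t = (2 powr (1/4) * 2 powr (1/4)) * exp (- 2 * pi * t\<^sup>2)"
        by (simp add: hermite1_0 mult_exp_exp)
      also have "2 powr (1/4) * 2 powr (1/4) = sqrt (2::real)"
        by (simp add: powr_add[symmetric] powr_half_sqrt)
      finally show "hermite1 0 t * hermite1 0 t = normal_density 0 (1 / (2 * sqrt pi)) t"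
        by (simp add: normal_density_def power_divide real_sqrt_divide field_simps)
    qed
    also have "(LINT t|lborel. normal_density 0 (1 / (2 * sqrt pi)) t) = 1"
      by (rule integral_normal_density) simp
    finally show ?thesis by simp
  qed
  have "I n m = (if n = m then 1 else 0)" for n m
  proof (induction n arbitrary: m)
    case 0
    show ?case
    proof (cases m)
      case (Suc l)
      have "I 0 (Suc l) = I (Suc l) 0" unfolding I_def by (simp add: mult.commute)
      also have "\<dots> = 0" using rec[of l 0] by (simp del: of_nat_Suc)
      finally show ?thesis using Suc by simp
    qed (simp add: I00)
  next
    case (Suc n)
    show ?case
    proof (cases m)
      case 0
      then show ?thesis using rec[of n 0] by (simp del: of_nat_Suc)
    next
      case (Suc l)
      then show ?thesis using rec[of n "Suc l"] Suc.IH[of l] by (auto simp del: of_nat_Suc)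
    qed
  qed
  then show ?thesis unfolding I_def .
qed

section \<open>Wigner distributions of Hermite functions in one variable\<close>

definition wigner1 :: "nat \<Rightarrow> nat \<Rightarrow> real \<Rightarrow> real \<Rightarrow> complex" where
  "wigner1 n m x w =
     (LINT t|lborel. hermite1c n (x + t / 2) * hermite1c m (x - t / 2) * cis (- 2 * pi * (w * t)))"

lemma wigner1_integrand_poly_gauss:
  "(\<lambda>t. hermite1c n (x + t / 2) * hermite1c m (x - t / 2) * cis (- 2 * pi * (w * t))) \<in> poly_gauss"
proof -
  have 1: "(\<lambda>t. hermite1c n (x + (1/2) *\<^sub>R t)) \<in> poly_gauss"
    by (rule poly_gauss_affine[OF hermite1c_poly_gauss]) simp
  have 2: "(\<lambda>t. hermite1c m (x + (- 1/2) *\<^sub>R t)) \<in> poly_gauss"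
    by (rule poly_gauss_affine[OF hermite1c_poly_gauss]) simp
  have "(\<lambda>t. cis (0 + t \<bullet> (- 2 * pi * w)) * (hermite1c n (x + (1/2) *\<^sub>R t) * hermite1c m (x + (- 1/2) *\<^sub>R t))) \<in> poly_gauss"
    by (intro poly_gauss_cis poly_gauss_mult 1 2)
  then show ?thesis by (simp add: ac_simps)
qed

text \<open>The derivatives \<open>u'\<close> and \<open>v'\<close> are left open, so that either
  the raising or the lowering form can be inserted for each factor.\<close>

lemma wigner1_integral_deriv:
  fixes x w :: real and n m :: nat
  defines "u \<equiv> \<lambda>k t. hermite1 k (x + t / 2)" and "v \<equiv> \<lambda>k t. hermite1 k (x - t / 2)"
    and "e \<equiv> \<lambda>t. cis (- 2 * pi * (w * t))"
  assumes du: "\<And>t. (hermite1 n has_real_derivative u' t) (at (x + t / 2))"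
    and dv: "\<And>t. (hermite1 m has_real_derivative v' t) (at (x - t / 2))"
  shows "(LINT t|lborel. (of_real (u' t * v m t - u n t * v' t) / 2
      - \<i> * of_real (2 * pi * w) * of_real (u n t * v m t)) * e t) = 0"
proof -
  let ?f = "\<lambda>t. hermite1c n (x + t / 2) * hermite1c m (x - t / 2) * cis (- 2 * pi * (w * t))"
  let ?f' = "\<lambda>t. (of_real (u' t * v m t - u n t * v' t) / 2
      - \<i> * of_real (2 * pi * w) * of_real (u n t * v m t)) * e t"
  have d: "(?f has_vector_derivative ?f' t) (at t)" for t
  proof -
    have "((\<lambda>t. hermite1 n (x + t / 2)) has_real_derivative u' t * (1/2)) (at t)"
      by (rule DERIV_chain2[where f = "hermite1 n" and g = "\<lambda>t. x + t / 2"], rule du)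
        (auto intro!: derivative_eq_intros)
    then have 1: "((\<lambda>t. hermite1c n (x + t / 2)) has_vector_derivative of_real (u' t * (1/2))) (at t)"
      by (rule has_vector_derivative_of_real)
    have "((\<lambda>t. hermite1 m (x - t / 2)) has_real_derivative v' t * (- 1/2)) (at t)"
      by (rule DERIV_chain2[where f = "hermite1 m" and g = "\<lambda>t. x - t / 2"], rule dv)
        (auto intro!: derivative_eq_intros)
    then have 2: "((\<lambda>t. hermite1c m (x - t / 2)) has_vector_derivative of_real (v' t * (- 1/2))) (at t)"
      by (rule has_vector_derivative_of_real)
    have 3: "((\<lambda>t. cis (- 2 * pi * (w * t))) has_vector_derivative (- 2 * pi * w) *\<^sub>R (\<i> * cis (- 2 * pi * (w * t)))) (at t)"
      unfolding has_vector_derivative_def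
      by (auto intro!: derivative_eq_intros simp: scaleR_conv_of_real)
    have alg: "U * V * (of_real (- 2 * pi * w) * (\<i> * E)) + (U * (of_real b * of_real (- 1/2)) + of_real a * of_real (1/2) * V) * E
        = ((of_real a * V - U * of_real b) / 2 - \<i> * of_real (2 * pi * w) * (U * V)) * E" for U V E and a b :: real
      by (simp add: algebra_simps diff_divide_distrib)
    show ?thesis
      using has_vector_derivative_mult[OF has_vector_derivative_mult[OF 1 2] 3]
      unfolding u_def v_def e_def of_real_diff of_real_mult[of "u' t"] of_real_mult[of "v' t"] of_real_mult[of "hermite1 n _"]
        scaleR_conv_of_real alg .
  qed
  from integral_poly_gauss_deriv[OF wigner1_integrand_poly_gauss d] show ?thesis .
qed

text \<open>With the raising form on the left and the lowering form on the right factor, the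
  contributions of \<open>t / 2\<close> cancel and \<open>2 * pi * x\<close> remains; the
  oscillating factor contributes the imaginary part \<open>- 2 * pi * w\<close>.\<close>

lemma wigner1_Suc_left:
  "of_real (sqrt (real (Suc n))) * wigner1 (Suc n) m x w =
     of_real (2 * sqrt pi) * Complex x (- w) * wigner1 n m x w - of_real (sqrt (real m)) * wigner1 n (m - 1) x w"
proof -
  define J where "J n m t = hermite1c n (x + t / 2) * hermite1c m (x - t / 2) * cis (- 2 * pi * (w * t))" for n m t
  have int: "integrable lborel (J n m)" for n m
    unfolding J_def by (intro poly_gauss_integrable wigner1_integrand_poly_gauss)
  have W: "wigner1 n m x w = (LINT t|lborel. J n m t)" for n m
    by (simp add: wigner1_def J_def)
  let ?u' = "\<lambda>t. 2 * pi * (x + t / 2) * hermite1 n (x + t / 2) - 2 * sqrt pi * sqrt (real (Suc n)) * hermite1 (Suc n) (x + t / 2)"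
  let ?v' = "\<lambda>t. 2 * sqrt pi * sqrt (real m) * hermite1 (m - 1) (x - t / 2) - 2 * pi * (x - t / 2) * hermite1 m (x - t / 2)"
  have "0 = (LINT t|lborel. (of_real (?u' t * hermite1 m (x - t / 2) - hermite1 n (x + t / 2) * ?v' t) / 2
      - \<i> * of_real (2 * pi * w) * of_real (hermite1 n (x + t / 2) * hermite1 m (x - t / 2))) * cis (- 2 * pi * (w * t)))"
    by (rule wigner1_integral_deriv[where u' = ?u' and v' = ?v', OF hermite1_deriv_up hermite1_deriv, symmetric])
  also have "\<dots> = (LINT t|lborel. of_real (2 * pi) * Complex x (- w) * J n m t
      - of_real (sqrt pi) * of_real (sqrt (real (Suc n))) * J (Suc n) m t
      - of_real (sqrt pi) * of_real (sqrt (real m)) * J n (m - 1) t)"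
  proof (rule Bochner_Integration.integral_cong[OF refl])
    fix t
    \<comment> \<open>Stated for arbitrary numbers, so that the values of the Hermite functions are
      atoms for the simplifier.\<close>
    have alg: "(of_real ((2 * pi * (x + t / 2) * U - 2 * r * a * U1) * V - U * (2 * r * b * V1 - 2 * pi * (x - t / 2) * V)) / 2
        - \<i> * of_real (2 * pi * w) * of_real (U * V)) * E =
      of_real (2 * pi) * Complex x (- w) * (of_real U * of_real V * E)
      - of_real r * of_real a * (of_real U1 * of_real V * E) - of_real r * of_real b * (of_real U * of_real V1 * E)"
      for U V U1 V1 r a b :: real and E :: complex
    proof -
      have eq: "(2 * pi * (x + t / 2) * U - 2 * r * a * U1) * V - U * (2 * r * b * V1 - 2 * pi * (x - t / 2) * V)
          = 2 * (2 * pi * x * (U * V) - r * a * (U1 * V) - r * b * (U * V1))"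
        by (simp add: algebra_simps)
      have "complex_of_real ((2 * pi * (x + t / 2) * U - 2 * r * a * U1) * V - U * (2 * r * b * V1 - 2 * pi * (x - t / 2) * V)) / 2
          = of_real (2 * pi * x * (U * V) - r * a * (U1 * V) - r * b * (U * V1))"
        unfolding eq by simp
      then show ?thesis
        by (simp only:) (simp add: Complex_eq algebra_simps)
    qed
    show "(of_real (?u' t * hermite1 m (x - t / 2) - hermite1 n (x + t / 2) * ?v' t) / 2
      - \<i> * of_real (2 * pi * w) * of_real (hermite1 n (x + t / 2) * hermite1 m (x - t / 2))) * cis (- 2 * pi * (w * t))
      = of_real (2 * pi) * Complex x (- w) * J n m t
      - of_real (sqrt pi) * of_real (sqrt (real (Suc n))) * J (Suc n) m t
      - of_real (sqrt pi) * of_real (sqrt (real m)) * J n (m - 1) t"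
      unfolding J_def by (rule alg)
  qed
  also have "\<dots> = of_real (2 * pi) * Complex x (- w) * wigner1 n m x w
      - of_real (sqrt pi) * of_real (sqrt (real (Suc n))) * wigner1 (Suc n) m x w
      - of_real (sqrt pi) * of_real (sqrt (real m)) * wigner1 n (m - 1) x w"
    using int by (simp add: W del: of_nat_Suc)
  also have "of_real (2 * pi) = complex_of_real (sqrt pi) * of_real (2 * sqrt pi)"
    unfolding of_real_mult[symmetric] by (rule arg_cong[where f = of_real]) simp
  finally have "complex_of_real (sqrt pi) * (of_real (sqrt (real (Suc n))) * wigner1 (Suc n) m x w) =
      complex_of_real (sqrt pi) * (of_real (2 * sqrt pi) * Complex x (- w) * wigner1 n m x w - of_real (sqrt (real m)) * wigner1 n (m - 1) x w)"
    by (simp add: algebra_simps del: of_nat_Suc)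
  then show ?thesis by simp
qed

text \<open>The opposite choice of derivative forms gives \<open>- 2 * pi * x\<close> with the same
  imaginary part, hence the conjugate variable \<open>Complex x w\<close>.\<close>

lemma wigner1_Suc_right:
  "of_real (sqrt (real (Suc m))) * wigner1 n (Suc m) x w =
     of_real (2 * sqrt pi) * Complex x w * wigner1 n m x w - of_real (sqrt (real n)) * wigner1 (n - 1) m x w"
proof -
  define J where "J n m t = hermite1c n (x + t / 2) * hermite1c m (x - t / 2) * cis (- 2 * pi * (w * t))" for n m t
  have int: "integrable lborel (J n m)" for n m
    unfolding J_def by (intro poly_gauss_integrable wigner1_integrand_poly_gauss)
  have W: "wigner1 n m x w = (LINT t|lborel. J n m t)" for n m
    by (simp add: wigner1_def J_def)
  let ?u' = "\<lambda>t. 2 * sqrt pi * sqrt (real n) * hermite1 (n - 1) (x + t / 2) - 2 * pi * (x + t / 2) * hermite1 n (x + t / 2)"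
  let ?v' = "\<lambda>t. 2 * pi * (x - t / 2) * hermite1 m (x - t / 2) - 2 * sqrt pi * sqrt (real (Suc m)) * hermite1 (Suc m) (x - t / 2)"
  have "0 = (LINT t|lborel. (of_real (?u' t * hermite1 m (x - t / 2) - hermite1 n (x + t / 2) * ?v' t) / 2
      - \<i> * of_real (2 * pi * w) * of_real (hermite1 n (x + t / 2) * hermite1 m (x - t / 2))) * cis (- 2 * pi * (w * t)))"
    by (rule wigner1_integral_deriv[where u' = ?u' and v' = ?v', OF hermite1_deriv hermite1_deriv_up, symmetric])
  also have "\<dots> = (LINT t|lborel. of_real (sqrt pi) * of_real (sqrt (real (Suc m))) * J n (Suc m) t
      + of_real (sqrt pi) * of_real (sqrt (real n)) * J (n - 1) m t
      - of_real (2 * pi) * Complex x w * J n m t)"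
  proof (rule Bochner_Integration.integral_cong[OF refl])
    fix t
    have alg: "(of_real ((2 * r * b * U1 - 2 * pi * (x + t / 2) * U) * V - U * (2 * pi * (x - t / 2) * V - 2 * r * a * V1)) / 2
        - \<i> * of_real (2 * pi * w) * of_real (U * V)) * E =
      of_real r * of_real a * (of_real U * of_real V1 * E) + of_real r * of_real b * (of_real U1 * of_real V * E)
      - of_real (2 * pi) * Complex x w * (of_real U * of_real V * E)"
      for U V U1 V1 r a b :: real and E :: complex
    proof -
      have eq: "(2 * r * b * U1 - 2 * pi * (x + t / 2) * U) * V - U * (2 * pi * (x - t / 2) * V - 2 * r * a * V1)
          = 2 * (r * a * (U * V1) + r * b * (U1 * V) - 2 * pi * x * (U * V))"
        by (simp add: algebra_simps)
      have "complex_of_real ((2 * r * b * U1 - 2 * pi * (x + t / 2) * U) * V - U * (2 * pi * (x - t / 2) * V - 2 * r * a * V1)) / 2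
          = of_real (r * a * (U * V1) + r * b * (U1 * V) - 2 * pi * x * (U * V))"
        unfolding eq by simp
      then show ?thesis
        by (simp only:) (simp add: Complex_eq algebra_simps)
    qed
    show "(of_real (?u' t * hermite1 m (x - t / 2) - hermite1 n (x + t / 2) * ?v' t) / 2
      - \<i> * of_real (2 * pi * w) * of_real (hermite1 n (x + t / 2) * hermite1 m (x - t / 2))) * cis (- 2 * pi * (w * t))
      = of_real (sqrt pi) * of_real (sqrt (real (Suc m))) * J n (Suc m) t
      + of_real (sqrt pi) * of_real (sqrt (real n)) * J (n - 1) m t
      - of_real (2 * pi) * Complex x w * J n m t"
      unfolding J_def by (rule alg)
  qed
  also have "\<dots> = of_real (sqrt pi) * of_real (sqrt (real (Suc m))) * wigner1 n (Suc m) x w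
      + of_real (sqrt pi) * of_real (sqrt (real n)) * wigner1 (n - 1) m x w
      - of_real (2 * pi) * Complex x w * wigner1 n m x w"
    using int by (simp add: W del: of_nat_Suc)
  also have "of_real (2 * pi) = complex_of_real (sqrt pi) * of_real (2 * sqrt pi)"
    unfolding of_real_mult[symmetric] by (rule arg_cong[where f = of_real]) simp
  finally have "complex_of_real (sqrt pi) * (of_real (sqrt (real (Suc m))) * wigner1 n (Suc m) x w) =
      complex_of_real (sqrt pi) * (of_real (2 * sqrt pi) * Complex x w * wigner1 n m x w - of_real (sqrt (real n)) * wigner1 (n - 1) m x w)"
    by (simp add: algebra_simps del: of_nat_Suc)
  then show ?thesis by simp
qed

text \<open>By the parallelogram law the two exponents add up to a function of \<open>x\<close> plus
  a function of \<open>t\<close>, which leaves the Fourier integral of a Gaussian.\<close>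

lemma wigner1_0_0: "wigner1 0 0 x w = of_real (2 * exp (- 2 * pi * (x\<^sup>2 + w\<^sup>2)))"
proof -
  have "hermite1c 0 (x + t / 2) * hermite1c 0 (x - t / 2) =
      of_real (sqrt 2 * exp (- 2 * pi * x\<^sup>2)) * of_real (exp (- (pi * t\<^sup>2 / 2)))" for t
  proof -
    have "hermite1 0 (x + t / 2) * hermite1 0 (x - t / 2) =
        (2 powr (1/4) * 2 powr (1/4)) * exp (- pi * (x + t / 2)\<^sup>2 + - pi * (x - t / 2)\<^sup>2)"
      by (simp add: hermite1_0 exp_add[symmetric] mult_exp_exp)
    also have "2 powr (1/4) * 2 powr (1/4) = sqrt (2::real)"
      by (simp add: powr_add[symmetric] powr_half_sqrt)
    also have "- pi * (x + t / 2)\<^sup>2 + - pi * (x - t / 2)\<^sup>2 = - 2 * pi * x\<^sup>2 + - (pi * t\<^sup>2 / 2)"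
      by (simp add: power2_eq_square field_simps)
    finally show ?thesis
      unfolding of_real_mult[symmetric] by (simp only: exp_add mult.assoc)
  qed
  then have "wigner1 0 0 x w = of_real (sqrt 2 * exp (- 2 * pi * x\<^sup>2)) *
      (LINT t|lborel. of_real (exp (- (pi * t\<^sup>2 / 2))) * cis (- 2 * pi * (w * t)))"
    unfolding wigner1_def by (simp add: mult.assoc)
  also have "\<dots> = of_real (sqrt 2 * exp (- 2 * pi * x\<^sup>2) * (sqrt 2 * exp (- 2 * pi * w\<^sup>2)))"
    unfolding integral_gauss_char by (simp only: of_real_mult)
  also have "sqrt 2 * exp (- 2 * pi * x\<^sup>2) * (sqrt 2 * exp (- 2 * pi * w\<^sup>2)) = 2 * exp (- 2 * pi * (x\<^sup>2 + w\<^sup>2))"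
    by (simp add: distrib_left exp_add exp_diff exp_minus field_simps)
  finally show ?thesis .
qed

text \<open>The polynomials \<open>\<Sum>\<^sub>k (-1)\<^sup>k y\<^sup>n\<^sup>-\<^sup>k z\<^sup>m\<^sup>-\<^sup>k / (k! (n-k)! (m-k)!)\<close>, the coefficients of
  \<open>exp (y s + z r - s r)\<close>; out of range terms are 0, so that index shifts need no case
  distinctions.\<close>

definition divided_power :: "complex \<Rightarrow> nat \<Rightarrow> nat \<Rightarrow> complex" where
  "divided_power y n k = (if k \<le> n then y ^ (n - k) / fact (n - k) else 0)"

definition ito_poly :: "nat \<Rightarrow> nat \<Rightarrow> complex \<Rightarrow> complex \<Rightarrow> complex" where
  "ito_poly n m y z = (\<Sum>k\<le>m. (- 1) ^ k / fact k * divided_power y n k * divided_power z m k)"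

text \<open>The boundary case \<open>k = Suc m\<close> is included: the left side is out of range
  and the right side has the factor 0. This lets a sum up to \<open>m\<close> be extended to
  \<open>Suc m\<close>.\<close>

lemma divided_power_Suc:
  assumes "k \<le> Suc m"
  shows "z * divided_power z m k = of_nat (Suc m - k) * divided_power z (Suc m) k"
proof (cases "k \<le> m")
  case True
  then have "Suc m - k = Suc (m - k)" by simp
  then show ?thesis using True by (simp add: divided_power_def del: of_nat_Suc)
qed (use assms in \<open>simp add: divided_power_def\<close>)

text \<open>Split the factor \<open>Suc m\<close> of the \<open>k\<close>-th term as
  \<open>(Suc m - k) + k\<close>. The first part amounts to multiplication by \<open>z\<close>; the
  second cancels against \<open>fact k\<close> and, after an index shift, gives the polynomial with
  \<open>n - 1\<close>.\<close>

lemma ito_poly_Suc: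
  "of_nat (Suc m) * ito_poly n (Suc m) y z =
     z * ito_poly n m y z - (if n = 0 then 0 else ito_poly (n - 1) m y z)"
proof -
  define T where "T k = (- 1) ^ k / fact k * divided_power y n k * divided_power z (Suc m) k" for k
  have "of_nat (Suc m) * ito_poly n (Suc m) y z = (\<Sum>k\<le>Suc m. of_nat (Suc m) * T k)"
    by (simp add: ito_poly_def T_def sum_distrib_left del: of_nat_Suc sum.atMost_Suc)
  also have "\<dots> = (\<Sum>k\<le>Suc m. of_nat (Suc m - k) * T k + of_nat k * T k)"
    by (intro sum.cong refl) (simp add: distrib_right[symmetric] of_nat_add[symmetric] del: of_nat_Suc of_nat_add)
  also have "\<dots> = (\<Sum>k\<le>Suc m. of_nat (Suc m - k) * T k) + (\<Sum>k\<le>Suc m. of_nat k * T k)"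
    by (rule sum.distrib)
  also have "(\<Sum>k\<le>Suc m. of_nat (Suc m - k) * T k) =
      (\<Sum>k\<le>Suc m. (- 1) ^ k / fact k * divided_power y n k * (z * divided_power z m k))"
    by (intro sum.cong refl) (simp add: T_def divided_power_Suc del: of_nat_Suc)
  also have "\<dots> = z * ito_poly n m y z"
    by (simp add: ito_poly_def sum_distrib_left divided_power_def mult_ac)
  also have "(\<Sum>k\<le>Suc m. of_nat k * T k) = (\<Sum>k\<le>m. of_nat (Suc k) * T (Suc k))"
    by (subst sum.atMost_Suc_shift) simp
  also have "\<dots> = - (if n = 0 then 0 else ito_poly (n - 1) m y z)"
  proof (cases n)
    case 0
    then show ?thesis by (simp add: T_def divided_power_def)
  next
    case (Suc l)
    have "of_nat (Suc k) * T (Suc k) = - ((- 1) ^ k / fact k * divided_power y l k * divided_power z m k)" for k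
    proof -
      have "of_nat (Suc k) * ((- 1) ^ Suc k / fact (Suc k)) = - ((- 1) ^ k / fact k :: complex)"
        by (simp del: of_nat_Suc)
      moreover have "divided_power y n (Suc k) = divided_power y l k"
        "divided_power z (Suc m) (Suc k) = divided_power z m k"
        by (simp_all add: divided_power_def Suc)
      ultimately show ?thesis
        unfolding T_def by (simp only: mult.assoc[symmetric]) simp
    qed
    then show ?thesis by (simp add: Suc ito_poly_def sum_negf del: of_nat_Suc)
  qed
  finally show ?thesis by simp
qed

text \<open>Reversing the sum by \<open>k = n - j\<close> gives both variables the exponent
  \<open>j\<close>, so that they combine to \<open>((norm z)\<^sup>2) ^ j\<close>, and splits off
  the sign \<open>(- 1) ^ n\<close>.\<close>

lemma ito_poly_diag: "fact n * ito_poly n n (cnj z) z = of_real ((- 1) ^ n * laguerre n ((norm z)\<^sup>2))"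
proof -
  have "fact n * ito_poly n n (cnj z) z =
      (\<Sum>k\<le>n. fact n * ((- 1) ^ k / fact k * divided_power (cnj z) n k * divided_power z n k))"
    by (simp add: ito_poly_def sum_distrib_left)
  also have "\<dots> = (\<Sum>j\<le>n. fact n * ((- 1) ^ (n - j) / fact (n - j) * divided_power (cnj z) n (n - j) * divided_power z n (n - j)))"
    by (rule sum.reindex_bij_witness[of _ "\<lambda>j. n - j" "\<lambda>j. n - j"]) auto
  also have "\<dots> = (\<Sum>j\<le>n. of_real ((- 1) ^ n * ((- 1) ^ j * real (n choose (n - j)) * ((norm z)\<^sup>2) ^ j / fact j)))"
  proof (rule sum.cong[OF refl])
    fix j assume "j \<in> {..n}"
    then have j: "j \<le> n" by simp
    have 1: "(- 1) ^ (n - j) = (- 1) ^ n * (- 1 :: complex) ^ j"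
    proof -
      have "(- 1 :: complex) ^ n = (- 1) ^ (n - j) * (- 1) ^ j"
        using j by (metis le_add_diff_inverse2 power_add)
      then show ?thesis by (simp add: mult.assoc power_mult_distrib[symmetric])
    qed
    have 2: "complex_of_real (real (n choose (n - j))) = fact n / (fact (n - j) * fact j)"
      using j by (simp add: binomial_fact binomial_symmetric[symmetric] mult.commute)
    have 3: "divided_power (cnj z) n (n - j) * divided_power z n (n - j) = of_real (((norm z)\<^sup>2) ^ j) / (fact j * fact j)"
    proof -
      have "divided_power (cnj z) n (n - j) * divided_power z n (n - j) = (z * cnj z) ^ j / (fact j * fact j)"
        using j by (simp add: divided_power_def power_mult_distrib mult.commute)
      then show ?thesis unfolding complex_norm_square[symmetric] by simp
    qed
    have "fact n * ((- 1) ^ (n - j) / fact (n - j) * divided_power (cnj z) n (n - j) * divided_power z n (n - j)) =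
      (- 1) ^ n * ((- 1) ^ j * (fact n / (fact (n - j) * fact j)) * of_real (((norm z)\<^sup>2) ^ j) / fact j)"
      unfolding mult.assoc[of _ "divided_power _ _ _"] 3 1 by (simp add: mult_ac)
    then show "fact n * ((- 1) ^ (n - j) / fact (n - j) * divided_power (cnj z) n (n - j) * divided_power z n (n - j)) =
      of_real ((- 1) ^ n * ((- 1) ^ j * real (n choose (n - j)) * ((norm z)\<^sup>2) ^ j / fact j))"
      unfolding 2[symmetric] by simp
  qed
  also have "\<dots> = of_real ((- 1) ^ n * laguerre n ((norm z)\<^sup>2))"
    by (simp add: laguerre_def sum_distrib_left atLeast0AtMost)
  finally show ?thesis .
qed

text \<open>A nonzero term has degree \<open>n - k\<close> in \<open>y\<close> and
  \<open>m - k\<close> in \<open>z\<close>; the difference does not depend on \<open>k\<close>, so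
  all terms acquire the same phase.\<close>

lemma ito_poly_rotate:
  "ito_poly n m (cis (- t) * y) (cis t * z) = cis (t * (real m - real n)) * ito_poly n m y z"
proof -
  have "divided_power (cis (- t) * y) n k * divided_power (cis t * z) m k =
      cis (t * (real m - real n)) * (divided_power y n k * divided_power z m k)" for k
  proof (cases "k \<le> n \<and> k \<le> m")
    case True
    have "cis (- t) ^ (n - k) * cis t ^ (m - k) = cis (t * (real m - real n))"
    proof -
      have "real (n - k) * - t + real (m - k) * t = t * (real m - real n)"
        using True by (simp add: of_nat_diff algebra_simps)
      then show ?thesis by (simp only: Complex.DeMoivre cis_mult)
    qed
    then show ?thesis
      using True by (simp add: divided_power_def power_mult_distrib)
  qed (auto simp: divided_power_def)
  then show ?thesis
    by (simp add: ito_poly_def sum_distrib_left mult.assoc mult.left_commute[of "cis _"])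
qed

text \<open>Both sides obey the same ladder relations. The one in \<open>n\<close> is used only at
  \<open>m = 0\<close>, where its lowering term has coefficient 0; the one in \<open>m\<close> then
  reaches all other indices.\<close>

lemma wigner1_eq:
  "wigner1 n m x w = of_real (2 * sqrt (fact n) * sqrt (fact m) * exp (- 2 * pi * (x\<^sup>2 + w\<^sup>2))) *
     ito_poly n m (of_real (2 * sqrt pi) * Complex x (- w)) (of_real (2 * sqrt pi) * Complex x w)"
proof -
  define y where "y = of_real (2 * sqrt pi) * Complex x (- w)"
  define z where "z = of_real (2 * sqrt pi) * Complex x w"
  define g where "g = complex_of_real (2 * exp (- 2 * pi * (x\<^sup>2 + w\<^sup>2)))"
  define s where "s n = complex_of_real (sqrt (fact n))" for n
  define q where "q n = complex_of_real (sqrt (real n))" for n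
  have s: "s (Suc n) = q (Suc n) * s n" for n
    by (simp add: s_def q_def real_sqrt_mult del: of_nat_Suc)
  have q: "q n * q n = of_nat n" for n
    unfolding q_def of_real_mult[symmetric] by simp
  have q0: "q (Suc n) \<noteq> 0" for n by (simp add: q_def del: of_nat_Suc)
  have L: "q (Suc n) * wigner1 (Suc n) m x w = y * wigner1 n m x w - q m * wigner1 n (m - 1) x w" for n m
    using wigner1_Suc_left[of n m x w] by (simp add: q_def y_def del: of_nat_Suc)
  have R: "q (Suc m) * wigner1 n (Suc m) x w = z * wigner1 n m x w - q n * wigner1 (n - 1) m x w" for n m
    using wigner1_Suc_right[of m n x w] by (simp add: q_def z_def del: of_nat_Suc)
  have "wigner1 n m x w = g * s n * s m * ito_poly n m y z"
  proof (induction m arbitrary: n)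
    case 0
    show ?case
    proof (induction n)
      case 0
      show ?case by (simp add: wigner1_0_0 g_def s_def ito_poly_def divided_power_def)
    next
      case (Suc n)
      have "q (Suc n) * wigner1 (Suc n) 0 x w = y * (g * s n * s 0 * ito_poly n 0 y z)"
        using L[of n 0] Suc by (simp add: q_def)
      also have "\<dots> = g * s n * s 0 * (of_nat (Suc n) * ito_poly (Suc n) 0 y z)"
        by (simp add: ito_poly_def divided_power_def field_simps del: of_nat_Suc)
      also have "\<dots> = q (Suc n) * (g * s (Suc n) * s 0 * ito_poly (Suc n) 0 y z)"
        unfolding s q[symmetric] by (simp only: mult_ac)
      finally show ?case using q0 by simp
    qed
  next
    case (Suc m)
    \<comment> \<open>For \<open>n = 0\<close> the factor \<open>q 0 = 0\<close> does what the case
      distinction in \<open>ito_poly_Suc\<close> does.\<close>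
    have *: "q n * s (n - 1) * ito_poly (n - 1) m y z = s n * (if n = 0 then 0 else ito_poly (n - 1) m y z)"
      by (cases n) (simp_all add: s q_def del: of_nat_Suc)
    have "q (Suc m) * wigner1 n (Suc m) x w =
        g * s n * s m * (z * ito_poly n m y z) - g * s m * (q n * s (n - 1) * ito_poly (n - 1) m y z)"
      unfolding R Suc.IH by (simp only: mult_ac)
    also have "\<dots> = g * s n * s m * (of_nat (Suc m) * ito_poly n (Suc m) y z)"
      unfolding * ito_poly_Suc by (simp add: algebra_simps)
    also have "\<dots> = q (Suc m) * (g * s n * s (Suc m) * ito_poly n (Suc m) y z)"
      unfolding s q[symmetric] by (simp only: mult_ac)
    finally show ?case using q0 by simp
  qed
  then show ?thesis by (simp add: g_def s_def y_def z_def mult_ac)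
qed

section \<open>Product Hermite functions and their Wigner distributions\<close>

lemma poly_fun_compose_inner:
  fixes p :: "real \<Rightarrow> complex"
  assumes "p \<in> poly_fun" shows "(\<lambda>x. p (x \<bullet> b)) \<in> poly_fun"
  using assms
proof (induction rule: poly_fun.induct)
  case (inner v)
  then show ?case using poly_fun.inner[of "v *\<^sub>R b"] by (simp add: mult.commute)
qed (auto intro: poly_fun.intros)

lemma poly_fun_vec_nth: "(\<lambda>x :: real ^ 'd::finite. of_real (x $ j)) \<in> poly_fun"
  using poly_fun.inner[of "axis j 1 :: real ^ 'd"] by (simp add: inner_axis)

text \<open>The Gaussian is assembled over all coordinates at once: a function of one coordinate
  alone has no decay in the others, so \<open>poly_gauss_mult\<close> cannot be applied factor by
  factor.\<close>

lemma hermite_poly_gauss: "hermite n \<in> poly_gauss"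
proof -
  obtain p where p: "\<And>k. p k \<in> poly_fun" "\<And>k t. hermite1c k t = p k t * exp (- of_real (pi * t\<^sup>2))"
    using hermite1c_poly by metis
  have "hermite n t = (\<Prod>j\<in>UNIV. p (n $ j) (t $ j)) * gaussian_exp pi 0 0 t" for t :: "real ^ 'a"
  proof -
    have "hermite n t = (\<Prod>j\<in>UNIV. p (n $ j) (t $ j)) * exp (\<Sum>j\<in>UNIV. - of_real (pi * (t $ j)\<^sup>2))"
      unfolding hermite_def of_real_prod p(2) prod.distrib by (simp add: exp_sum)
    also have "(\<Sum>j\<in>UNIV. - complex_of_real (pi * (t $ j)\<^sup>2)) = - of_real (pi * (t \<bullet> t))"
      by (simp add: sum_negf inner_vec_def power2_eq_square sum_distrib_left)
    finally show ?thesis by (simp add: gaussian_exp_def)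
  qed
  moreover have "(\<lambda>t :: real ^ 'a. \<Prod>j\<in>UNIV. p (n $ j) (t $ j)) \<in> poly_fun"
  proof (intro poly_fun_prod)
    fix j
    show "(\<lambda>t :: real ^ 'a. p (n $ j) (t $ j)) \<in> poly_fun"
      using poly_fun_compose_inner[OF p(1)[of "n $ j"], of "axis j 1 :: real ^ 'a"] by (simp add: inner_axis)
  qed
  ultimately show ?thesis by (intro poly_gaussI[of _ pi]) auto
qed

lemma cnj_hermite [simp]: "cnj (hermite n t) = hermite n t"
  by (simp add: hermite_def)

lemma hermite_minus: "hermite n (- t) = (- 1) ^ (\<Sum>j\<in>UNIV. n $ j) * hermite n t"
  by (simp add: hermite_def hermite1_minus prod.distrib power_sum)

lemma inner_2_hermite: "inner_2 (hermite n) (hermite m) = (if n = m then 1 else 0)"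
proof -
  have "inner_2 (hermite n) (hermite m) =
      (LINT t|lborel. (\<Prod>j\<in>UNIV. hermite1c (n $ j) (t $ j) * hermite1c (m $ j) (t $ j)))"
    by (simp add: inner_2_def) (simp add: hermite_def prod.distrib)
  also have "\<dots> = (\<Prod>j\<in>UNIV. if n $ j = m $ j then 1 else 0)"
    by (subst integral_vec_prod, intro poly_gauss_integrable poly_gauss_mult hermite1c_poly_gauss)
      (simp add: hermite1_orthonormal)
  also have "\<dots> = (if n = m then 1 else 0)"
    by (auto simp: vec_eq_iff)
  finally show ?thesis .
qed

lemma wigner_hermite:
  "wigner (hermite n) (hermite m) z = (\<Prod>j\<in>UNIV. wigner1 (n $ j) (m $ j) (fst z $ j) (snd z $ j))"
proof -
  obtain x w where z: "z = (x, w)" by (cases z)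
  have "wigner (hermite n) (hermite m) z = (LINT t|lborel. (\<Prod>j\<in>UNIV. hermite1c (n $ j) (x $ j + t $ j / 2) *
      hermite1c (m $ j) (x $ j - t $ j / 2) * cis (- 2 * pi * (w $ j * t $ j))))"
    unfolding wigner_def z prod.case cnj_hermite
  proof (rule Bochner_Integration.integral_cong[OF refl])
    fix t
    have nth: "(x + (1/2) *\<^sub>R t) $ j = x $ j + t $ j / 2" "(x - (1/2) *\<^sub>R t) $ j = x $ j - t $ j / 2" for j
      by simp_all
    have "cis (- 2 * pi * (w \<bullet> t)) = (\<Prod>j\<in>UNIV. cis (- 2 * pi * (w $ j * t $ j)))"
      by (simp add: cis_conv_exp exp_sum[symmetric] inner_vec_def sum_distrib_left sum_negf)
    then show "hermite n (x + (1/2) *\<^sub>R t) * hermite m (x - (1/2) *\<^sub>R t) * cis (- 2 * pi * (w \<bullet> t)) =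
       (\<Prod>j\<in>UNIV. hermite1c (n $ j) (x $ j + t $ j / 2) * hermite1c (m $ j) (x $ j - t $ j / 2) *
          cis (- 2 * pi * (w $ j * t $ j)))"
      by (simp only: hermite_def nth prod.distrib of_real_prod)
  qed
  also have "\<dots> = (\<Prod>j\<in>UNIV. wigner1 (n $ j) (m $ j) (fst z $ j) (snd z $ j))"
    unfolding wigner1_def z fst_conv snd_conv
    by (rule integral_vec_prod) (intro poly_gauss_integrable wigner1_integrand_poly_gauss)
  finally show ?thesis .
qed

text \<open>Read off the closed form, so Gaussian decay in both variables comes without estimating
  the Wigner integral.\<close>

lemma wigner_hermite_poly_gauss:
  "wigner (hermite n) (hermite m) \<in> (poly_gauss :: ('d::finite phase \<Rightarrow> complex) set)"
proof -
  define p where "p j z = of_real (2 * sqrt (fact (n $ j)) * sqrt (fact (m $ j))) *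
      ito_poly (n $ j) (m $ j) (of_real (2 * sqrt pi) * Complex (fst z $ j) (- (snd z $ j)))
        (of_real (2 * sqrt pi) * Complex (fst z $ j) (snd z $ j))" for j and z :: "'d phase"
  have f: "(\<lambda>z :: 'd phase. of_real (fst z $ j)) \<in> poly_fun" for j
    using poly_fun.inner[of "(axis j 1, 0) :: 'd phase"] by (simp add: inner_prod_def inner_axis)
  have s: "(\<lambda>z :: 'd phase. of_real (snd z $ j)) \<in> poly_fun" for j
    using poly_fun.inner[of "(0, axis j 1) :: 'd phase"] by (simp add: inner_prod_def inner_axis)
  have dp: "(\<lambda>z. divided_power (f z) k l) \<in> poly_fun" if "f \<in> poly_fun" for f :: "'d phase \<Rightarrow> complex" and k l
    using poly_fun.mult[OF poly_fun.const[of "1 / fact (k - l)"] poly_fun_power[OF that, of "k - l"]]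
    by (cases "l \<le> k") (auto simp: divided_power_def intro: poly_fun.const)
  have C1: "(\<lambda>z :: 'd phase. of_real (2 * sqrt pi) * Complex (fst z $ j) (snd z $ j)) \<in> poly_fun" for j
    unfolding Complex_eq by (intro poly_fun.intros f s)
  have C2: "(\<lambda>z :: 'd phase. of_real (2 * sqrt pi) * Complex (fst z $ j) (- (snd z $ j))) \<in> poly_fun" for j
    using poly_fun_cnj[OF C1[of j]] by (simp add: complex_cnj)
  have p: "p j \<in> poly_fun" for j
    unfolding p_def[abs_def] ito_poly_def
    by (intro poly_fun.mult poly_fun.const poly_fun_sum dp C1 C2)
  show ?thesis
  proof (rule poly_gaussI[of "\<lambda>z. \<Prod>j\<in>UNIV. p j z" "2 * pi" _ 0 0])
    show "(\<lambda>z. \<Prod>j\<in>UNIV. p j z) \<in> poly_fun" by (intro poly_fun_prod p)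
    fix z :: "'d phase"
    have "wigner (hermite n) (hermite m) z =
        (\<Prod>j\<in>UNIV. p j z * exp (of_real (- 2 * pi * ((fst z $ j)\<^sup>2 + (snd z $ j)\<^sup>2))))"
      unfolding wigner_hermite wigner1_eq p_def
      by (intro prod.cong refl) (simp add: exp_of_real[symmetric] mult_ac)
    also have "\<dots> = (\<Prod>j\<in>UNIV. p j z) * exp (\<Sum>j\<in>UNIV. of_real (- 2 * pi * ((fst z $ j)\<^sup>2 + (snd z $ j)\<^sup>2)))"
      by (simp add: prod.distrib exp_sum)
    also have "(\<Sum>j\<in>UNIV. complex_of_real (- 2 * pi * ((fst z $ j)\<^sup>2 + (snd z $ j)\<^sup>2))) = - of_real (2 * pi * (z \<bullet> z))"
      unfolding of_real_sum[symmetric] of_real_minus[symmetric]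
      by (rule arg_cong[where f = of_real])
        (simp add: inner_prod_def inner_vec_def power2_eq_square sum.distrib[symmetric] sum_distrib_left sum_negf)
    finally show "wigner (hermite n) (hermite m) z = (\<Prod>j\<in>UNIV. p j z) * gaussian_exp (2 * pi) 0 0 z"
      by (simp add: gaussian_exp_def)
  qed simp
qed

definition rotation_character :: "nat ^ 'd::finite \<Rightarrow> nat ^ 'd \<Rightarrow> real ^ 'd \<Rightarrow> complex" where
  "rotation_character n m \<theta> = (\<Prod>j\<in>UNIV. cis (\<theta> $ j * (real (m $ j) - real (n $ j))))"

lemma poly_rotation_nth:
  "Complex (fst (poly_rotation \<theta> z) $ j) (snd (poly_rotation \<theta> z) $ j) =
     cis (\<theta> $ j) * Complex (fst z $ j) (snd z $ j)"
  by (simp add: poly_rotation_def of_C_def to_C_def complex_eq_iff)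

lemma wigner_hermite_rotate:
  "wigner (hermite n) (hermite m) (poly_rotation \<theta> z) =
     rotation_character n m \<theta> * wigner (hermite n) (hermite m) z"
proof -
  have "wigner1 k l (fst (poly_rotation \<theta> z) $ j) (snd (poly_rotation \<theta> z) $ j) =
     cis (\<theta> $ j * (real l - real k)) * wigner1 k l (fst z $ j) (snd z $ j)" for k l j
  proof -
    define \<zeta> where "\<zeta> = Complex (fst z $ j) (snd z $ j)"
    have e: "wigner1 k l x w = of_real (2 * sqrt (fact k) * sqrt (fact l) * exp (- 2 * pi * (norm (Complex x w))\<^sup>2)) *
        ito_poly k l (of_real (2 * sqrt pi) * cnj (Complex x w)) (of_real (2 * sqrt pi) * Complex x w)" for x w
      unfolding wigner1_eq by (simp add: complex_cnj cmod_power2)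
    have "ito_poly k l (of_real (2 * sqrt pi) * cnj (cis (\<theta> $ j) * \<zeta>)) (of_real (2 * sqrt pi) * (cis (\<theta> $ j) * \<zeta>)) =
       ito_poly k l (cis (- \<theta> $ j) * (of_real (2 * sqrt pi) * cnj \<zeta>)) (cis (\<theta> $ j) * (of_real (2 * sqrt pi) * \<zeta>))"
      by (simp add: cis_cnj mult_ac)
    also have "\<dots> = cis (\<theta> $ j * (real l - real k)) * ito_poly k l (of_real (2 * sqrt pi) * cnj \<zeta>) (of_real (2 * sqrt pi) * \<zeta>)"
      using ito_poly_rotate[of k l "\<theta> $ j"] by simp
    finally show ?thesis
      unfolding e poly_rotation_nth \<zeta>_def[symmetric] by (simp add: norm_mult)
  qed
  then show ?thesis
    by (simp add: wigner_hermite rotation_character_def prod.distrib)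
qed

lemma phase_action_eq: "phase_action z = (\<chi> j. 2 * pi * (poly_abs z $ j)\<^sup>2)"
  by (simp add: phase_action_def poly_abs_def to_C_def cmod_power2)

lemma wigner_hermite_diag:
  "wigner (hermite n) (hermite n) z =
     (- 1) ^ (\<Sum>j\<in>UNIV. n $ j) * (2 ^ CARD('d) * of_real (laguerre_weight n (phase_action z)))"
  for n :: "nat ^ 'd::finite"
proof -
  have w: "wigner1 k k x w = of_real ((- 1) ^ k * (2 * (laguerre k (2 * (2 * pi * (x\<^sup>2 + w\<^sup>2))) * exp (- (2 * pi * (x\<^sup>2 + w\<^sup>2))))))"
    for k x w
  proof -
    \<comment> \<open>Scaled so that \<open>(norm \<zeta>)\<^sup>2\<close> is twice the action
      \<open>2 * pi * (x\<^sup>2 + w\<^sup>2)\<close>, the argument of the Laguerre polynomial in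
      \<open>laguerre_weight\<close>.\<close>
    define \<zeta> where "\<zeta> = of_real (2 * sqrt pi) * Complex x w"
    have "cnj \<zeta> = of_real (2 * sqrt pi) * Complex x (- w)"
      by (simp add: \<zeta>_def complex_cnj)
    moreover have "(norm \<zeta>)\<^sup>2 = 2 * (2 * pi * (x\<^sup>2 + w\<^sup>2))"
      by (simp add: \<zeta>_def norm_mult power_mult_distrib cmod_power2)
    moreover have "complex_of_real (2 * sqrt (fact k) * sqrt (fact k) * exp (- 2 * pi * (x\<^sup>2 + w\<^sup>2))) * ito_poly k k (cnj \<zeta>) \<zeta>
        = of_real (2 * exp (- 2 * pi * (x\<^sup>2 + w\<^sup>2))) * (fact k * ito_poly k k (cnj \<zeta>) \<zeta>)"
    proof -
      have "2 * sqrt (fact k) * sqrt (fact k) * exp (- 2 * pi * (x\<^sup>2 + w\<^sup>2)) = 2 * exp (- 2 * pi * (x\<^sup>2 + w\<^sup>2)) * fact k"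
        by simp
      then show ?thesis by (simp only: of_real_mult of_real_fact mult.assoc)
    qed
    ultimately show ?thesis
      unfolding wigner1_eq \<zeta>_def[symmetric] ito_poly_diag by (simp add: ito_poly_diag mult_ac)
  qed
  show ?thesis
    unfolding wigner_hermite w
    by (simp add: laguerre_weight_def phase_action_def prod.distrib power_sum exp_sum sum_negf[symmetric]
        of_real_prod exp_of_real[symmetric] del: sum_negf)
qed

section \<open>Covariance under time-frequency shifts and rotations\<close>

lemma tf_shift_adj_poly_gauss:
  assumes "f \<in> poly_gauss" shows "tf_shift_adj z f \<in> poly_gauss"
proof -
  have "(\<lambda>t. cis (- 2 * pi * (fst z \<bullet> snd z) + t \<bullet> (- 2 * pi) *\<^sub>R snd z) * f (fst z + 1 *\<^sub>R t)) \<in> poly_gauss"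
    by (intro poly_gauss_cis poly_gauss_affine assms) simp
  then show ?thesis
    by (simp add: tf_shift_adj_def[abs_def] inner_add_left algebra_simps)
qed

text \<open>The phases at the points \<open>y + t / 2\<close> and \<open>y - t / 2\<close> cancel
  under conjugation up to a character of \<open>t\<close>, which is absorbed as a shift of the
  frequency.\<close>

lemma wigner_tf_shift_adj:
  "wigner (tf_shift_adj z f) (tf_shift_adj z g) w = wigner f g (w + z)"
proof -
  obtain x \<omega> where z: "z = (x, \<omega>)" by (cases z)
  obtain y \<eta> where w: "w = (y, \<eta>)" by (cases w)
  have "cis (- 2 * pi * ((y + (1/2) *\<^sub>R t + x) \<bullet> \<omega>)) * cnj (cis (- 2 * pi * ((y - (1/2) *\<^sub>R t + x) \<bullet> \<omega>))) *
      cis (- 2 * pi * (\<eta> \<bullet> t)) = cis (- 2 * pi * ((\<eta> + \<omega>) \<bullet> t))" for t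
    unfolding cis_cnj cis_mult
    by (rule arg_cong[where f = cis]) (simp add: inner_simps inner_commute algebra_simps)
  note phase = this
  have "tf_shift_adj z f (y + (1/2) *\<^sub>R t) * cnj (tf_shift_adj z g (y - (1/2) *\<^sub>R t)) * cis (- 2 * pi * (\<eta> \<bullet> t)) =
      f ((y + x) + (1/2) *\<^sub>R t) * cnj (g ((y + x) - (1/2) *\<^sub>R t)) * cis (- 2 * pi * ((\<eta> + \<omega>) \<bullet> t))" for t
  proof -
    have shift: "y + (1/2) *\<^sub>R t + x = (y + x) + (1/2) *\<^sub>R t" "y - (1/2) *\<^sub>R t + x = (y + x) - (1/2) *\<^sub>R t"
      by simp_all
    have "P * U * cnj (Q * V) * E = U * cnj V * (P * cnj Q * E)" for P Q U V E :: complex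
      by simp
    from this[of "cis (- 2 * pi * ((y + (1/2) *\<^sub>R t + x) \<bullet> \<omega>))"]
    show ?thesis
      unfolding tf_shift_adj_def z fst_conv snd_conv phase[symmetric] unfolding shift by this
  qed
  then show ?thesis
    by (simp only: wigner_def w z prod.case add_Pair)
qed

text \<open>Time-frequency shifts commute up to the symplectic character. In the integral this
  appears by translating \<open>t\<close> by \<open>- x\<close>.\<close>

lemma fourier_wigner_tf_shift_adj:
  assumes [measurable]: "f \<in> borel_measurable borel" "g \<in> borel_measurable borel"
  shows "fourier_wigner_rank1 (tf_shift_adj z g) (tf_shift_adj z f) \<zeta> =
     cis (2 * pi * (fst z \<bullet> snd \<zeta> - fst \<zeta> \<bullet> snd z)) * fourier_wigner_rank1 g f \<zeta>"
proof -
  obtain x \<omega> where z: "z = (x, \<omega>)" by (cases z)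
  obtain y \<eta> where w: "\<zeta> = (y, \<eta>)" by (cases \<zeta>)
  have 1: "tf_shift (- \<zeta>) (tf_shift_adj z g) t * cnj (tf_shift_adj z f t) =
      cis (- 2 * pi * (y \<bullet> \<omega>) - 2 * pi * (t \<bullet> \<eta>)) * (g (t + y + x) * cnj (f (t + x)))" for t
  proof -
    have "cis (2 * pi * (t \<bullet> - \<eta>)) * cis (- 2 * pi * ((t + y + x) \<bullet> \<omega>)) * cnj (cis (- 2 * pi * ((t + x) \<bullet> \<omega>)))
        = cis (- 2 * pi * (y \<bullet> \<omega>) - 2 * pi * (t \<bullet> \<eta>))"
      unfolding cis_cnj cis_mult
      by (rule arg_cong[where f = cis]) (simp add: inner_simps algebra_simps)
    from this[symmetric] show ?thesis
      by (simp add: tf_shift_def tf_shift_adj_def z w mult_ac)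
  qed
  have "inner_2 (tf_shift (- \<zeta>) (tf_shift_adj z g)) (tf_shift_adj z f) =
      (LINT t|lborel. cis (- 2 * pi * (y \<bullet> \<omega>) - 2 * pi * (t \<bullet> \<eta>)) * (g (t + y + x) * cnj (f (t + x))))"
    unfolding inner_2_def 1 ..
  also have "\<dots> = \<bar>1\<bar> ^ DIM(real ^ 'a) *\<^sub>R (LINT t|lborel. cis (- 2 * pi * (y \<bullet> \<omega>) - 2 * pi * ((- x + 1 *\<^sub>R t) \<bullet> \<eta>)) *
      (g ((- x + 1 *\<^sub>R t) + y + x) * cnj (f ((- x + 1 *\<^sub>R t) + x))))"
  proof (rule integral_affine)
    have [measurable]: "cis \<in> borel_measurable borel"
      by (intro borel_measurable_continuous_onI continuous_intros)
    have [measurable]: "cnj \<in> borel_measurable borel"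
      by (intro borel_measurable_continuous_onI continuous_intros)
    show "(\<lambda>t. cis (- 2 * pi * (y \<bullet> \<omega>) - 2 * pi * (t \<bullet> \<eta>)) * (g (t + y + x) * cnj (f (t + x)))) \<in> borel_measurable borel"
      by measurable
  qed simp
  also have "\<dots> = (LINT t|lborel. cis (2 * pi * (x \<bullet> \<eta> - y \<bullet> \<omega>)) * (cis (2 * pi * (t \<bullet> - \<eta>)) * (g (t + y) * cnj (f t))))"
  proof -
    have "cis (- 2 * pi * (y \<bullet> \<omega>) - 2 * pi * ((- x + 1 *\<^sub>R t) \<bullet> \<eta>)) =
        cis (2 * pi * (x \<bullet> \<eta> - y \<bullet> \<omega>)) * cis (2 * pi * (t \<bullet> - \<eta>))" for t
      unfolding cis_mult by (rule arg_cong[where f = cis]) (simp add: inner_simps algebra_simps)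
    then show ?thesis by (simp add: mult.assoc)
  qed
  also have "\<dots> = cis (2 * pi * (x \<bullet> \<eta> - y \<bullet> \<omega>)) * inner_2 (tf_shift (- \<zeta>) g) f"
    by (simp add: inner_2_def tf_shift_def w mult.assoc)
  finally show ?thesis
    by (simp add: fourier_wigner_rank1_def z w)
qed

text \<open>The two transforms differ by a reflection of the second function and a dilation by 2.
  Hermite functions have a parity, so the reflection costs only a sign and no symplectic Fourier
  transform has to be computed; the dilation causes the power of 2.\<close>

lemma fourier_wigner_hermite:
  "fourier_wigner_rank1 (hermite m) (hermite n) \<zeta> =
     (- 1) ^ (\<Sum>j\<in>UNIV. n $ j) / 2 ^ CARD('d) * wigner (hermite m) (hermite n) ((1/2) *\<^sub>R \<zeta>)"
  for n m :: "nat ^ 'd::finite"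
proof -
  obtain x w where z: "\<zeta> = (x, w)" by (cases \<zeta>)
  define J where "J s = hermite m (s + (1/2) *\<^sub>R x) * hermite n (s - (1/2) *\<^sub>R x) * cis (- 2 * pi * (w \<bullet> s))" for s
  have [measurable]: "hermite k \<in> borel_measurable borel" for k :: "nat ^ 'd"
    by (intro poly_gauss_measurable hermite_poly_gauss)
  have [measurable]: "cis \<in> borel_measurable borel"
    by (intro borel_measurable_continuous_onI continuous_intros)
  have "inner_2 (tf_shift (- \<zeta>) (hermite m)) (hermite n) =
      (LINT t|lborel. cis (2 * pi * (t \<bullet> - w)) * hermite m (t + x) * hermite n t)"
    by (simp add: inner_2_def tf_shift_def z)
  \<comment> \<open>The translation by half of \<open>x\<close> symmetrizes the integrand; the phase
    it creates cancels the prefactor of the Fourier-Wigner transform.\<close>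
  also have "\<dots> = \<bar>1\<bar> ^ DIM(real ^ 'd) *\<^sub>R (LINT s|lborel. cis (2 * pi * ((- (1/2) *\<^sub>R x + 1 *\<^sub>R s) \<bullet> - w)) *
      hermite m ((- (1/2) *\<^sub>R x + 1 *\<^sub>R s) + x) * hermite n (- (1/2) *\<^sub>R x + 1 *\<^sub>R s))"
    by (rule integral_affine) simp_all
  also have "\<dots> = (LINT s|lborel. cis (pi * (x \<bullet> w)) * J s)"
  proof -
    have a: "s - (1/2) *\<^sub>R x + x = s + (1/2) *\<^sub>R x" "- (1/2) *\<^sub>R x + 1 *\<^sub>R s = s - (1/2) *\<^sub>R x" for s
      by (simp_all add: vec_eq_iff)
    have "cis (2 * pi * ((s - (1/2) *\<^sub>R x) \<bullet> - w)) = cis (pi * (x \<bullet> w)) * cis (- 2 * pi * (w \<bullet> s))" for s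
      unfolding cis_mult by (rule arg_cong[where f = cis]) (simp add: inner_simps inner_commute algebra_simps)
    then show ?thesis unfolding a J_def by (simp add: mult_ac)
  qed
  finally have 1: "fourier_wigner_rank1 (hermite m) (hermite n) \<zeta> = (LINT s|lborel. J s)"
    by (simp add: fourier_wigner_rank1_def z mult.assoc[symmetric] cis_mult)
  have "wigner (hermite m) (hermite n) ((1/2) *\<^sub>R \<zeta>) =
      (LINT t|lborel. hermite m ((1/2) *\<^sub>R x + (1/2) *\<^sub>R t) * hermite n ((1/2) *\<^sub>R x - (1/2) *\<^sub>R t) *
        cis (- 2 * pi * (((1/2) *\<^sub>R w) \<bullet> t)))"
    by (simp add: wigner_def z)
  also have "\<dots> = \<bar>2\<bar> ^ DIM(real ^ 'd) *\<^sub>R (LINT t|lborel. hermite m ((1/2) *\<^sub>R x + (1/2) *\<^sub>R (0 + 2 *\<^sub>R t)) *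
      hermite n ((1/2) *\<^sub>R x - (1/2) *\<^sub>R (0 + 2 *\<^sub>R t)) * cis (- 2 * pi * (((1/2) *\<^sub>R w) \<bullet> (0 + 2 *\<^sub>R t))))"
    by (rule integral_affine) simp_all
  also have "\<dots> = 2 ^ CARD('d) * (LINT s|lborel. (- 1) ^ (\<Sum>j\<in>UNIV. n $ j) * J s)"
  proof -
    have "hermite n ((1/2) *\<^sub>R x - s) = (- 1) ^ (\<Sum>j\<in>UNIV. n $ j) * hermite n (s - (1/2) *\<^sub>R x)" for s
      using hermite_minus[of n "s - (1/2) *\<^sub>R x"] by simp
    moreover have "(1/2) *\<^sub>R (0 + 2 *\<^sub>R t) = t" "((1/2) *\<^sub>R w) \<bullet> (0 + 2 *\<^sub>R t) = w \<bullet> t"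
      for t :: "real ^ 'd" by simp_all
    moreover have "\<bar>2\<bar> ^ DIM(real ^ 'd) *\<^sub>R c = 2 ^ CARD('d) * c" for c :: complex
      by (simp add: scaleR_conv_of_real)
    ultimately show ?thesis
      by (simp only: J_def mult_ac add.commute)
  qed
  finally show ?thesis
    unfolding 1 by (simp add: mult.assoc[symmetric] power_mult_distrib[symmetric])
qed

lemma poly_rotation_scaleR: "poly_rotation \<theta> (c *\<^sub>R z) = c *\<^sub>R poly_rotation \<theta> z"
  by (simp add: poly_rotation_def of_C_def to_C_def vec_eq_iff prod_eq_iff algebra_simps)

text \<open>In each coordinate the form is the imaginary part of a conjugate times a complex number,
  where a common unimodular factor cancels.\<close>

lemma poly_rotation_symplectic:
  "fst (poly_rotation \<theta> z) \<bullet> snd (poly_rotation \<theta> \<zeta>) - fst (poly_rotation \<theta> \<zeta>) \<bullet> snd (poly_rotation \<theta> z) =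
   fst z \<bullet> snd \<zeta> - fst \<zeta> \<bullet> snd z"
proof -
  have *: "a $ j * d $ j - c $ j * b $ j = Im (cnj (Complex (a $ j) (b $ j)) * Complex (c $ j) (d $ j))"
    for a b c d :: "real ^ 'a" and j by simp
  have rot: "cnj (cis t * u) * (cis t * v) = cnj u * v" for t u v
  proof -
    have "cnj (cis t * u) * (cis t * v) = (cis (- t) * cis t) * (cnj u * v)"
      by (simp only: complex_cnj_mult cis_cnj mult_ac)
    then show ?thesis by (simp only: cis_mult) simp
  qed
  show ?thesis
    unfolding inner_vec_def sum_subtractf[symmetric] inner_real_def * poly_rotation_nth rot ..
qed

lemma poly_rotation_inner_self: "poly_rotation \<theta> z \<bullet> poly_rotation \<theta> z = z \<bullet> z"
proof -
  have *: "z \<bullet> z = (\<Sum>j\<in>UNIV. (norm (Complex (fst z $ j) (snd z $ j)))\<^sup>2)" for z :: "'a phase"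
    by (simp add: inner_prod_def inner_vec_def cmod_power2 sum.distrib) (simp add: power2_eq_square)
  show ?thesis unfolding *[of "poly_rotation \<theta> z"] *[of z] poly_rotation_nth by (simp add: norm_mult)
qed

lemma cnj_rotation_character: "cnj (rotation_character n m \<theta>) = rotation_character m n \<theta>"
  by (simp add: rotation_character_def cis_cnj algebra_simps)

lemma exists_rotation_character:
  assumes "n \<noteq> m" shows "\<exists>\<theta>. rotation_character n m \<theta> = - 1"
proof -
  obtain i where i: "n $ i \<noteq> m $ i" using assms by (auto simp: vec_eq_iff)
  \<comment> \<open>Only a coordinate in which the indices differ is rotated, by the angle that
    makes its factor \<open>cis pi\<close>; all other factors are \<open>cis 0\<close>.\<close>
  define \<theta> where "\<theta> = (\<chi> j. if j = i then pi / (real (m $ i) - real (n $ i)) else 0)"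
  have "rotation_character n m \<theta> = (\<Prod>j\<in>UNIV. if j = i then - 1 else 1)"
    unfolding rotation_character_def using i by (intro prod.cong refl) (auto simp: \<theta>_def)
  then show ?thesis by auto
qed

section \<open>Pairings\<close>

lemma tempered_distribution_cmult:
  assumes "tempered_distribution u" "f \<in> schwartz"
  shows "u (\<lambda>x. c * f x) = c * u f"
proof -
  have lin: "\<And>f g c. f \<in> schwartz \<Longrightarrow> g \<in> schwartz \<Longrightarrow> u (\<lambda>x. c * f x + g x) = c * u f + u g"
    using assms(1) unfolding tempered_distribution_def by blast
  have "(\<lambda>x. 0) \<in> poly_gauss"
    by (rule poly_gaussI[of "\<lambda>_. 0" 1 _ 0 0]) (auto intro: poly_fun.const)
  then have 0: "(\<lambda>x. 0) \<in> schwartz" using poly_gauss_schwartz by blast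
  \<comment> \<open>With both functions zero and coefficient 1, linearity says that the value is
    twice itself.\<close>
  have "u (\<lambda>x. 0) = 0" using lin[OF 0 0, of 1] by simp
  then show ?thesis using lin[OF assms(2) 0, of c] by simp
qed

text \<open>A cutoff with value 1 at the origin that depends only on \<open>x \<bullet> x\<close>,
  hence is unchanged by poly-rotations at every scale.\<close>

definition std_gauss :: "'a::euclidean_space \<Rightarrow> complex" where
  "std_gauss x = exp (- of_real (x \<bullet> x))"

lemma std_gauss_schwartz: "(std_gauss :: 'a::euclidean_space \<Rightarrow> complex) \<in> schwartz"
  and std_gauss_scaled_schwartz: "\<epsilon> \<noteq> 0 \<Longrightarrow> (\<lambda>x :: 'a. std_gauss (\<epsilon> *\<^sub>R x)) \<in> schwartz"
proof -
  have g: "std_gauss \<in> (poly_gauss :: ('a \<Rightarrow> complex) set)"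
    using poly_gauss_exp[of 1] by (simp add: std_gauss_def[abs_def])
  then show "std_gauss \<in> (schwartz :: ('a \<Rightarrow> complex) set)" using poly_gauss_schwartz by blast
  show "(\<lambda>x :: 'a. std_gauss (\<epsilon> *\<^sub>R x)) \<in> schwartz" if "\<epsilon> \<noteq> 0"
    using poly_gauss_affine[OF g that, of 0] poly_gauss_schwartz by auto
qed

lemma has_pairing_tendsto:
  assumes "has_pairing F h c"
  shows "((\<lambda>\<epsilon>. F (\<lambda>z. std_gauss (\<epsilon> *\<^sub>R z) * h z)) \<longlongrightarrow> c) (at_right (0::real))"
  using assms std_gauss_schwartz unfolding has_pairing_def by (auto simp: std_gauss_def)

lemma has_pairing_unique: "has_pairing F h c \<Longrightarrow> has_pairing F h d \<Longrightarrow> c = d"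
  by (rule tendsto_unique[OF _ has_pairing_tendsto has_pairing_tendsto]) simp

text \<open>With a rotation invariant cutoff the truncated function is again multiplied by
  \<open>\<kappa>\<close>, so the invariance of \<open>F\<close> forces the value 0 for every
  \<open>\<epsilon> > 0\<close>, before the limit is taken.\<close>

lemma has_pairing_rotation_eq_0:
  assumes F: "tempered_distribution F" "polyradial F" and h: "has_pairing F h c"
    and rot: "\<And>z. h (poly_rotation \<theta> z) = \<kappa> * h z" and "\<kappa> \<noteq> 1"
  shows "c = 0"
proof -
  have "F (\<lambda>z. std_gauss (\<epsilon> *\<^sub>R z) * h z) = 0" if "\<epsilon> > 0" for \<epsilon>
  proof -
    define f where "f z = std_gauss (\<epsilon> *\<^sub>R z) * h z" for z
    have f: "f \<in> schwartz"
      using h std_gauss_scaled_schwartz[of \<epsilon>] that unfolding has_pairing_def f_def by auto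
    have rot_f: "f (poly_rotation \<theta> z) = \<kappa> * f z" for z
      by (simp add: f_def std_gauss_def rot poly_rotation_inner_self poly_rotation_scaleR[symmetric])
    have "F (\<lambda>z. f (poly_rotation \<theta> z)) = F f"
      using F(2) f unfolding polyradial_def by blast
    then have "F (\<lambda>z. \<kappa> * f z) = F f"
      unfolding rot_f .
    then have "\<kappa> * F f = F f" using tempered_distribution_cmult[OF F(1) f] by simp
    then show ?thesis using \<open>\<kappa> \<noteq> 1\<close> by (simp add: f_def[abs_def])
  qed
  then have "\<forall>\<^sub>F \<epsilon> in at_right 0. F (\<lambda>z. std_gauss (\<epsilon> *\<^sub>R z) * h z) = 0"
    by (simp add: eventually_at_filter)
  then have "((\<lambda>\<epsilon>. F (\<lambda>z. std_gauss (\<epsilon> *\<^sub>R z) * h z)) \<longlongrightarrow> 0) (at_right (0::real))"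
    by (rule tendsto_eventually)
  from tendsto_unique[OF _ has_pairing_tendsto[OF h] this] show ?thesis by simp
qed

section \<open>Matrix coefficients of the mixed-state operator\<close>

lemma distr_inner_op_shift:
  "distr_inner (op_shift z S f) g = distr_inner (S (tf_shift_adj z f)) (tf_shift_adj z g)"
  by (simp add: op_shift_def tf_shift_distr_def distr_inner_def)

lemma distr_inner_op_shift_hermite_rotate:
  assumes "polyradial_operator S"
  shows "distr_inner (op_shift (poly_rotation \<theta> z) S (hermite n)) (hermite m) =
     rotation_character n m \<theta> * distr_inner (op_shift z S (hermite n)) (hermite m)"
proof -
  obtain b where b: "tempered_distribution b" "polyradial b"
    and Sb: "\<And>f g. f \<in> schwartz \<Longrightarrow> g \<in> schwartz \<Longrightarrow>
      distr_inner (S f) g = distr_inner b (fourier_wigner_rank1 g f)"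
    using assms unfolding polyradial_operator_def is_fourier_wigner_def by blast
  \<comment> \<open>The conjugate stems from \<open>distr_inner\<close>; it swaps the indices of the
    rotation character, which thus becomes \<open>rotation_character n m \<theta>\<close>.\<close>
  define \<Psi> where "\<Psi> z \<zeta> = cnj (cis (2 * pi * (fst z \<bullet> snd \<zeta> - fst \<zeta> \<bullet> snd z)) *
      fourier_wigner_rank1 (hermite m) (hermite n) \<zeta>)" for z \<zeta>
  have H: "distr_inner (op_shift z S (hermite n)) (hermite m) = b (\<Psi> z)" for z
  proof -
    have "tf_shift_adj z (hermite k) \<in> schwartz" for k
      using tf_shift_adj_poly_gauss[OF hermite_poly_gauss] poly_gauss_schwartz by blast
    then show ?thesis
      unfolding distr_inner_op_shift \<Psi>_def
      by (subst Sb) (auto simp: distr_inner_def fourier_wigner_tf_shift_adj hermite_poly_gauss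
          poly_gauss_measurable)
  qed
  have \<Psi>: "\<Psi> z \<in> poly_gauss" for z
  proof -
    have "(\<lambda>\<zeta>. wigner (hermite m) (hermite n) (0 + (1/2) *\<^sub>R \<zeta>)) \<in> poly_gauss"
      by (intro poly_gauss_affine wigner_hermite_poly_gauss) simp
    then have "fourier_wigner_rank1 (hermite m) (hermite n) \<in> poly_gauss"
      unfolding fourier_wigner_hermite[abs_def] by (intro poly_gauss_cmult) simp
    \<comment> \<open>For fixed \<open>z\<close> the symplectic form is linear in
      \<open>\<zeta>\<close>, so its character is a modulation with a frequency proportional to
      \<open>(- snd z, fst z)\<close>.\<close>
    then have "(\<lambda>\<zeta>. cis (0 + \<zeta> \<bullet> (2 * pi) *\<^sub>R (- snd z, fst z)) * fourier_wigner_rank1 (hermite m) (hermite n) \<zeta>) \<in> poly_gauss"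
      by (rule poly_gauss_cis)
    also have "(\<lambda>\<zeta>. cis (0 + \<zeta> \<bullet> (2 * pi) *\<^sub>R (- snd z, fst z)) * fourier_wigner_rank1 (hermite m) (hermite n) \<zeta>) =
        (\<lambda>\<zeta>. cis (2 * pi * (fst z \<bullet> snd \<zeta> - fst \<zeta> \<bullet> snd z)) * fourier_wigner_rank1 (hermite m) (hermite n) \<zeta>)"
      by (rule ext) (simp add: inner_prod_def inner_commute algebra_simps)
    finally show ?thesis unfolding \<Psi>_def[abs_def] by (rule poly_gauss_cnj)
  qed
  have \<Psi>s: "\<Psi> z \<in> schwartz" for z
    using \<Psi>[of z] poly_gauss_schwartz by blast
  have rot: "\<Psi> (poly_rotation \<theta> z) (poly_rotation \<theta> \<zeta>) = rotation_character n m \<theta> * \<Psi> z \<zeta>" for \<zeta>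
    unfolding \<Psi>_def poly_rotation_symplectic fourier_wigner_hermite poly_rotation_scaleR[symmetric]
      wigner_hermite_rotate
    by (simp add: cnj_rotation_character mult_ac)
  \<comment> \<open>Invariance of \<open>b\<close> lets the inner variable be rotated along with
    \<open>z\<close>; the symplectic form then does not change and only the rotation character is
    left.\<close>
  have "b (\<Psi> (poly_rotation \<theta> z)) = b (\<lambda>\<zeta>. \<Psi> (poly_rotation \<theta> z) (poly_rotation \<theta> \<zeta>))"
  proof -
    have "b (\<lambda>\<zeta>. \<Psi> (poly_rotation \<theta> z) (poly_rotation \<theta> \<zeta>)) = b (\<Psi> (poly_rotation \<theta> z))"
      using b(2) \<Psi>s[of "poly_rotation \<theta> z"] unfolding polyradial_def by blast
    then show ?thesis by (rule sym)
  qed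
  also have "\<dots> = rotation_character n m \<theta> * b (\<Psi> z)"
    unfolding rot by (rule tempered_distribution_cmult[OF b(1) \<Psi>s])
  finally show ?thesis unfolding H .
qed

lemma mixed_state_op_hermite_offdiag:
  fixes n m :: "nat ^ 'd::finite"
  assumes S: "polyradial_operator S" and F: "tempered_distribution F" "polyradial F"
    and T: "is_mixed_state_op F S T" and "n \<noteq> m"
  shows "inner_2 (T (hermite n)) (hermite m) = 0"
proof -
  obtain \<theta> where \<theta>: "rotation_character n m \<theta> = - 1"
    using exists_rotation_character[OF \<open>n \<noteq> m\<close>] by blast
  have "hermite k \<in> schwartz" for k :: "nat ^ 'd"
    using hermite_poly_gauss poly_gauss_schwartz by blast
  then have "has_pairing F (\<lambda>z. distr_inner (op_shift z S (hermite n)) (hermite m)) (inner_2 (T (hermite n)) (hermite m))"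
    using T unfolding is_mixed_state_op_def by blast
  from has_pairing_rotation_eq_0[OF F this distr_inner_op_shift_hermite_rotate[OF S, of \<theta>]]
  show ?thesis by (simp add: \<theta>)
qed

lemma mixed_state_op_hermite_diag:
  fixes n :: "nat ^ 'd::finite"
  assumes T: "is_mixed_state_op F S T" and a: "is_weyl_symbol S a" and G: "is_convolution F a G"
  shows "inner_2 (T (hermite n)) (hermite n) = G (wigner (hermite n) (hermite n))"
proof -
  have sch: "hermite n \<in> schwartz" "tf_shift_adj z (hermite n) \<in> schwartz"
    "wigner (hermite n) (hermite n) \<in> schwartz" for z
    using hermite_poly_gauss poly_gauss_schwartz tf_shift_adj_poly_gauss wigner_hermite_poly_gauss by blast+
  have "distr_inner (op_shift z S (hermite n)) (hermite n) = a (\<lambda>w. wigner (hermite n) (hermite n) (w + z))" for z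
  proof -
    have "distr_inner (op_shift z S (hermite n)) (hermite n) =
        distr_inner a (wigner (tf_shift_adj z (hermite n)) (tf_shift_adj z (hermite n)))"
      unfolding distr_inner_op_shift using a sch(2)[of z] unfolding is_weyl_symbol_def by blast
    \<comment> \<open>By \<open>wigner_hermite_diag\<close> this Wigner distribution is real, which
      removes the conjugate in \<open>distr_inner\<close>.\<close>
    then show ?thesis
      by (simp add: distr_inner_def wigner_tf_shift_adj wigner_hermite_diag)
  qed
  moreover have "has_pairing F (\<lambda>z. distr_inner (op_shift z S (hermite n)) (hermite n)) (inner_2 (T (hermite n)) (hermite n))"
    using T sch(1) unfolding is_mixed_state_op_def by blast
  moreover have "has_pairing F (\<lambda>z. a (\<lambda>w. wigner (hermite n) (hermite n) (w + z))) (G (wigner (hermite n) (hermite n)))"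
    using G sch(3) unfolding is_convolution_def by blast
  ultimately show ?thesis using has_pairing_unique by simp
qed

section \<open>Completeness of the Hermite functions\<close>

lemma square_int_measurable: "f \<in> square_int \<Longrightarrow> f \<in> borel_measurable borel"
  by (simp add: square_int_def)

lemma square_int_mult_integrable:
  assumes "f \<in> square_int" "g \<in> square_int" shows "integrable lborel (\<lambda>x. f x * g x)"
proof (rule Bochner_Integration.integrable_bound)
  show "integrable lborel (\<lambda>x. (norm (f x))\<^sup>2 + (norm (g x))\<^sup>2)"
    using assms by (simp add: square_int_def)
  have "norm (f x * g x) \<le> norm ((norm (f x))\<^sup>2 + (norm (g x))\<^sup>2)" for x
  proof -
    have "norm (f x) * norm (g x) \<le> 2 * norm (f x) * norm (g x)" by simp
    also have "\<dots> \<le> (norm (f x))\<^sup>2 + (norm (g x))\<^sup>2" by (rule sum_squares_bound)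
    finally show ?thesis by (simp add: norm_mult)
  qed
  then show "AE x in lborel. norm (f x * g x) \<le> norm ((norm (f x))\<^sup>2 + (norm (g x))\<^sup>2)" by simp
  show "(\<lambda>x. f x * g x) \<in> borel_measurable lborel"
    using assms by (auto simp: square_int_def)
qed

lemma square_int_minus_cmult:
  assumes f: "f \<in> square_int" and g: "g \<in> square_int"
  shows "(\<lambda>x. f x - c * g x) \<in> square_int"
proof -
  have m [measurable]: "f \<in> borel_measurable borel" "g \<in> borel_measurable borel"
    using f g square_int_measurable by blast+
  have "integrable lborel (\<lambda>x. (norm (f x - c * g x))\<^sup>2)"
  proof (rule Bochner_Integration.integrable_bound)
    show "integrable lborel (\<lambda>x. 2 * (norm (f x))\<^sup>2 + (2 * (norm c)\<^sup>2) * (norm (g x))\<^sup>2)"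
      using f g by (simp add: square_int_def)
    have "norm ((norm (f x - c * g x))\<^sup>2) \<le> norm (2 * (norm (f x))\<^sup>2 + (2 * (norm c)\<^sup>2) * (norm (g x))\<^sup>2)" for x
    proof -
      have "(norm (f x - c * g x))\<^sup>2 \<le> (norm (f x) + norm c * norm (g x))\<^sup>2"
        using norm_triangle_ineq4[of "f x" "c * g x"] by (intro power_mono) (auto simp: norm_mult)
      also have "\<dots> \<le> 2 * (norm (f x))\<^sup>2 + 2 * (norm c * norm (g x))\<^sup>2"
        using sum_squares_bound[of "norm (f x)" "norm c * norm (g x)"] by (simp add: power2_sum)
      finally show ?thesis by (simp add: power_mult_distrib)
    qed
    then show "AE x in lborel. norm ((norm (f x - c * g x))\<^sup>2) \<le>
        norm (2 * (norm (f x))\<^sup>2 + (2 * (norm c)\<^sup>2) * (norm (g x))\<^sup>2)" by simp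
  qed measurable
  then show ?thesis by (simp add: square_int_def)
qed

lemma norm_exp_partial_sum_le:
  fixes z :: complex shows "norm (\<Sum>k<N. z ^ k /\<^sub>R fact k) \<le> exp (norm z)"
proof -
  have "norm (\<Sum>k<N. z ^ k /\<^sub>R fact k) \<le> (\<Sum>k<N. norm z ^ k /\<^sub>R fact k)"
    by (rule sum_norm_le) (simp add: norm_power)
  also have "\<dots> \<le> (\<Sum>k. norm z ^ k /\<^sub>R fact k)"
    by (rule sum_le_suminf[OF summable_exp_generic]) auto
  finally show ?thesis by (simp add: exp_def)
qed

lemma norm_gaussian_exp: "norm (gaussian_exp c 0 0 x) = exp (- (c * (x \<bullet> x)))"
  by (simp add: gaussian_exp_def norm_exp_eq_Re)

lemma poly_fun_gaussian: "p \<in> poly_fun \<Longrightarrow> c > 0 \<Longrightarrow> (\<lambda>x. p x * gaussian_exp c u v x) \<in> poly_gauss"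
  by (rule poly_gaussI) auto

lemma gaussian_exp_measurable [measurable]: "gaussian_exp c u v \<in> borel_measurable borel"
  unfolding gaussian_exp_def[abs_def] by (intro borel_measurable_continuous_onI continuous_intros)

lemma poly_fun_measurable: "p \<in> poly_fun \<Longrightarrow> p \<in> borel_measurable borel"
  by (intro borel_measurable_continuous_onI poly_fun_continuous)

text \<open>The partial sums of \<open>exp (q x)\<close> are polynomials, for which the integral
  vanishes. They are bounded by \<open>exp (A + B * (x \<bullet> x))\<close>, and
  \<open>B < c\<close> leaves a genuine Gaussian, so that the majorant is integrable against
  \<open>f\<close>.\<close>

lemma integral_exp_poly_eq_0:
  fixes f :: "'a::euclidean_space \<Rightarrow> complex"
  assumes f: "f \<in> square_int"
    and D: "\<And>p. p \<in> poly_fun \<Longrightarrow> (LINT x|lborel. f x * (p x * gaussian_exp c 0 0 x)) = 0"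
    and q: "q \<in> poly_fun" and bound: "\<And>x. norm (q x) \<le> A + B * (x \<bullet> x)" and "B < c"
    and p: "p \<in> poly_fun"
  shows "(LINT x|lborel. f x * (p x * (gaussian_exp c 0 0 x * exp (q x)))) = 0"
proof -
  have m [measurable]: "f \<in> borel_measurable borel" "p \<in> borel_measurable borel" "q \<in> borel_measurable borel"
    using f p q by (auto intro: square_int_measurable poly_fun_measurable)
  define s where "s N x = f x * (p x * (gaussian_exp c 0 0 x * (\<Sum>k<N. q x ^ k /\<^sub>R fact k)))" for N :: nat and x
  define w where "w x = exp A * norm (f x * (p x * gaussian_exp (c - B) 0 0 x))" for x
  have s0: "(LINT x|lborel. s N x) = 0" for N
  proof -
    have "(\<lambda>x. p x * (\<Sum>k<N. of_real (1 / fact k) * q x ^ k)) \<in> poly_fun"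
      by (intro poly_fun.mult p poly_fun_sum poly_fun.const poly_fun_power q)
    from D[OF this] show ?thesis
      by (simp add: s_def scaleR_conv_of_real mult_ac divide_inverse)
  qed
  have "(\<lambda>N. LINT x|lborel. s N x) \<longlonglongrightarrow> (LINT x|lborel. f x * (p x * (gaussian_exp c 0 0 x * exp (q x))))"
  proof (rule integral_dominated_convergence[where w = w])
    show "(\<lambda>x. f x * (p x * (gaussian_exp c 0 0 x * exp (q x)))) \<in> borel_measurable lborel"
      by simp
    show "s N \<in> borel_measurable lborel" for N
      unfolding s_def by simp
    show "integrable lborel w"
      unfolding w_def using \<open>B < c\<close>
      by (intro integrable_mult_right integrable_norm square_int_mult_integrable f
          poly_gauss_square_int poly_fun_gaussian p) simp
    show "AE x in lborel. (\<lambda>N. s N x) \<longlonglongrightarrow> f x * (p x * (gaussian_exp c 0 0 x * exp (q x)))"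
    proof (intro AE_I2)
      fix x
      show "(\<lambda>N. s N x) \<longlonglongrightarrow> f x * (p x * (gaussian_exp c 0 0 x * exp (q x)))"
        unfolding s_def using exp_converges[of "q x"] by (intro tendsto_intros) (simp add: sums_def)
    qed
    fix N
    show "AE x in lborel. norm (s N x) \<le> w x"
    proof (intro AE_I2)
      fix x
      have "norm (\<Sum>k<N. q x ^ k /\<^sub>R fact k) \<le> exp (A + B * (x \<bullet> x))"
        using norm_exp_partial_sum_le[of "q x" N] bound[of x] by (meson exp_le_cancel_iff order_trans)
      then have "norm (s N x) \<le> norm (f x) * (norm (p x) * (exp (- (c * (x \<bullet> x))) * exp (A + B * (x \<bullet> x))))"
        unfolding s_def norm_mult norm_gaussian_exp by (intro mult_left_mono) auto
      also have "exp (- (c * (x \<bullet> x))) * exp (A + B * (x \<bullet> x)) = exp A * exp (- ((c - B) * (x \<bullet> x)))"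
        by (simp add: mult_exp_exp algebra_simps)
      finally show "norm (s N x) \<le> w x"
        by (simp add: w_def norm_mult norm_gaussian_exp mult_ac)
    qed
  qed
  then have "(\<lambda>N. 0) \<longlonglongrightarrow> (LINT x|lborel. f x * (p x * (gaussian_exp c 0 0 x * exp (q x))))"
    unfolding s0 .
  then show ?thesis
    by (metis LIMSEQ_const_iff)
qed

text \<open>The majorant involves \<open>norm (q x)\<close>, so from the exponent \<open>b\<close>
  one expansion reaches only exponents below \<open>2 * b\<close>. A factor \<open>3/2\<close> is
  gained each time, and iteration makes the Gaussian arbitrarily narrow.\<close>

lemma integral_poly_gaussian_iterate:
  fixes f :: "'a::euclidean_space \<Rightarrow> complex"
  assumes f: "f \<in> square_int" and "c > 0"
    and D: "\<And>p. p \<in> poly_fun \<Longrightarrow> (LINT x|lborel. f x * (p x * gaussian_exp c 0 0 x)) = 0"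
    and p: "p \<in> poly_fun"
  shows "(LINT x|lborel. f x * (p x * gaussian_exp (c * (3/2) ^ k) 0 0 x)) = 0"
  using p
proof (induction k arbitrary: p)
  case 0
  then show ?case using D by simp
next
  case (Suc k)
  define b where "b = c * (3/2) ^ k"
  have b: "b > 0" using \<open>c > 0\<close> by (simp add: b_def)
  have q: "(\<lambda>x. of_real (- b / 2) * of_real (x \<bullet> x)) \<in> poly_fun"
    by (intro poly_fun.mult poly_fun.const poly_fun_inner_self)
  have "(LINT x|lborel. f x * (p x * (gaussian_exp b 0 0 x * exp (of_real (- b / 2) * of_real (x \<bullet> x))))) = 0"
  proof (rule integral_exp_poly_eq_0[OF f _ q _ _ Suc.prems, where A = 0 and B = "b / 2"])
    show "(LINT x|lborel. f x * (r x * gaussian_exp b 0 0 x)) = 0" if "r \<in> poly_fun" for r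
      unfolding b_def by (rule Suc.IH[OF that])
    show "norm (complex_of_real (- b / 2) * of_real (x \<bullet> x)) \<le> 0 + b / 2 * (x \<bullet> x)" for x :: 'a
      using b by (simp add: norm_mult abs_mult)
  qed (use b in auto)
  also have "(\<lambda>x :: 'a. gaussian_exp b 0 0 x * exp (of_real (- b / 2) * of_real (x \<bullet> x))) = gaussian_exp (c * (3/2) ^ Suc k) 0 0"
    by (rule ext) (simp add: gaussian_exp_def b_def mult_exp_exp field_simps)
  finally show ?case .
qed

text \<open>The factor \<open>gaussian_exp a\<close> stays the same while \<open>c\<close> grows, so
  that kernels of all widths are tested against one integrable function.\<close>

lemma integral_shifted_gaussian_eq_0:
  fixes f :: "'a::euclidean_space \<Rightarrow> complex"
  assumes f: "f \<in> square_int" and "0 < a" "a < c"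
    and D: "\<And>p. p \<in> poly_fun \<Longrightarrow> (LINT x|lborel. f x * (p x * gaussian_exp c 0 0 x)) = 0"
  shows "(LINT x|lborel. f x * gaussian_exp a 0 0 x * of_real (exp (- c * ((x - y) \<bullet> (x - y))))) = 0"
proof -
  \<comment> \<open>Half of the gap between \<open>a\<close> and \<open>c\<close>: a completed
    square bounds the linear term of \<open>q\<close> by \<open>d * (x \<bullet> x)\<close> plus a
    constant, and \<open>a + d < c\<close> still holds.\<close>
  define d where "d = (c - a) / 2"
  have d: "d > 0" using \<open>a < c\<close> by (simp add: d_def)
  define q where "q x = complex_of_real (- a) * of_real (x \<bullet> x) + of_real (x \<bullet> (2 * c) *\<^sub>R y)" for x
  have q: "q \<in> poly_fun"
    unfolding q_def by (intro poly_fun.intros poly_fun_inner_self)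
  have "(LINT x|lborel. f x * (1 * (gaussian_exp c 0 0 x * exp (q x)))) = 0"
  proof (rule integral_exp_poly_eq_0[OF f D q _ _ poly_fun.const])
    show "norm (q x) \<le> (c * norm y)\<^sup>2 / d + (a + d) * (x \<bullet> x)" for x
    proof -
      have "norm (q x) = \<bar>- a * (x \<bullet> x) + x \<bullet> (2 * c) *\<^sub>R y\<bar>"
        unfolding q_def of_real_mult[symmetric] of_real_add[symmetric] norm_of_real ..
      also have "\<dots> \<le> a * (x \<bullet> x) + \<bar>x \<bullet> (2 * c) *\<^sub>R y\<bar>"
      proof -
        have "0 \<le> a * (x \<bullet> x)" using \<open>0 < a\<close> by simp
        then show ?thesis by linarith
      qed
      also have "\<bar>x \<bullet> (2 * c) *\<^sub>R y\<bar> \<le> norm x * (2 * c * norm y)"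
        using Cauchy_Schwarz_ineq2[of x "(2 * c) *\<^sub>R y"] assms by simp
      also have "norm x * (2 * c * norm y) \<le> (c * norm y)\<^sup>2 / d + d * (x \<bullet> x)"
      proof -
        have "0 \<le> (c * norm y - d * norm x)\<^sup>2" by simp
        then have "d * (norm x * (2 * c * norm y)) \<le> (c * norm y)\<^sup>2 + d * d * (norm x)\<^sup>2"
          by (simp add: power2_eq_square algebra_simps)
        then show ?thesis
          using d by (simp add: field_simps power2_norm_eq_inner)
      qed
      finally show ?thesis by (simp add: algebra_simps)
    qed
    show "a + d < c" using \<open>a < c\<close> by (simp add: d_def field_simps)
  qed
  \<comment> \<open>This factor is constant in \<open>x\<close> and supplies the term that completes
    the square \<open>(x - y) \<bullet> (x - y)\<close>.\<close>
  then have "of_real (exp (- c * (y \<bullet> y))) * (LINT x|lborel. f x * (1 * (gaussian_exp c 0 0 x * exp (q x)))) = 0"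
    by simp
  also have "of_real (exp (- c * (y \<bullet> y))) * (LINT x|lborel. f x * (1 * (gaussian_exp c 0 0 x * exp (q x)))) =
      (LINT x|lborel. of_real (exp (- c * (y \<bullet> y))) * (f x * (1 * (gaussian_exp c 0 0 x * exp (q x)))))"
    by simp
  also have "(\<lambda>x. of_real (exp (- c * (y \<bullet> y))) * (f x * (1 * (gaussian_exp c 0 0 x * exp (q x))))) =
      (\<lambda>x. f x * gaussian_exp a 0 0 x * of_real (exp (- c * ((x - y) \<bullet> (x - y)))))"
  proof
    fix x
    have "of_real (exp (- c * (y \<bullet> y))) * (gaussian_exp c 0 0 x * exp (q x)) =
        gaussian_exp a 0 0 x * of_real (exp (- c * ((x - y) \<bullet> (x - y))))"
      unfolding gaussian_exp_def q_def exp_of_real[symmetric] mult_exp_exp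
      by (rule arg_cong[where f = exp]) (simp add: inner_simps inner_commute algebra_simps)
    then show "of_real (exp (- c * (y \<bullet> y))) * (f x * (1 * (gaussian_exp c 0 0 x * exp (q x)))) =
        f x * gaussian_exp a 0 0 x * of_real (exp (- c * ((x - y) \<bullet> (x - y))))"
      by (simp add: mult.left_commute[of _ "f x"] mult.assoc)
  qed
  finally show ?thesis .
qed

section \<open>Gaussian approximate identities and integrals over boxes\<close>

lemma AE_not_in_box_frontier: "AE x in lborel. x \<notin> cbox a b - box a b"
proof -
  have "emeasure lborel (cbox a b - box a b) = emeasure lborel (cbox a b) - emeasure lborel (box a b)"
    by (rule emeasure_Diff) (auto simp: box_subset_cbox emeasure_lborel_box_eq)
  also have "\<dots> = 0"
    by (auto simp: emeasure_lborel_box_eq emeasure_lborel_cbox_eq)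
  finally have "cbox a b - box a b \<in> null_sets lborel" by (simp add: null_sets_def)
  then show ?thesis by (rule AE_not_in)
qed

text \<open>The substitution moves the width of the kernel into the argument of \<open>g\<close>;
  the weight no longer depends on \<open>c\<close> and can serve as a majorant.\<close>

lemma gauss_kernel_scale:
  fixes x :: "'a::euclidean_space"
  assumes "c > 0" and [measurable]: "g \<in> borel_measurable borel"
  shows "(LINT y|lborel. g y * complex_of_real (exp (- c * ((x - y) \<bullet> (x - y))))) =
     (1 / sqrt c) ^ DIM('a) *\<^sub>R (LINT s|lborel. g (x + (1 / sqrt c) *\<^sub>R s) * of_real (exp (- (s \<bullet> s))))"
proof -
  have "(LINT y|lborel. g y * complex_of_real (exp (- c * ((x - y) \<bullet> (x - y))))) =
      \<bar>1 / sqrt c\<bar> ^ DIM('a) *\<^sub>R (LINT s|lborel. g (x + (1 / sqrt c) *\<^sub>R s) *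
        of_real (exp (- c * ((x - (x + (1 / sqrt c) *\<^sub>R s)) \<bullet> (x - (x + (1 / sqrt c) *\<^sub>R s))))))"
    using assms by (intro integral_affine) auto
  also have "(\<lambda>s. - c * ((x - (x + (1 / sqrt c) *\<^sub>R s)) \<bullet> (x - (x + (1 / sqrt c) *\<^sub>R s)))) = (\<lambda>s. - (s \<bullet> s))"
    using \<open>c > 0\<close> by (intro ext) (simp add: mult.assoc[symmetric])
  finally show ?thesis using \<open>c > 0\<close> by (simp add: fun_eq_iff)
qed

text \<open>Fubini moves the smoothing from \<open>h\<close>, which is merely integrable, to the
  indicator of the box. That indicator is bounded and locally constant off the null set
  \<open>cbox a b - box a b\<close>, so its smoothed versions converge almost everywhere.\<close>

lemma integral_gaussians_imp_box_eq_0: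
  fixes h :: "'a::euclidean_space \<Rightarrow> complex"
  assumes h: "integrable lborel h" and c: "filterlim c at_top sequentially" "\<And>k. c k > 0"
    and D: "\<And>k y. (LINT x|lborel. h x * of_real (exp (- c k * ((x - y) \<bullet> (x - y))))) = 0"
  shows "(LINT x:box a b|lborel. h x) = 0"
proof -
  have [measurable]: "h \<in> borel_measurable borel" using h by (simp add: borel_measurable_integrable)
  define g where "g y = complex_of_real (indicator (box a b) y)" for y
  have [measurable]: "g \<in> borel_measurable borel" unfolding g_def by simp
  have g1: "norm (g y) \<le> 1" for y by (simp add: g_def indicator_def)
  have g: "integrable lborel g"
    unfolding g_def by (intro integrable_of_real integrable_real_indicator) (auto simp: emeasure_lborel_box_eq)
  \<comment> \<open>The kernels are left unnormalized; the limit carries the factor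
    \<open>Z\<close>, which is divided out at the end because it is nonzero.\<close>
  define Z where "Z = (LINT s|lborel. complex_of_real (exp (- ((s :: 'a) \<bullet> s))))"
  define K where "K k x = (LINT s|lborel. g (x + (1 / sqrt (c k)) *\<^sub>R s) * complex_of_real (exp (- ((s :: 'a) \<bullet> s))))" for k x
  have gauss: "integrable lborel (\<lambda>s :: 'a. exp (- (s \<bullet> s)))"
    using integrable_gauss[of 1] by simp
  have K_bound: "norm (K k x) \<le> (LINT s|lborel. exp (- ((s :: 'a) \<bullet> s)))" for k x
    unfolding K_def
  proof (rule order_trans[OF integral_norm_bound], rule integral_mono_AE)
    show "integrable lborel (\<lambda>s. norm (g (x + (1 / sqrt (c k)) *\<^sub>R s) * complex_of_real (exp (- (s \<bullet> s)))))"
      by (rule Bochner_Integration.integrable_bound[OF gauss]) (auto simp: norm_mult intro!: mult_left_le_one_le g1)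
  qed (use gauss g1 in \<open>auto simp: norm_mult intro!: mult_left_le_one_le\<close>)
  have K_lim: "(\<lambda>k. K k x) \<longlonglongrightarrow> g x * Z" if x: "x \<notin> cbox a b - box a b" for x
  proof -
    have "(\<lambda>k. K k x) \<longlonglongrightarrow> (LINT s|lborel. g x * complex_of_real (exp (- ((s :: 'a) \<bullet> s))))"
      unfolding K_def
    proof (rule integral_dominated_convergence[where w = "\<lambda>s. exp (- (s \<bullet> s))"])
      show "AE s in lborel. (\<lambda>k. g (x + (1 / sqrt (c k)) *\<^sub>R s) * complex_of_real (exp (- (s \<bullet> s))))
          \<longlonglongrightarrow> g x * complex_of_real (exp (- (s \<bullet> s)))"
      proof (intro AE_I2 tendsto_intros)
        fix s :: 'a
        have "filterlim (\<lambda>k. sqrt (c k)) at_top sequentially"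
          using filterlim_compose[OF sqrt_at_top c(1)] .
        then have "(\<lambda>k. 1 / sqrt (c k)) \<longlonglongrightarrow> 0"
          by (intro tendsto_divide_0[OF tendsto_const] filterlim_at_top_imp_at_infinity)
        then have "(\<lambda>k. x + (1 / sqrt (c k)) *\<^sub>R s) \<longlonglongrightarrow> x + 0 *\<^sub>R s"
          by (intro tendsto_intros)
        then have lim: "(\<lambda>k. x + (1 / sqrt (c k)) *\<^sub>R s) \<longlonglongrightarrow> x" by simp
        have "\<forall>\<^sub>F k in sequentially. g (x + (1 / sqrt (c k)) *\<^sub>R s) = g x"
        proof (cases "x \<in> box a b")
          case True
          from topological_tendstoD[OF lim open_box True] show ?thesis
            by eventually_elim (use True in \<open>simp add: g_def\<close>)
        next
          case False
          with x have "x \<in> - cbox a b" by auto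
          from topological_tendstoD[OF lim open_Compl[OF closed_cbox] this] show ?thesis
          proof eventually_elim
            case (elim k)
            then have "x + (1 / sqrt (c k)) *\<^sub>R s \<notin> box a b" using box_subset_cbox[of a b] by blast
            then show ?case using False by (simp add: g_def)
          qed
        qed
        then show "(\<lambda>k. g (x + (1 / sqrt (c k)) *\<^sub>R s)) \<longlonglongrightarrow> g x" by (rule tendsto_eventually)
      qed
      show "AE s in lborel. norm (g (x + (1 / sqrt (c k)) *\<^sub>R s) * complex_of_real (exp (- (s \<bullet> s)))) \<le> exp (- (s \<bullet> s))" for k
        by (intro AE_I2) (auto simp: norm_mult intro!: mult_left_le_one_le g1)
    qed (use gauss in auto)
    then show ?thesis by (simp add: Z_def)
  qed
  have zero: "(LINT x|lborel. h x * K k x) = 0" for k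
  proof -
    define f where "f x y = h x * (g y * complex_of_real (exp (- c k * ((x - y) \<bullet> (x - y)))))" for x y
    have m: "(\<lambda>(x, y). f x y) \<in> borel_measurable (lborel \<Otimes>\<^sub>M lborel)"
    proof -
      have [measurable]: "(\<lambda>z :: 'a \<times> 'a. complex_of_real (exp (- c k * ((fst z - snd z) \<bullet> (fst z - snd z))))) \<in> borel_measurable borel"
        by (intro borel_measurable_continuous_onI continuous_intros)
      have [measurable]: "fst \<in> borel_measurable (borel :: ('a \<times> 'a) measure)"
        "snd \<in> borel_measurable (borel :: ('a \<times> 'a) measure)"
        by (intro borel_measurable_continuous_onI continuous_intros)+
      have "(\<lambda>z. h (fst z) * (g (snd z) * complex_of_real (exp (- c k * ((fst z - snd z) \<bullet> (fst z - snd z)))))) \<in> borel_measurable (borel :: ('a \<times> 'a) measure)"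
        by measurable
      then show ?thesis by (simp add: f_def lborel_prod case_prod_unfold)
    qed
    have i: "integrable (lborel \<Otimes>\<^sub>M lborel) (\<lambda>z. h (fst z) * g (snd z))"
    proof (rule lborel_pair.Fubini_integrable)
      show "integrable lborel (\<lambda>x. LINT y|lborel. norm (h (fst (x, y)) * g (snd (x, y))))"
        using h by (simp add: norm_mult)
      show "AE x in lborel. integrable lborel (\<lambda>y. h (fst (x, y)) * g (snd (x, y)))"
        using g by simp
    qed measurable
    have int: "integrable (lborel \<Otimes>\<^sub>M lborel) (\<lambda>(x, y). f x y)"
    proof (rule Bochner_Integration.integrable_bound[OF i m], intro AE_I2)
      fix z :: "'a \<times> 'a"
      have "norm (f (fst z) (snd z)) \<le> norm (h (fst z) * g (snd z))"
        unfolding f_def mult.assoc[symmetric] norm_mult[of "h (fst z) * g (snd z)"]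
        using c(2)[of k] by (intro mult_left_le) auto
      then show "norm (case z of (x, y) \<Rightarrow> f x y) \<le> norm (h (fst z) * g (snd z))"
        by (simp add: case_prod_unfold)
    qed
    have "(LINT x|lborel. LINT y|lborel. f x y) = (LINT y|lborel. LINT x|lborel. f x y)"
      using lborel_pair.integral_fst[OF int] lborel_pair.integral_snd[OF int] by simp
    also have "(\<lambda>y. LINT x|lborel. f x y) = (\<lambda>y. g y * (LINT x|lborel. h x * of_real (exp (- c k * ((x - y) \<bullet> (x - y))))))"
      by (rule ext) (simp add: f_def mult.left_commute del: of_real_exp)
    also have "(LINT y|lborel. g y * (LINT x|lborel. h x * of_real (exp (- c k * ((x - y) \<bullet> (x - y)))))) = 0"
      unfolding D by simp
    also have "(\<lambda>x. LINT y|lborel. f x y) = (\<lambda>x. h x * ((1 / sqrt (c k)) ^ DIM('a) *\<^sub>R K k x))"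
      unfolding f_def K_def by (rule ext) (simp only: gauss_kernel_scale[OF c(2), symmetric] \<open>g \<in> borel_measurable borel\<close> integral_mult_right_zero)
    finally have "(1 / sqrt (c k)) ^ DIM('a) *\<^sub>R (LINT x|lborel. h x * K k x) = 0"
      by (simp del: scaleR_conv_of_real)
    then show ?thesis using c(2)[of k] by simp
  qed
  have "(\<lambda>k. LINT x|lborel. h x * K k x) \<longlonglongrightarrow> (LINT x|lborel. h x * (g x * Z))"
  proof (rule integral_dominated_convergence[where w = "\<lambda>x. norm (h x) * (LINT s|lborel. exp (- ((s :: 'a) \<bullet> s)))"])
    show "AE x in lborel. (\<lambda>k. h x * K k x) \<longlonglongrightarrow> h x * (g x * Z)"
      using AE_not_in_box_frontier[of a b] by eventually_elim (intro tendsto_intros K_lim)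
    show "AE x in lborel. norm (h x * K k x) \<le> norm (h x) * (LINT s|lborel. exp (- ((s :: 'a) \<bullet> s)))" for k
      by (intro AE_I2) (auto simp: norm_mult intro!: mult_left_mono K_bound)
    show "integrable lborel (\<lambda>x. norm (h x) * (LINT s|lborel. exp (- ((s :: 'a) \<bullet> s))))"
      using h by simp
    show "(\<lambda>x. h x * K k x) \<in> borel_measurable lborel" for k
    proof -
      have "(\<lambda>(x, s). g (x + (1 / sqrt (c k)) *\<^sub>R s) * complex_of_real (exp (- ((s :: 'a) \<bullet> s)))) \<in> borel_measurable (lborel \<Otimes>\<^sub>M lborel)"
        by measurable
      then have "K k \<in> borel_measurable lborel"
        unfolding K_def by (rule lborel.borel_measurable_lebesgue_integral)
      then show ?thesis by simp
    qed
  qed measurable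
  then have "(LINT x|lborel. h x * (g x * Z)) = 0"
    unfolding zero by (simp add: LIMSEQ_const_iff)
  moreover have "Z \<noteq> 0"
  proof -
    have "(LINT s|lborel. exp (- ((s :: 'a) \<bullet> s))) \<noteq> 0"
    proof
      assume "(LINT s|lborel. exp (- ((s :: 'a) \<bullet> s))) = 0"
      then have "AE s in lborel. exp (- ((s :: 'a) \<bullet> s)) = 0"
        using integral_nonneg_eq_0_iff_AE[OF gauss] by simp
      then have "AE s in (lborel :: 'a measure). False" by simp
      then show False
        unfolding eventually_False ae_filter_eq_bot_iff by simp
    qed
    then show ?thesis unfolding Z_def by (simp add: integral_complex_of_real del: of_real_exp)
  qed
  ultimately have "(LINT x|lborel. h x * g x) = 0"
    by (simp add: mult.assoc[symmetric])
  then show ?thesis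
    by (simp add: set_lebesgue_integral_def g_def scaleR_conv_of_real mult.commute)
qed

text \<open>Dynkin's argument for the intersection stable family of open boxes. The whole space is
  not a box, so its integral is a separate hypothesis, consumed in the step for complements.\<close>

lemma AE_eq_0_if_box_integrals_eq_0:
  fixes h :: "'a::euclidean_space \<Rightarrow> complex"
  assumes h: "integrable lborel h" and box: "\<And>a b. (LINT x:box a b|lborel. h x) = 0"
    and total: "(LINT x|lborel. h x) = 0"
  shows "AE x in lborel. h x = 0"
proof (rule sigma_finite_measure.density_zero[OF lborel.sigma_finite_measure_axioms h])
  fix A :: "'a set" assume "A \<in> sets lborel"
  then have A: "A \<in> sigma_sets UNIV (range (\<lambda>(a, b). box a b))"
    by (simp add: borel_eq_box)
  have sets: "A \<in> sets lborel" if "A \<in> sigma_sets UNIV (range (\<lambda>(a, b). box a b))" for A :: "'a set"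
    using that by (simp add: borel_eq_box)
  have si: "set_integrable lborel A h" if "A \<in> sets lborel" for A
    using that h unfolding set_integrable_def by (intro integrable_mult_indicator)
  show "(LINT x:A|lborel. h x) = 0"
  proof (induction rule: sigma_sets_induct_disjoint[OF _ _ A])
    case 1
    show "Int_stable (range (\<lambda>(a, b). box a b :: 'a set))"
      by (auto simp: Int_stable_def box_Int_box)
  next
    case 2
    show ?case by simp
  next
    case (3 A)
    then show ?case using box by auto
  next
    case 4
    show ?case by (simp add: set_lebesgue_integral_def)
  next
    case (5 A)
    have "(LINT x|lborel. h x) = (LINT x:(UNIV - A) \<union> A|lborel. h x)"
      by (simp add: set_lebesgue_integral_def)
    also have "\<dots> = (LINT x:UNIV - A|lborel. h x) + (LINT x:A|lborel. h x)"
      using sets[OF 5(1)] by (intro set_integral_Un si) auto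
    finally show ?case using 5(2) total by simp
  next
    case (6 A)
    have m: "A i \<in> sets lborel" for i using 6(2) sets by blast
    have "(LINT x:(\<Union>i. A i)|lborel. h x) = (\<Sum>i. (LINT x:A i|lborel. h x))"
      using 6(1) m by (intro lebesgue_integral_countable_add si) (auto simp: disjoint_family_on_def)
    then show ?case using 6(3) by simp
  qed
qed

section \<open>From orthogonality to Hermite functions to orthogonality to Gaussians\<close>

lemma hermite_coordinate_mult:
  fixes n :: "nat ^ 'd::finite"
  shows "of_real (2 * sqrt pi) * (of_real (x $ j) * hermite n x) =
     of_real (sqrt (real (Suc (n $ j)))) * hermite (\<chi> i. if i = j then Suc (n $ j) else n $ i) x
     + of_real (sqrt (real (n $ j))) * hermite (\<chi> i. if i = j then n $ j - 1 else n $ i) x"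
proof -
  define P where "P = (\<Prod>i\<in>UNIV - {j}. hermite1 (n $ i) (x $ i))"
  have split: "hermite (\<chi> i. if i = j then k else n $ i) x = of_real (hermite1 k (x $ j) * P)" for k
  proof -
    have "(\<Prod>i\<in>UNIV. hermite1 ((\<chi> i. if i = j then k else n $ i) $ i) (x $ i)) =
        hermite1 k (x $ j) * (\<Prod>i\<in>UNIV - {j}. hermite1 ((\<chi> i. if i = j then k else n $ i) $ i) (x $ i))"
      by (subst prod.remove[of _ j]) auto
    also have "(\<Prod>i\<in>UNIV - {j}. hermite1 ((\<chi> i. if i = j then k else n $ i) $ i) (x $ i)) = P"
      unfolding P_def by (intro prod.cong) auto
    finally show ?thesis by (simp add: hermite_def)
  qed
  have "n = (\<chi> i. if i = j then n $ j else n $ i)" by (simp add: vec_eq_iff)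
  then have n: "hermite n x = of_real (hermite1 (n $ j) (x $ j) * P)" using split[of "n $ j"] by simp
  have "2 * sqrt pi * (x $ j * (hermite1 (n $ j) (x $ j) * P)) =
      sqrt (real (Suc (n $ j))) * (hermite1 (Suc (n $ j)) (x $ j) * P) +
      sqrt (real (n $ j)) * (hermite1 (n $ j - 1) (x $ j) * P)"
    unfolding mult.assoc[symmetric, of "sqrt (real (Suc (n $ j)))"] hermite1_Suc by (simp add: algebra_simps)
  then show ?thesis
    unfolding n split of_real_mult[symmetric] of_real_add[symmetric] by simp
qed

text \<open>The induction on \<open>q\<close> shows that multiplication by \<open>q\<close>
  preserves vanishing against all Hermite functions at once, for any polynomial prefactor
  \<open>p\<close>. In this form a product of polynomials is a composition, and a coordinate is
  absorbed by changing the Hermite index.\<close>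

lemma integral_poly_hermite_eq_0:
  fixes f :: "real ^ 'd::finite \<Rightarrow> complex"
  assumes f: "f \<in> square_int" and orth: "\<And>n. inner_2 f (hermite n) = 0" and q: "q \<in> poly_fun"
  shows "(LINT x|lborel. f x * (q x * hermite n x)) = 0"
proof -
  have int: "integrable lborel (\<lambda>x. f x * (p x * hermite n x))" if "p \<in> poly_fun" for p n
    by (intro square_int_mult_integrable f poly_gauss_square_int poly_gauss_poly_mult that hermite_poly_gauss)
  have "p \<in> poly_fun \<Longrightarrow> (\<And>n. (LINT x|lborel. f x * (p x * hermite n x)) = 0) \<Longrightarrow>
      (LINT x|lborel. f x * ((q x * p x) * hermite n x)) = 0" for p n
    using q
  proof (induction arbitrary: p n rule: poly_fun.induct)
    case (const c)
    have "(\<lambda>x. f x * ((c * p x) * hermite n x)) = (\<lambda>x. c * (f x * (p x * hermite n x)))"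
      by (rule ext) (simp add: mult_ac)
    then show ?case using const by simp
  next
    case (inner v)
    have coord: "(LINT x|lborel. f x * ((of_real (x $ j) * p x) * hermite n x)) = 0" for j
    proof -
      let ?up = "\<chi> i. if i = j then Suc (n $ j) else n $ i"
      let ?down = "\<chi> i. if i = j then n $ j - 1 else n $ i"
      have "of_real (2 * sqrt pi) * (LINT x|lborel. f x * ((of_real (x $ j) * p x) * hermite n x)) =
          (LINT x|lborel. f x * (p x * (of_real (2 * sqrt pi) * (of_real (x $ j) * hermite n x))))"
        by (subst integral_mult_right_zero[symmetric]) (simp add: mult_ac)
      also have "\<dots> = (LINT x|lborel. of_real (sqrt (real (Suc (n $ j)))) * (f x * (p x * hermite ?up x)) +
          of_real (sqrt (real (n $ j))) * (f x * (p x * hermite ?down x)))"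
        unfolding hermite_coordinate_mult by (simp add: algebra_simps del: of_nat_Suc)
      also have "\<dots> = of_real (sqrt (real (Suc (n $ j)))) * (LINT x|lborel. f x * (p x * hermite ?up x)) +
          of_real (sqrt (real (n $ j))) * (LINT x|lborel. f x * (p x * hermite ?down x))"
        using int[OF inner(1)] by (simp del: of_nat_Suc)
      also have "\<dots> = 0" using inner(2) by simp
      finally show ?thesis by simp
    qed
    have intj: "integrable lborel (\<lambda>x. f x * ((of_real (x $ j) * p x) * hermite n x))" for j
      by (intro int poly_fun.mult poly_fun_vec_nth inner)
    have "(\<lambda>x. f x * ((of_real (x \<bullet> v) * p x) * hermite n x)) =
        (\<lambda>x. \<Sum>j\<in>UNIV. of_real (v $ j) * (f x * ((of_real (x $ j) * p x) * hermite n x)))"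
      by (rule ext) (simp add: inner_vec_def sum_distrib_left sum_distrib_right mult_ac)
    then show ?case using coord intj by (simp add: integral_sum)
  next
    case (add q r)
    have "(\<lambda>x. f x * (((q x + r x) * p x) * hermite n x)) =
        (\<lambda>x. f x * ((q x * p x) * hermite n x) + f x * ((r x * p x) * hermite n x))"
      by (rule ext) (simp add: algebra_simps)
    moreover have "(LINT x|lborel. f x * ((q x * p x) * hermite n x) + f x * ((r x * p x) * hermite n x)) =
        (LINT x|lborel. f x * ((q x * p x) * hermite n x)) + (LINT x|lborel. f x * ((r x * p x) * hermite n x))"
      by (intro Bochner_Integration.integral_add int poly_fun.mult add)
    ultimately show ?case using add.IH[OF add.prems] by simp
  next
    case (mult q r)
    have "(LINT x|lborel. f x * ((q x * (r x * p x)) * hermite n x)) = 0"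
      by (rule mult.IH(1)[OF poly_fun.mult[OF mult.hyps(2) mult.prems(1)] mult.IH(2)[OF mult.prems]])
    then show ?case by (simp add: mult.assoc)
  qed
  from this[of "\<lambda>_. 1"] orth show ?thesis
    by (simp add: poly_fun.const inner_2_def)
qed

lemma hermite_complete:
  fixes f :: "real ^ 'd::finite \<Rightarrow> complex"
  assumes f: "f \<in> square_int" and orth: "\<And>n. inner_2 f (hermite n) = 0"
  shows "ae_eq f (\<lambda>x. 0)"
proof -
  define C where "C = complex_of_real (2 powr (1/4)) ^ CARD('d)"
  have C: "hermite 0 x = C * gaussian_exp pi 0 0 x" for x :: "real ^ 'd"
  proof -
    have "(\<Prod>j\<in>UNIV. exp (- pi * (x $ j)\<^sup>2)) = exp (- (pi * (x \<bullet> x)))"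
      by (simp add: exp_sum[symmetric] inner_vec_def sum_distrib_left sum_negf power2_eq_square)
    then show ?thesis
      by (simp add: hermite_def hermite1_0 prod.distrib C_def gaussian_exp_def exp_of_real[symmetric])
  qed
  have C0: "C \<noteq> 0" by (simp add: C_def)
  have D: "(LINT x|lborel. f x * (p x * gaussian_exp pi 0 0 x)) = 0" if "p \<in> poly_fun" for p
  proof -
    have "(LINT x|lborel. f x * (p x * hermite 0 x)) = C * (LINT x|lborel. f x * (p x * gaussian_exp pi 0 0 x))"
      unfolding C by (subst integral_mult_right_zero[symmetric]) (simp add: mult_ac)
    then show ?thesis using integral_poly_hermite_eq_0[OF f orth that, of 0] C0 by simp
  qed
  define h where "h x = f x * gaussian_exp pi 0 0 x" for x
  \<comment> \<open>The exponent is \<open>Suc k\<close> because the fixed factor of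
    \<open>h\<close> already has exponent \<open>pi\<close>, and the shifted Gaussians require
    \<open>pi < c k\<close> strictly.\<close>
  define c where "c k = pi * (3/2) ^ Suc k" for k
  have c: "c k > pi" for k
    using one_less_power[of "3/2 :: real" "Suc k"] by (simp add: c_def del: power_Suc)
  have h: "integrable lborel h"
    unfolding h_def[abs_def]
    by (intro square_int_mult_integrable f poly_gauss_square_int poly_gaussI[of "\<lambda>_. 1" pi]) (auto intro: poly_fun.const)
  have "AE x in lborel. h x = 0"
  proof (rule AE_eq_0_if_box_integrals_eq_0[OF h])
    show "(LINT x|lborel. h x) = 0"
      using D[of "\<lambda>_. 1"] by (simp add: h_def poly_fun.const)
    show "(LINT x:box a b|lborel. h x) = 0" for a b
    proof (rule integral_gaussians_imp_box_eq_0[OF h, of c])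
      show "filterlim c at_top sequentially"
        unfolding c_def by real_asymp
      show "c k > 0" for k using c[of k] pi_gt_zero by linarith
      show "(LINT x|lborel. h x * of_real (exp (- c k * ((x - y) \<bullet> (x - y))))) = 0" for k y
        unfolding h_def
      proof (rule integral_shifted_gaussian_eq_0[OF f pi_gt_zero c])
        show "(LINT x|lborel. f x * (p x * gaussian_exp (c k) 0 0 x)) = 0" if "p \<in> poly_fun" for p
          unfolding c_def by (rule integral_poly_gaussian_iterate[OF f pi_gt_zero D that])
      qed
    qed
  qed
  then show ?thesis
    by eventually_elim (simp add: h_def gaussian_exp_def)
qed

lemma hermite_square_int: "hermite n \<in> square_int"
  by (intro poly_gauss_square_int hermite_poly_gauss)

lemma hermite_orthonormal_basis:
  "L2_orthonormal_basis (hermite :: nat ^ 'd::finite \<Rightarrow> real ^ 'd \<Rightarrow> complex)"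
  unfolding L2_orthonormal_basis_def
  using hermite_square_int inner_2_hermite hermite_complete by blast

text \<open>The residual \<open>T (e i) - c * e i\<close> is orthogonal to the other basis elements
  by assumption and to \<open>e i\<close> by the choice of \<open>c\<close>, so completeness makes
  it vanish.\<close>

lemma L2_eigenpair_of_diagonal:
  fixes e :: "'i \<Rightarrow> 'a::euclidean_space \<Rightarrow> complex"
  assumes e: "L2_orthonormal_basis e" and T: "T (e i) \<in> square_int"
    and off: "\<And>j. j \<noteq> i \<Longrightarrow> inner_2 (T (e i)) (e j) = 0"
  shows "L2_eigenpair T (e i) (inner_2 (T (e i)) (e i))"
proof -
  define c where "c = inner_2 (T (e i)) (e i)"
  have e_sq: "e j \<in> square_int" and on: "inner_2 (e k) (e j) = (if k = j then 1 else 0)" for j k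
    using e unfolding L2_orthonormal_basis_def by blast+
  have cnj: "(\<lambda>x. cnj (e j x)) \<in> square_int" for j
  proof -
    have [measurable]: "e j \<in> borel_measurable borel" using e_sq square_int_measurable by blast
    have [measurable]: "cnj \<in> borel_measurable borel"
      by (intro borel_measurable_continuous_onI continuous_intros)
    have "(\<lambda>x. cnj (e j x)) \<in> borel_measurable borel" by measurable
    then show ?thesis using e_sq[of j] by (simp add: square_int_def)
  qed
  have "inner_2 (\<lambda>x. T (e i) x - c * e i x) (e j) = 0" for j
  proof -
    have "inner_2 (\<lambda>x. T (e i) x - c * e i x) (e j) =
        (LINT x|lborel. T (e i) x * cnj (e j x) - c * (e i x * cnj (e j x)))"
      by (simp add: inner_2_def algebra_simps)
    also have "\<dots> = inner_2 (T (e i)) (e j) - c * inner_2 (e i) (e j)"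
      unfolding inner_2_def
      by (subst Bochner_Integration.integral_diff, intro square_int_mult_integrable T cnj,
          intro integrable_mult_right square_int_mult_integrable e_sq cnj) simp
    also have "\<dots> = 0" using off[of j] by (auto simp: on c_def)
    finally show ?thesis .
  qed
  moreover have "(\<lambda>x. T (e i) x - c * e i x) \<in> square_int"
    by (intro square_int_minus_cmult T e_sq)
  ultimately have "ae_eq (\<lambda>x. T (e i) x - c * e i x) (\<lambda>x. 0)"
    using e unfolding L2_orthonormal_basis_def by blast
  then have "ae_eq (T (e i)) (\<lambda>x. c * e i x)" by simp
  moreover have "\<not> ae_eq (e i) (\<lambda>x. 0)"
  proof
    assume "ae_eq (e i) (\<lambda>x. 0)"
    then have "AE x in lborel. e i x * cnj (e i x) = 0"
      by eventually_elim simp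
    then have "inner_2 (e i) (e i) = 0"
      unfolding inner_2_def by (rule integral_eq_zero_AE)
    then show False by (simp add: on)
  qed
  ultimately show ?thesis
    unfolding L2_eigenpair_def c_def using e_sq by blast
qed

section \<open>The eigenvalues\<close>

text \<open>The diagonal Wigner formula is solved for the weight; the sign is its own
  inverse.\<close>

lemma laguerre_weight_schwartz: "(\<lambda>z :: 'd::finite phase. of_real (laguerre_weight n (phase_action z))) \<in> schwartz"
proof -
  have "(\<lambda>z :: 'd phase. ((- 1) ^ (\<Sum>j\<in>UNIV. n $ j) / 2 ^ CARD('d)) * wigner (hermite n) (hermite n) z) \<in> schwartz"
    using poly_gauss_cmult[OF wigner_hermite_poly_gauss] poly_gauss_schwartz by blast
  then show ?thesis
    by (simp add: wigner_hermite_diag mult.assoc[symmetric] power_mult_distrib[symmetric])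
qed

text \<open>The factor \<open>2 ^ CARD('d)\<close> of the diagonal Wigner distribution is exactly
  the one built into \<open>Vd_pairing\<close>.\<close>

lemma pairing_wigner_hermite:
  fixes n :: "nat ^ 'd::finite"
  assumes "tempered_distribution G"
  shows "G (wigner (hermite n) (hermite n)) = (- 1) ^ (\<Sum>j\<in>UNIV. n $ j) * Vd_pairing G (laguerre_weight n)"
proof -
  have "G (wigner (hermite n) (hermite n)) =
      G (\<lambda>z. ((- 1) ^ (\<Sum>j\<in>UNIV. n $ j) * 2 ^ CARD('d)) * of_real (laguerre_weight n (phase_action z)))"
    by (rule arg_cong[where f = G]) (simp add: wigner_hermite_diag fun_eq_iff)
  also have "\<dots> = ((- 1) ^ (\<Sum>j\<in>UNIV. n $ j) * 2 ^ CARD('d)) * G (\<lambda>z. of_real (laguerre_weight n (phase_action z)))"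
    by (rule tempered_distribution_cmult[OF assms laguerre_weight_schwartz])
  finally show ?thesis by (simp add: Vd_pairing_def phase_action_eq)
qed

lemma laguerre_weight_measurable: "laguerre_weight n \<in> borel_measurable borel"
  unfolding laguerre_weight_def[abs_def] laguerre_def
  by (intro borel_measurable_continuous_onI continuous_intros) auto

lemma
  fixes n :: "nat ^ 'd::finite"
  assumes [measurable]: "g \<in> borel_measurable borel"
    and G: "represented_by G (\<lambda>z :: 'd phase. g (poly_abs z))"
  shows set_integrable_laguerre_weight: "set_integrable lborel Vd
      (\<lambda>u. g (\<chi> j. sqrt (u $ j / (2 * pi))) * of_real (laguerre_weight n u))"
    and Vd_pairing_represented: "Vd_pairing G (laguerre_weight n) =
      (LINT u:Vd|lborel. g (\<chi> j. sqrt (u $ j / (2 * pi))) * of_real (laguerre_weight n u))"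
proof -
  define k where "k u = g (\<chi> j. sqrt (u $ j / (2 * pi))) * of_real (laguerre_weight n u)" for u
  have [measurable]: "(\<lambda>u :: real ^ 'd. \<chi> j. sqrt (u $ j / (2 * pi))) \<in> borel_measurable borel"
    by (intro measurable_vec_lambda) measurable
  note laguerre_weight_measurable [measurable]
  have k [measurable]: "k \<in> borel_measurable borel" unfolding k_def by measurable
  \<comment> \<open>The entries of \<open>poly_abs z\<close> are nonnegative, so the square root
    recovers them from their squares.\<close>
  have "(\<chi> j. sqrt (phase_action z $ j / (2 * pi))) = poly_abs z" for z :: "'d phase"
    by (simp add: phase_action_eq vec_eq_iff poly_abs_def)
  then have kz: "k (phase_action z) = g (poly_abs z) * of_real (laguerre_weight n (phase_action z))" for z
    by (simp add: k_def)
  have int: "integrable lborel (\<lambda>z :: 'd phase. k (phase_action z))"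
    and Gk: "G (\<lambda>z. of_real (laguerre_weight n (phase_action z))) = (LINT z|lborel. k (phase_action z))"
    unfolding kz
    using bspec[OF G[unfolded represented_by_def] laguerre_weight_schwartz[of n]] by simp_all
  show "set_integrable lborel Vd (\<lambda>u. g (\<chi> j. sqrt (u $ j / (2 * pi))) * of_real (laguerre_weight n u))"
    using set_integrable_phase_action[OF k int] by (simp add: k_def[abs_def])
  \<comment> \<open>The density \<open>(1/2) ^ CARD('d)\<close> of the image measure on
    \<open>Vd\<close> cancels the factor in the definition of the pairing.\<close>
  have "Vd_pairing G (laguerre_weight n) = 2 ^ CARD('d) * ((1/2) ^ CARD('d) *\<^sub>R (LINT u:Vd|lborel. k u))"
    unfolding Vd_pairing_def phase_action_eq[symmetric] Gk integral_phase_action[OF k int] ..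
  also have "\<dots> = (LINT u:Vd|lborel. k u)"
    by (simp add: scaleR_conv_of_real power_divide)
  finally show "Vd_pairing G (laguerre_weight n) =
      (LINT u:Vd|lborel. g (\<chi> j. sqrt (u $ j / (2 * pi))) * of_real (laguerre_weight n u))"
    by (simp add: k_def)
qed

theorem proposition5p4:
  fixes S :: "'d::finite tempered_op"
    and F a G :: "'d phase distr"
    and T :: "(real ^ 'd \<Rightarrow> complex) \<Rightarrow> (real ^ 'd \<Rightarrow> complex)"
  assumes "polyradial_operator S"
    and "tempered_distribution F" and "polyradial F"
    and "is_mixed_state_op F S T" and "compact_L2_operator T"
    and "is_weyl_symbol S a" and "is_convolution F a G"
  shows "L2_orthonormal_basis (hermite :: nat ^ 'd \<Rightarrow> real ^ 'd \<Rightarrow> complex) \<and>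
    (\<forall>n :: nat ^ 'd. \<exists>ev :: complex.
       L2_eigenpair T (hermite n) ev \<and>
       ev = G (wigner (hermite n) (hermite n)) \<and>
       ev = (- 1) ^ (\<Sum>j\<in>UNIV. n $ j) * Vd_pairing G (laguerre_weight n) \<and>
       (\<forall>g \<in> borel_measurable borel. represented_by G (\<lambda>z. g (poly_abs z)) \<longrightarrow>
          set_integrable lborel Vd
            (\<lambda>u. g (\<chi> j. sqrt (u $ j / (2 * pi))) * of_real (laguerre_weight n u)) \<and>
          ev = (- 1) ^ (\<Sum>j\<in>UNIV. n $ j) *
            (LINT u:Vd|lborel.
               g (\<chi> j. sqrt (u $ j / (2 * pi))) * of_real (laguerre_weight n u))))"
proof (intro conjI allI)
  show "L2_orthonormal_basis (hermite :: nat ^ 'd \<Rightarrow> real ^ 'd \<Rightarrow> complex)"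
    by (rule hermite_orthonormal_basis)
  fix n :: "nat ^ 'd"
  have "T (hermite n) \<in> square_int"
    using assms(5) hermite_square_int unfolding compact_L2_operator_def L2_operator_def by blast
  then have "L2_eigenpair T (hermite n) (inner_2 (T (hermite n)) (hermite n))"
    using mixed_state_op_hermite_offdiag[OF assms(1-4)]
    by (intro L2_eigenpair_of_diagonal hermite_orthonormal_basis) metis+
  then have eigen: "L2_eigenpair T (hermite n) (G (wigner (hermite n) (hermite n)))"
    unfolding mixed_state_op_hermite_diag[OF assms(4,6,7)] .
  have G: "tempered_distribution G" using assms(7) unfolding is_convolution_def by blast
  show "\<exists>ev. L2_eigenpair T (hermite n) ev \<and>
       ev = G (wigner (hermite n) (hermite n)) \<and>
       ev = (- 1) ^ (\<Sum>j\<in>UNIV. n $ j) * Vd_pairing G (laguerre_weight n) \<and>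
       (\<forall>g \<in> borel_measurable borel. represented_by G (\<lambda>z. g (poly_abs z)) \<longrightarrow>
          set_integrable lborel Vd
            (\<lambda>u. g (\<chi> j. sqrt (u $ j / (2 * pi))) * of_real (laguerre_weight n u)) \<and>
          ev = (- 1) ^ (\<Sum>j\<in>UNIV. n $ j) *
            (LINT u:Vd|lborel.
               g (\<chi> j. sqrt (u $ j / (2 * pi))) * of_real (laguerre_weight n u)))"
    using eigen pairing_wigner_hermite[OF G, of n] Vd_pairing_represented set_integrable_laguerre_weight
    by (intro exI[of _ "G (wigner (hermite n) (hermite n))"]) auto
qed

end
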